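(* Let $f\in\mathbb{R}[\mathbf{x}]$ attain its minimum $f^*=\min_{x\in\mathbb{R}^n}f(x)$ on $\mathbb{R}^n$. Let $V_{\mathbb{R}}(I_{grad}(f))=W_0\cup\dots\cup W_s$ be the decomposition into disjoint real subvarieties with $f(W_j)=\{f_j\}$, $f_0<f_1<\dots<f_s$, and let $p_0,\dots,p_s\in\mathbb{R}[\mathbf{x}]$ be polynomials such that $p_i$ is constantly equal to $\delta_{ij}$ (Kronecker delta) on $W_j$ for all $i,j$. Let $G\subset\mathbb{R}[\mathbf{x}]$ with $I_{grad}(f)\subset(G)\subset I_{min}(f)$. Then there exists $t_1\ge0$ such that for all $t\ge t_1$: $f^{sos}_{G,t}=f^\mu_{G,t}=f^*$, and for every $\Lambda^*\in\mathcal{L}_{G,t,\succcurlyeq}$ with $\Lambda^*(f)=f^\mu_{G,t}$ we have $p_i\in\ker H_{\Lambda^*}^t$ for all $i=1,\dots,s$.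
   Context: $\mathbb{R}[\mathbf{x}]=\mathbb{R}[x_1,\dots,x_n]$; $\mathbb{R}[\mathbf{x}]_t$ is the space of polynomials of degree $\le t$; $(S)$ is the ideal generated by $S$. $I_{grad}(f)=(\partial f/\partial x_1,\dots,\partial f/\partial x_n)$; $V_{\mathbb{R}}(I)$ is the set of common zeros of $I$ in $\mathbb{R}^n$; $I_{min}(f)$ is the ideal of all polynomials vanishing at every $\mathbf{x}^*\in\mathbb{R}^n$ with $f(\mathbf{x}^* )=f^*$. For $G\subset\mathbb{R}[\mathbf{x}]$ and $d\in\mathbb{N}$, $\langle G\,|\,d\rangle=\{\sum_{g\in G,\deg g\le d}p_g g\mid p_g\in\mathbb{R}[\mathbf{x}]_{d-\deg g}\}$ (finite sums). For $t$ with $2t\ge\deg f$ define $\mathcal{L}_{G,t,\succcurlyeq}=\{\Lambda\in(\mathbb{R}[\mathbf{x}]_{2t})^*\mid\Lambda(g)=0\ \forall g\in\langle G\,|\,2t\rangle,\ \Lambda(1)=1,\ \Lambda(p^2)\ge0\ \forall p\in\mathbb{R}[\mathbf{x}]_t\}$, $\mathcal{S}_{G,t}=\{\sum_ih_i^2+h\ (\text{finite sums})\mid h_i\in\mathbb{R}[\mathbf{x}]_t,\ h\in\langle G\,|\,2t\rangle\}$, $f^\mu_{G,t}=\inf\{\Lambda(f)\mid\Lambda\in\mathcal{L}_{G,t,\succcurlyeq}\}$, $f^{sos}_{G,t}=\sup\{\lambda\in\mathbb{R}\mid f-\lambda\in\mathcal{S}_{G,t}\}$ (with values $+\infty$, $-\infty$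 respectively if the set is empty), and $\ker H_\Lambda^t=\{p\in\mathbb{R}[\mathbf{x}]_t\mid\Lambda(pq)=0\ \forall q\in\mathbb{R}[\mathbf{x}]_t\}$. *)

theory Defs
  imports "HOL-Analysis.Analysis" "HOL-Library.Poly_Mapping"
begin

text \<open>Real polynomials in the variables indexed by the finite type \<open>'n\<close>: a polynomial maps each
  exponent vector to its coefficient, and \<open>HOL-Library.Poly_Mapping\<close> supplies the convolution ring
  structure. The number of variables is \<open>CARD('n)\<close>, and points are vectors in \<open>real ^ 'n\<close>.\<close>

type_synonym 'n rpoly = "('n \<Rightarrow>\<^sub>0 nat) \<Rightarrow>\<^sub>0 real"

definition const_poly :: "real \<Rightarrow> 'n::finite rpoly" where
  "const_poly c = Poly_Mapping.single 0 c"

definition eval_poly :: "'n::finite rpoly \<Rightarrow> real ^ 'n \<Rightarrow> real" where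
  "eval_poly p x =
    (\<Sum>m\<in>Poly_Mapping.keys p. Poly_Mapping.lookup p m * (\<Prod>i\<in>UNIV. (x $ i) ^ Poly_Mapping.lookup m i))"

text \<open>In \<open>partial_poly\<close> the exponent subtraction is truncated, but only where the
  coefficient vanishes anyway.\<close>

definition partial_poly :: "'n \<Rightarrow> 'n::finite rpoly \<Rightarrow> 'n rpoly" where
  "partial_poly i p =
    (\<Sum>m\<in>Poly_Mapping.keys p. Poly_Mapping.single (m - Poly_Mapping.single i 1)
       (Poly_Mapping.lookup p m * real (Poly_Mapping.lookup m i)))"

definition mon_degree :: "('n::finite \<Rightarrow>\<^sub>0 nat) \<Rightarrow> nat" where
  "mon_degree m = (\<Sum>i\<in>UNIV. Poly_Mapping.lookup m i)"

text \<open>Total degree, with the convention that the zero polynomial has degree 0.\<close>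

definition total_degree :: "'n::finite rpoly \<Rightarrow> nat" where
  "total_degree p = Max (insert 0 (mon_degree ` Poly_Mapping.keys p))"

definition polys_upto :: "nat \<Rightarrow> 'n::finite rpoly set" where
  "polys_upto t = {p. total_degree p \<le> t}"

text \<open>An ideal is a submodule of the ring regarded as a module over itself, so the ideal generated
  by a set is its span: all finite sums of multiples of its elements.\<close>

definition ideal_gen :: "'n::finite rpoly set \<Rightarrow> 'n rpoly set" where
  "ideal_gen S = module.span (*) S"

definition grad_ideal :: "'n::finite rpoly \<Rightarrow> 'n rpoly set" where
  "grad_ideal f = ideal_gen (range (\<lambda>i. partial_poly i f))"

definition real_zeros :: "'n::finite rpoly set \<Rightarrow> (real ^ 'n) set" where
  "real_zeros I = {x. \<forall>p\<in>I. eval_poly p x = 0}"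

definition real_variety :: "(real ^ 'n::finite) set \<Rightarrow> bool" where
  "real_variety W \<longleftrightarrow> (\<exists>S. W = real_zeros S)"

definition is_global_min :: "'n::finite rpoly \<Rightarrow> real \<Rightarrow> bool" where
  "is_global_min f fstar \<longleftrightarrow> (\<exists>x. eval_poly f x = fstar) \<and> (\<forall>x. fstar \<le> eval_poly f x)"

text \<open>The vanishing ideal of the minimizers of \<open>f\<close>, where \<open>fstar\<close> is the minimum of \<open>f\<close>.\<close>

definition min_ideal :: "'n::finite rpoly \<Rightarrow> real \<Rightarrow> 'n rpoly set" where
  "min_ideal f fstar = {p. \<forall>x. eval_poly f x = fstar \<longrightarrow> eval_poly p x = 0}"

definition trunc_gen :: "'n::finite rpoly set \<Rightarrow> nat \<Rightarrow> 'n rpoly set" where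
  "trunc_gen G d = {(\<Sum>g\<in>T. p g * g) | T p.
     finite T \<and> T \<subseteq> G \<and> (\<forall>g\<in>T. total_degree g \<le> d \<and> p g \<in> polys_upto (d - total_degree g))}"

text \<open>The dual space of the polynomials of degree at most \<open>d\<close>. Functionals live on a proper
  subspace of the type; \<open>extensional\<close> fixes their irrelevant values outside it.\<close>

definition poly_dual :: "nat \<Rightarrow> ('n::finite rpoly \<Rightarrow> real) set" where
  "poly_dual d = {\<Lambda> \<in> extensional (polys_upto d).
     (\<forall>p\<in>polys_upto d. \<forall>q\<in>polys_upto d. \<Lambda> (p + q) = \<Lambda> p + \<Lambda> q) \<and>
     (\<forall>c. \<forall>p\<in>polys_upto d. \<Lambda> (const_poly c * p) = c * \<Lambda> p)}"

definition mom_functionals :: "'n::finite rpoly set \<Rightarrow> nat \<Rightarrow> ('n rpoly \<Rightarrow> real) set" where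
  "mom_functionals G t = {\<Lambda> \<in> poly_dual (2 * t).
     (\<forall>g\<in>trunc_gen G (2 * t). \<Lambda> g = 0) \<and> \<Lambda> 1 = 1 \<and> (\<forall>p\<in>polys_upto t. \<Lambda> (p ^ 2) \<ge> 0)}"

definition trunc_sos :: "'n::finite rpoly set \<Rightarrow> nat \<Rightarrow> 'n rpoly set" where
  "trunc_sos G t = {(\<Sum>i<k. h i ^ 2) + g | (k::nat) h g.
     (\<forall>i<k. h i \<in> polys_upto t) \<and> g \<in> trunc_gen G (2 * t)}"

text \<open>The optimal values are extended reals, so that they are \<open>\<infinity>\<close> and \<open>-\<infinity>\<close> respectively when there is
  no feasible point. They are meaningful only if \<open>total_degree f \<le> 2 * t\<close>.\<close>

definition f_mom :: "'n::finite rpoly \<Rightarrow> 'n rpoly set \<Rightarrow> nat \<Rightarrow> ereal" where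
  "f_mom f G t = (INF \<Lambda>\<in>mom_functionals G t. ereal (\<Lambda> f))"

definition f_sos :: "'n::finite rpoly \<Rightarrow> 'n rpoly set \<Rightarrow> nat \<Rightarrow> ereal" where
  "f_sos f G t = (SUP l\<in>{l. f - const_poly l \<in> trunc_sos G t}. ereal l)"

definition hankel_ker :: "nat \<Rightarrow> ('n::finite rpoly \<Rightarrow> real) \<Rightarrow> 'n rpoly set" where
  "hankel_ker t \<Lambda> = {p \<in> polys_upto t. \<forall>q\<in>polys_upto t. \<Lambda> (p * q) = 0}"

end

theory Submission
  imports Defs "HOL-Algebra.Algebraic_Closure_Type" "HOL-Computational_Algebra.Fraction_Field"
begin

text \<open>Put \<open>u = f - f\<^sup>* - (\<Sum>i\<le>s. (f\<^sub>i - f\<^sup>*) p\<^sub>i\<^sup>2)\<close>. On \<open>W\<^sub>j\<close> only the summand with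
  \<open>i = j\<close> survives, and it equals \<open>f - f\<^sup>*\<close> there, so \<open>u\<close> vanishes at every real critical point
  of \<open>f\<close>. By the real Nullstellensatz some \<open>u\<^sup>2\<^sup>m + \<sigma>\<close> with \<open>\<sigma>\<close> a sum of squares lies in the gradient
  ideal, hence in \<open>(G)\<close>; after multiplication by an even power of \<open>u\<close> the exponent is a power of two,
  say \<open>N\<close>. Completing squares repeatedly gives, for each \<open>\<epsilon> > 0\<close>, a \<open>c \<ge> 0\<close> for which
  \<open>\<epsilon> + u + c u\<^sup>N\<close> is a sum of squares of polynomials in \<open>u\<close>. Therefore
  \<open>\<epsilon> + u = (\<epsilon> + u + c u\<^sup>N) + c \<sigma> - c (u\<^sup>N + \<sigma>)\<close> lies in the truncated cone, and the degrees
  do not depend on \<open>\<epsilon>\<close>, which enters only through scalars (\<open>uniform_trunc_sos\<close>).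

  Adding the nonnegative multiples of the \<open>p\<^sub>i\<^sup>2\<close> puts \<open>f - (f\<^sup>* - \<epsilon>)\<close> into the cone of one fixed order
  \<open>t\<close> for all \<open>\<epsilon> > 0\<close>. So the sum-of-squares value is at least \<open>f\<^sup>*\<close>; weak duality and the evaluation at a
  minimizer give the equalities. If \<open>\<Lambda> f = f\<^sup>*\<close>, the term with index \<open>i\<close> may be left out of the same
  identity, which yields \<open>(f\<^sub>i - f\<^sup>*) \<Lambda>(p\<^sub>i\<^sup>2) \<le> \<epsilon>\<close> for all \<open>\<epsilon>\<close>. For \<open>i \<ge> 1\<close> the factor is positive, so
  \<open>\<Lambda>(p\<^sub>i\<^sup>2) = 0\<close>, and the Cauchy--Schwarz inequality puts \<open>p\<^sub>i\<close> into the kernel.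

  The real Nullstellensatz (\<open>real_nullstellensatz\<close>) is where the work lies. If \<open>u\<^sup>2\<^sup>m + \<sigma> \<in> I\<close> never
  happens, Zorn's lemma gives a prime cone that contains the squares and \<open>I\<close> and has \<open>u\<close> outside its
  support (\<open>prime_cone_avoiding\<close>). The polynomial ring modulo the support is then an ordered domain; in its
  fraction field, and in a real closure \<open>L\<close> of that, the classes of the variables form a common zero
  of \<open>I\<close> at which \<open>u\<close> does not vanish. It remains to replace this point over \<open>L\<close> by a real one. This is
  the transfer principle \<open>real_point_with_same_signs\<close>, proved by moving one coordinate at a time
  from \<open>L\<close> to the reals. One step rests on the Cohen--Hoermander elimination
  \<open>sign_match_controlled\<close>: which sign vectors finitely many polynomials in one variable take on a real
  closed field is decided by the signs of finitely many elements of the coefficient ring. Thom's lemma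
  keeps track of the order of the roots there.\<close>

hide_const (open) Polynomials.degree Polynomials.lead_coeff Module.smult up_ring.monom up_ring.coeff

section \<open>Polynomials over real closed fields\<close>

text \<open>Among the ordered fields, the real closed ones are those with the intermediate value property for
  polynomials. A polynomial enters the axiom through its coefficient function.\<close>

class real_closed_field = linordered_field +
  assumes sum_ivt: "a < b \<Longrightarrow> (\<Sum>k\<le>n. c k * a ^ k) < 0 \<Longrightarrow> 0 < (\<Sum>k\<le>n. c k * b ^ k)
    \<Longrightarrow> \<exists>x. a < x \<and> x < b \<and> (\<Sum>k\<le>n. c k * x ^ k) = 0"

lemma poly_ivt_pos:
  fixes p :: "'a::real_closed_field poly"
  assumes "a < b" "poly p a < 0" "0 < poly p b"
  shows "\<exists>x. a < x \<and> x < b \<and> poly p x = 0"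
  using sum_ivt[of a b "coeff p" "degree p"] assms by (simp add: poly_altdef)

lemma poly_ivt_neg:
  fixes p :: "'a::real_closed_field poly"
  assumes "a < b" "0 < poly p a" "poly p b < 0"
  shows "\<exists>x. a < x \<and> x < b \<and> poly p x = 0"
  using poly_ivt_pos[of a b "-p"] assms by simp

instance real :: real_closed_field
proof
  fix a b :: real and c :: "nat \<Rightarrow> real" and n
  assume ab: "a < b" and lo: "(\<Sum>k\<le>n. c k * a ^ k) < 0" and hi: "0 < (\<Sum>k\<le>n. c k * b ^ k)"
  have "\<exists>x. a \<le> x \<and> x \<le> b \<and> (\<Sum>k\<le>n. c k * x ^ k) = 0"
    using ab lo hi by (intro IVT') (auto intro!: continuous_intros)
  then obtain x where x: "a \<le> x" "x \<le> b" "(\<Sum>k\<le>n. c k * x ^ k) = 0" by blast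
  moreover from this have "x \<noteq> a" "x \<noteq> b" using lo hi by auto
  ultimately show "\<exists>x. a < x \<and> x < b \<and> (\<Sum>k\<le>n. c k * x ^ k) = 0" by (intro exI[of _ x]) auto
qed

lemma no_root_pos:
  fixes p :: "'a::real_closed_field poly"
  assumes "\<And>x. min a b \<le> x \<Longrightarrow> x \<le> max a b \<Longrightarrow> poly p x \<noteq> 0" and "0 < poly p a"
  shows "0 < poly p b"
proof (rule ccontr)
  assume "\<not> 0 < poly p b"
  with assms(1)[of b] have n: "poly p b < 0" by force
  with assms(2) consider "a < b" | "b < a" by (cases a b rule: linorder_cases) auto
  then show False
    using poly_ivt_neg[of a b p] poly_ivt_pos[of b a p] assms n
    by cases (auto simp: min_def max_def less_le not_le split: if_splits)
qed

text \<open>Completeness is not available, so Rolle's theorem needs an algebraic argument. Write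
  \<open>p = (x - a) h\<close>, take the smallest root \<open>c\<close> of \<open>h\<close> in \<open>(a, b]\<close> and write \<open>h = (x - c) k\<close>. A positive
  derivative at \<open>a\<close> and at \<open>c\<close> makes \<open>h(a)\<close> and \<open>k(c)\<close> positive; then \<open>h\<close> is negative just below
  \<open>c\<close> and must have a smaller root.\<close>

lemma weak_rolle:
  fixes p :: "'a::real_closed_field poly"
  assumes ab: "a < b" and p0: "poly p a = 0" "poly p b = 0"
    and pos: "\<And>x. a \<le> x \<Longrightarrow> x \<le> b \<Longrightarrow> 0 < poly (pderiv p) x"
  shows False
proof -
  from p0(1) obtain h where h: "p = [:-a, 1:] * h" by (auto simp: poly_eq_0_iff_dvd dvd_def)
  have dp: "pderiv p = h + [:-a, 1:] * pderiv h" unfolding h by (simp only: pderiv_mult) (simp add: pderiv_pCons)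
  have ha: "0 < poly h a" using pos[of a] ab by (simp add: dp)
  have hb: "poly h b = 0" using p0(2) ab by (simp add: h)
  define Z where "Z = {x. a < x \<and> x \<le> b \<and> poly h x = 0}"
  have "h \<noteq> 0" using ha by auto
  have fin: "finite Z"
    unfolding Z_def by (rule finite_subset[OF _ poly_roots_finite[OF \<open>h \<noteq> 0\<close>]]) auto
  have "b \<in> Z" using hb ab by (simp add: Z_def)
  define c where "c = Min Z"
  have cZ: "c \<in> Z" and cmin: "\<And>x. x \<in> Z \<Longrightarrow> c \<le> x"
    using fin \<open>b \<in> Z\<close> Min_in[OF fin] Min_le[OF fin] unfolding c_def by blast+
  have c: "a < c" "c \<le> b" "poly h c = 0" using cZ by (auto simp: Z_def)
  from c(3) obtain k where k: "h = [:-c, 1:] * k" by (auto simp: poly_eq_0_iff_dvd dvd_def)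
  have dh: "pderiv h = k + [:-c, 1:] * pderiv k" unfolding k by (simp only: pderiv_mult) (simp add: pderiv_pCons)
  have kc: "0 < poly k c"
    using pos[of c] c by (auto simp: dp dh mult_less_cancel_right_disj)
  define m where "m = (a + c) / 2"
  have m: "a < m" "m < c" using c by (auto simp: m_def field_simps)
  have nz: "poly h x \<noteq> 0" if "a \<le> x" "x < c" for x
    using cmin[of x] that ha c by (cases "x = a") (auto simp: Z_def)
  have "0 < poly k m"
  proof (rule no_root_pos[OF _ kc])
    fix x assume "min c m \<le> x" "x \<le> max c m"
    then show "poly k x \<noteq> 0" using nz[of x] kc m by (cases "x = c") (auto simp: k min_def max_def)
  qed
  moreover have "0 < poly h m"
    using no_root_pos[of a m h] nz ha m by (auto simp: min_def max_def)
  ultimately show False using m by (simp add: k mult_less_0_iff zero_less_mult_iff)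
qed

lemma pderiv_pos_less_closed:
  fixes p :: "'a::real_closed_field poly"
  assumes ab: "a < b" and pos: "\<And>x. a \<le> x \<Longrightarrow> x \<le> b \<Longrightarrow> 0 < poly (pderiv p) x"
  shows "poly p a < poly p b"
proof (rule ccontr)
  assume le: "\<not> poly p a < poly p b"
  define s where "s = (poly p b - poly p a) / (b - a)"
  have s: "s \<le> 0" "s * (b - a) = poly p b - poly p a" using le ab by (auto simp: s_def field_simps)
  \<comment> \<open>subtract the chord, whose slope is not positive\<close>
  define g where "g = p - [:poly p a - s * a, s:]"
  have "poly g a = 0" "poly g b = 0" using s(2) by (auto simp: g_def algebra_simps)
  moreover have "pderiv g = pderiv p - [:s:]" by (simp add: g_def pderiv_diff pderiv_pCons)
  then have "0 < poly (pderiv g) x" if "a \<le> x" "x \<le> b" for x using pos[OF that] s(1) by simp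
  ultimately show False using weak_rolle[OF ab, of g] by blast
qed

text \<open>Positivity on the open interval suffices: the endpoints of a gap between roots may be roots of the
  derivative itself.\<close>

lemma pderiv_pos_less:
  fixes p :: "'a::real_closed_field poly"
  assumes ab: "a < b" and pos: "\<And>x. a < x \<Longrightarrow> x < b \<Longrightarrow> 0 < poly (pderiv p) x"
  shows "poly p a < poly p b"
proof -
  have less: "poly p x < poly p y" if "a < x" "x < y" "y < b" for x y
    using that pos by (intro pderiv_pos_less_closed) auto
  have left: "poly p a \<le> poly p x" if x: "a < x" "x < b" for x
  proof (rule ccontr)
    assume "\<not> poly p a \<le> poly p x"
    then obtain v where v: "poly p x < v" "v < poly p a" using dense[of "poly p x" "poly p a"] by auto
    obtain y where "a < y" "y < x" "poly p y = v"
      using poly_ivt_neg[of a x "p - [:v:]"] v x by auto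
    with less[of y x] v x show False by simp
  qed
  have right: "poly p x \<le> poly p b" if x: "a < x" "x < b" for x
  proof (rule ccontr)
    assume "\<not> poly p x \<le> poly p b"
    then obtain v where v: "poly p b < v" "v < poly p x" using dense[of "poly p b" "poly p x"] by auto
    obtain y where "x < y" "y < b" "poly p y = v"
      using poly_ivt_neg[of x b "p - [:v:]"] v x by auto
    with less[of x y] v x show False by simp
  qed
  obtain x where x: "a < x" "x < b" using dense[OF ab] by auto
  obtain y where y: "x < y" "y < b" using dense[OF x(2)] by auto
  show ?thesis using left[of x] less[of x y] right[of y] x y by force
qed

lemma poly_eq_0_on_interval:
  fixes p :: "'a::linordered_field poly"
  assumes "a < b" and "\<And>x. a < x \<Longrightarrow> x < b \<Longrightarrow> poly p x = 0"
  shows "p = 0"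
proof (rule ccontr)
  assume "p \<noteq> 0"
  then have "finite {x. poly p x = 0}" by (rule poly_roots_finite)
  moreover have "{a<..<b} \<subseteq> {x. poly p x = 0}" using assms(2) by auto
  ultimately show False using infinite_Ioo[OF assms(1)] finite_subset by blast
qed

lemma poly_pos_near_left:
  fixes p :: "'a::real_closed_field poly"
  assumes ab: "a < b" and pb: "0 < poly p b"
  shows "\<exists>m. a < m \<and> m < b \<and> 0 < poly p m"
proof -
  have "p \<noteq> 0" using pb by auto
  define Z where "Z = insert a {x. a < x \<and> x < b \<and> poly p x = 0}"
  have fin: "finite Z"
    unfolding Z_def by (intro finite.insertI finite_subset[OF _ poly_roots_finite[OF \<open>p \<noteq> 0\<close>]]) auto
  define c where "c = Max Z"
  have cZ: "c \<in> Z" and cmax: "\<And>x. x \<in> Z \<Longrightarrow> x \<le> c"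
    using fin Max_in[of Z] Max_ge[of Z] unfolding c_def by (auto simp: Z_def)
  have c: "a \<le> c" "c < b" using cZ ab by (auto simp: Z_def)
  obtain m where m: "c < m" "m < b" using dense[OF c(2)] by auto
  have "0 < poly p m"
  proof (rule no_root_pos[OF _ pb])
    fix x assume x: "min b m \<le> x" "x \<le> max b m"
    show "poly p x \<noteq> 0"
    proof
      assume "poly p x = 0"
      with x m pb c have "x \<in> Z" by (cases "x = b") (auto simp: Z_def min_def max_def)
      with cmax[of x] x m show False by auto
    qed
  qed
  with m c show ?thesis by (intro exI[of _ m]) auto
qed

lemma poly_ge_lead_coeff_eventually:
  fixes p :: "'a::linordered_field poly"
  assumes "0 < lead_coeff p"
  shows "\<exists>x0. \<forall>x\<ge>x0. lead_coeff p \<le> poly p x"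
  using assms
proof (induction p)
  case 0 then show ?case by simp
next
  case (pCons a q)
  show ?case
  proof (cases "q = 0")
    case True then show ?thesis by simp
  next
    case False
    let ?l = "lead_coeff q"
    have l: "0 < ?l" using pCons.prems False by simp
    from pCons.IH[OF l] obtain x1 where x1: "\<And>x. x \<ge> x1 \<Longrightarrow> ?l \<le> poly q x" by blast
    have "?l \<le> poly (pCons a q) x" if x: "x \<ge> max x1 (1 + \<bar>a\<bar> / ?l)" for x
    proof -
      have x': "x \<ge> 1 + \<bar>a\<bar> / ?l" using x by simp
      have "0 \<le> \<bar>a\<bar> / ?l" using l by simp
      hence x0: "0 \<le> x" using x' by simp
      have "(1 + \<bar>a\<bar> / ?l) * ?l \<le> x * ?l" using x' l by (intro mult_right_mono) auto
      moreover have "(1 + \<bar>a\<bar> / ?l) * ?l = ?l + \<bar>a\<bar>"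
        using less_imp_neq[OF l] by (simp add: distrib_right)
      moreover have "x * ?l \<le> x * poly q x" using x x1[of x] x0 by (intro mult_left_mono) auto
      ultimately have "?l + \<bar>a\<bar> \<le> x * poly q x" by simp
      moreover have "- \<bar>a\<bar> \<le> a" using abs_ge_minus_self[of a] by linarith
      moreover have "poly (pCons a q) x = a + x * poly q x" by simp
      ultimately show ?thesis by linarith
    qed
    moreover have "lead_coeff (pCons a q) = ?l" using False by simp
    ultimately show ?thesis by metis
  qed
qed

text \<open>The leading coefficients of a polynomial and of its derivative have the same sign, so a derivative
  that stays positive forces positive values far to the right. This treats the unbounded gap
  beyond the last root.\<close>

lemma poly_pos_if_pderiv_pos:
  fixes p :: "'a::real_closed_field poly"
  assumes pos: "\<And>x. a \<le> x \<Longrightarrow> 0 < poly (pderiv p) x"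
  shows "\<exists>x>a. 0 < poly p x"
proof -
  have dn: "pderiv p \<noteq> 0" using pos[of a] by auto
  have "0 < lead_coeff (pderiv p)"
  proof (rule ccontr)
    assume "\<not> ?thesis"
    with dn have "0 < lead_coeff (- pderiv p)" by (simp add: not_less le_less)
    from poly_ge_lead_coeff_eventually[OF this] obtain x0
      where x0: "\<And>x. x \<ge> x0 \<Longrightarrow> lead_coeff (- pderiv p) \<le> poly (- pderiv p) x" by blast
    from x0[of "max x0 a"] pos[of "max x0 a"] \<open>0 < lead_coeff (- pderiv p)\<close> show False by simp
  qed
  moreover have "degree p \<noteq> 0" using dn by (metis pderiv_eq_0_iff)
  ultimately have "0 < lead_coeff p"
    by (auto simp: degree_pderiv coeff_pderiv zero_less_mult_iff simp del: of_nat_Suc)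
  from poly_ge_lead_coeff_eventually[OF this] obtain x0
    where x0: "\<And>x. x \<ge> x0 \<Longrightarrow> lead_coeff p \<le> poly p x" by blast
  have "0 < poly p (max x0 (a+1))" using x0[of "max x0 (a+1)"] \<open>0 < lead_coeff p\<close> by simp
  then show ?thesis by (intro exI[of _ "max x0 (a+1)"]) (auto simp: less_max_iff_disj)
qed

text \<open>Integer-valued, so that signs taken in different fields can be compared.\<close>

definition sg :: "'a::linordered_idom \<Rightarrow> int" where
  "sg x = (if 0 < x then 1 else if x = 0 then 0 else -1)"

lemma sg_simps [simp]: "sg x = 1 \<longleftrightarrow> 0 < x" "sg x = 0 \<longleftrightarrow> x = 0" "sg x = -1 \<longleftrightarrow> x < 0"
  "sg 0 = 0" "sg 1 = 1" "sg (- x) = - sg x"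
  by (auto simp: sg_def)

lemma sg_eq_iff: "sg x = sg y \<longleftrightarrow> (0 < x \<longleftrightarrow> 0 < y) \<and> (x = 0 \<longleftrightarrow> y = 0)"
  by (auto simp: sg_def)

lemma sg_mult: "sg (x * y) = sg x * sg y"
  by (auto simp: sg_def zero_less_mult_iff mult_less_0_iff)

lemma sg_mono: "x \<le> y \<Longrightarrow> sg x \<le> sg y"
  by (auto simp: sg_def)

lemma sg_range: "sg x = 1 \<or> sg x = 0 \<or> sg x = -1" by (auto simp: sg_def)

lemma sg_no_root_between:
  fixes p :: "'a::real_closed_field poly"
  assumes "\<And>x. min a b \<le> x \<Longrightarrow> x \<le> max a b \<Longrightarrow> poly p x \<noteq> 0"
  shows "sg (poly p a) = sg (poly p b)"
proof -
  have 1: "0 < poly p a \<longleftrightarrow> 0 < poly p b"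
    using no_root_pos[of a b p] no_root_pos[of b a p] assms by (auto simp: min.commute max.commute)
  show ?thesis using 1 assms[of a] assms[of b] by (auto simp: sg_eq_iff)
qed

section \<open>Moving a point inside a gap between roots\<close>

text \<open>Two real closed fields carry finite sets \<open>Z1\<close> and \<open>Z2\<close> of marked points, matched by \<open>R\<close> in an
  order-preserving way. The points \<open>x\<close> and \<open>y\<close> lie in corresponding gaps. The aim is to move \<open>y\<close>
  within its gap until a polynomial that is monotone there has the sign seen at \<open>x\<close>.\<close>

locale gap_correspondence =
  fixes R :: "'a::real_closed_field \<Rightarrow> 'b::real_closed_field \<Rightarrow> bool"
    and Z1 :: "'a set" and Z2 :: "'b set" and x :: 'a and y :: 'b
  assumes finite_Z: "finite Z2"
    and x_notin: "x \<notin> Z1" and y_notin: "y \<notin> Z2"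
    and total1: "\<And>a. a \<in> Z1 \<Longrightarrow> \<exists>b\<in>Z2. R a b"
    and total2: "\<And>b. b \<in> Z2 \<Longrightarrow> \<exists>a\<in>Z1. R a b"
    and base: "\<And>a b. a \<in> Z1 \<Longrightarrow> b \<in> Z2 \<Longrightarrow> R a b \<Longrightarrow> x < a \<longleftrightarrow> y < b"
    and mono: "\<And>a a' b b'. a \<in> Z1 \<Longrightarrow> a' \<in> Z1 \<Longrightarrow> b \<in> Z2 \<Longrightarrow> b' \<in> Z2 \<Longrightarrow>
       R a b \<Longrightarrow> R a' b' \<Longrightarrow> a < a' \<Longrightarrow> b < b'"
begin

text \<open>The right end \<open>b\<close> of the gap of \<open>y\<close> corresponds to the right end \<open>a\<close> of the gap of \<open>x\<close>. Since \<open>g1\<close>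
  increases from \<open>g1 x \<ge> 0\<close>, it is positive at \<open>a\<close>, so \<open>g2\<close> is positive at \<open>b\<close> and also somewhere
  before \<open>b\<close>. If the gap is unbounded, \<open>g2\<close> grows to positive values anyway. The intermediate value property then supplies the value zero if that is the sign wanted.\<close>

lemma move_right:
  fixes g1 :: "'a poly" and g2 :: "'b poly"
  assumes sgR: "\<And>a b. a \<in> Z1 \<Longrightarrow> b \<in> Z2 \<Longrightarrow> R a b \<Longrightarrow> sg (poly g1 a) = sg (poly g2 b)"
    and roots1: "\<And>u. poly (pderiv g1) u = 0 \<Longrightarrow> u \<in> Z1"
    and roots2: "\<And>u. poly (pderiv g2) u = 0 \<Longrightarrow> u \<in> Z2"
    and pos1: "0 < poly (pderiv g1) x" and pos2: "0 < poly (pderiv g2) y"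
    and less: "sg (poly g2 y) < sg (poly g1 x)"
  shows "\<exists>w. (\<forall>z\<in>Z2. \<not> (min y w \<le> z \<and> z \<le> max y w)) \<and> sg (poly g2 w) = sg (poly g1 x)"
proof -
  let ?s = "sg (poly g1 x)"
  define good where "good w \<longleftrightarrow> y \<le> w \<and> (\<forall>z\<in>Z2. \<not> (y \<le> z \<and> z \<le> w))" for w
  have "\<exists>w. good w \<and> ?s \<le> sg (poly g2 w)"
  proof (cases "\<exists>z\<in>Z2. y < z")
    case False
    then have nz: "z \<in> Z2 \<Longrightarrow> z < y" for z using y_notin by (metis linorder_neqE)
    have "0 < poly (pderiv g2) u" if "y \<le> u" for u
      using that pos2 by (intro no_root_pos[of y u]) (auto simp: min_def max_def dest!: roots2 nz)
    from poly_pos_if_pderiv_pos[of y g2, OF this] obtain w where "y < w" "0 < poly g2 w" by blast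
    moreover from this have "good w" by (auto simp: good_def dest!: nz)
    ultimately show ?thesis using sg_range[of "poly g1 x"] by (intro exI[of _ w]) (auto simp: sg_def)
  next
    case True
    define b where "b = Min {z \<in> Z2. y < z}"
    have b: "b \<in> Z2" "y < b" and bmin: "\<And>z. z \<in> Z2 \<Longrightarrow> y < z \<Longrightarrow> b \<le> z"
    proof -
      have "finite {z \<in> Z2. y < z}" "{z \<in> Z2. y < z} \<noteq> {}" using True finite_Z by auto
      from Min_in[OF this] Min_le[OF this(1)]
      show "b \<in> Z2" "y < b" "\<And>z. z \<in> Z2 \<Longrightarrow> y < z \<Longrightarrow> b \<le> z" unfolding b_def by auto
    qed
    obtain a where a: "a \<in> Z1" "R a b" using total2[OF b(1)] by blast
    have xa: "x < a" using base[OF a(1) b(1) a(2)] b(2) by simp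
    have noZ1: "u \<notin> Z1" if "x \<le> u" "u < a" for u
    proof
      assume u: "u \<in> Z1"
      with x_notin that have "x < u" by (cases "x = u") auto
      obtain z where z: "z \<in> Z2" "R u z" using total1[OF u] by blast
      have "y < z" using base[OF u z] \<open>x < u\<close> by simp
      moreover have "z < b" using mono[OF u a(1) z(1) b(1) z(2) a(2)] that by simp
      ultimately show False using bmin[OF z(1)] by simp
    qed
    have "0 < poly (pderiv g1) u" if "x < u" "u < a" for u
    proof (rule no_root_pos[OF _ pos1])
      fix v assume "min x u \<le> v" "v \<le> max x u"
      with that have "x \<le> v" "v < a" by (auto simp: min_def max_def split: if_splits)
      with noZ1 roots1 show "poly (pderiv g1) v \<noteq> 0" by blast
    qed
    from pderiv_pos_less[OF xa this] have "poly g1 x < poly g1 a" by blast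
    moreover have "0 \<le> poly g1 x" using less sg_range[of "poly g2 y"] by (auto simp: sg_def split: if_splits)
    ultimately have "sg (poly g1 a) = 1" by simp
    then have "0 < poly g2 b" using sgR[OF a(1) b(1) a(2)] by simp
    from poly_pos_near_left[OF b(2) this] obtain m where m: "y < m" "m < b" "0 < poly g2 m" by blast
    have "\<not> (y \<le> z \<and> z \<le> m)" if "z \<in> Z2" for z
      using bmin[OF that] y_notin m that by (cases "y = z") auto
    then have "good m" unfolding good_def using m by simp
    with m show ?thesis using sg_range[of "poly g1 x"] by (intro exI[of _ m]) (auto simp: sg_def)
  qed
  then obtain w where w: "good w" "?s \<le> sg (poly g2 w)" by blast
  have goodD: "good v \<Longrightarrow> \<forall>z\<in>Z2. \<not> (min y v \<le> z \<and> z \<le> max y v)" for v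
    by (auto simp: good_def min_def max_def)
  show ?thesis
  proof (cases "?s = sg (poly g2 w)")
    case True with w goodD show ?thesis by metis
  next
    case False
    with w(2) less have "sg (poly g2 w) = 1" "?s = 0" "sg (poly g2 y) = -1"
      unfolding sg_def by (simp_all split: if_splits)
    then have 1: "poly g2 y < 0" "0 < poly g2 w" by simp_all
    have "y < w" using 1 w(1) by (auto simp: good_def le_less)
    from poly_ivt_pos[OF this 1] obtain v where v: "y < v" "v < w" "poly g2 v = 0" by blast
    have "good v" using w(1) v unfolding good_def by (metis less_imp_le order_trans)
    with v \<open>?s = 0\<close> goodD show ?thesis by (metis sg_simps(4))
  qed
qed

text \<open>Reflection exchanges left and right; together with a change of sign it keeps derivatives
  positive, so moving left needs no argument of its own.\<close>

lemma mirrored: "gap_correspondence (\<lambda>a b. R (- a) (- b)) (uminus ` Z1) (uminus ` Z2) (- x) (- y)"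
proof
  show "finite (uminus ` Z2)" using finite_Z by simp
  show "- x \<notin> uminus ` Z1" "- y \<notin> uminus ` Z2" using x_notin y_notin by auto
  show "\<exists>b\<in>uminus ` Z2. R (- a) (- b)" if "a \<in> uminus ` Z1" for a using that total1 by auto
  show "\<exists>a\<in>uminus ` Z1. R (- a) (- b)" if "b \<in> uminus ` Z2" for b using that total2 by auto
  show "- x < a \<longleftrightarrow> - y < b" if "a \<in> uminus ` Z1" "b \<in> uminus ` Z2" "R (- a) (- b)" for a b
  proof -
    from that have ab: "- a \<in> Z1" "- b \<in> Z2" by auto
    from base[OF ab that(3)] have "x < - a \<longleftrightarrow> y < - b" .
    moreover have "- a \<noteq> x" "- b \<noteq> y" using ab x_notin y_notin by auto
    ultimately show ?thesis by (metis minus_less_iff neg_less_iff_less not_less_iff_gr_or_eq minus_minus)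
  qed
  show "b < b'" if "a \<in> uminus ` Z1" "a' \<in> uminus ` Z1" "b \<in> uminus ` Z2" "b' \<in> uminus ` Z2"
     "R (- a) (- b)" "R (- a') (- b')" "a < a'" for a a' b b'
    using mono[of "- a'" "- a" "- b'" "- b"] that by auto
qed

lemma move_pos:
  fixes g1 :: "'a poly" and g2 :: "'b poly"
  assumes sgR: "\<And>a b. a \<in> Z1 \<Longrightarrow> b \<in> Z2 \<Longrightarrow> R a b \<Longrightarrow> sg (poly g1 a) = sg (poly g2 b)"
    and roots1: "\<And>u. poly (pderiv g1) u = 0 \<Longrightarrow> u \<in> Z1"
    and roots2: "\<And>u. poly (pderiv g2) u = 0 \<Longrightarrow> u \<in> Z2"
    and pos1: "0 < poly (pderiv g1) x" and pos2: "0 < poly (pderiv g2) y"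
  shows "\<exists>w. (\<forall>z\<in>Z2. \<not> (min y w \<le> z \<and> z \<le> max y w)) \<and> sg (poly g2 w) = sg (poly g1 x)"
proof (cases "sg (poly g2 y)" "sg (poly g1 x)" rule: linorder_cases)
  case less
  then show ?thesis using move_right[OF sgR roots1 roots2 pos1 pos2] by blast
next
  case equal
  then show ?thesis using y_notin by (intro exI[of _ y]) auto
next
  case greater
  interpret M: gap_correspondence "\<lambda>a b. R (- a) (- b)" "uminus ` Z1" "uminus ` Z2" "- x" "- y"
    by (rule mirrored)
  let ?h1 = "- (g1 \<circ>\<^sub>p [:0, -1:])" and ?h2 = "- (g2 \<circ>\<^sub>p [:0, -1:])"
  have d1: "pderiv ?h1 = pderiv g1 \<circ>\<^sub>p [:0, -1:]" and d2: "pderiv ?h2 = pderiv g2 \<circ>\<^sub>p [:0, -1:]"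
    by (simp_all add: pderiv_pcompose pderiv_minus pderiv_pCons)
  have "\<exists>w. (\<forall>z\<in>uminus ` Z2. \<not> (min (- y) w \<le> z \<and> z \<le> max (- y) w)) \<and> sg (poly ?h2 w) = sg (poly ?h1 (- x))"
  proof (rule M.move_right)
    show "sg (poly ?h1 a) = sg (poly ?h2 b)"
      if "a \<in> uminus ` Z1" "b \<in> uminus ` Z2" "R (- a) (- b)" for a b
      using that sgR[of "- a" "- b"] by (auto simp: poly_pcompose)
    show "u \<in> uminus ` Z1" if "poly (pderiv ?h1) u = 0" for u
      using that roots1[of "- u"] unfolding d1 by (simp add: poly_pcompose image_iff) (metis minus_minus)
    show "u \<in> uminus ` Z2" if "poly (pderiv ?h2) u = 0" for u
      using that roots2[of "- u"] unfolding d2 by (simp add: poly_pcompose image_iff) (metis minus_minus)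
    show "0 < poly (pderiv ?h1) (- x)" "0 < poly (pderiv ?h2) (- y)"
      unfolding d1 d2 using pos1 pos2 by (simp_all add: poly_pcompose)
    show "sg (poly ?h2 (- y)) < sg (poly ?h1 (- x))" using greater by (simp add: poly_pcompose)
  qed
  then obtain w where w: "\<forall>z\<in>uminus ` Z2. \<not> (min (- y) w \<le> z \<and> z \<le> max (- y) w)"
    "sg (poly ?h2 w) = sg (poly ?h1 (- x))" by blast
  have "\<not> (min y (- w) \<le> z \<and> z \<le> max y (- w))" if "z \<in> Z2" for z
  proof -
    from w(1) that have "\<not> (min (- y) w \<le> - z \<and> - z \<le> max (- y) w)" by auto
    then show ?thesis by (auto simp: min_def max_def split: if_splits)
  qed
  moreover have "sg (poly g2 (- w)) = sg (poly g1 x)" using w(2) by (simp add: poly_pcompose)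
  ultimately show ?thesis by blast
qed

lemma move:
  fixes g1 :: "'a poly" and g2 :: "'b poly"
  assumes sgR: "\<And>a b. a \<in> Z1 \<Longrightarrow> b \<in> Z2 \<Longrightarrow> R a b \<Longrightarrow> sg (poly g1 a) = sg (poly g2 b)"
    and roots1: "\<And>u. poly (pderiv g1) u = 0 \<Longrightarrow> u \<in> Z1"
    and roots2: "\<And>u. poly (pderiv g2) u = 0 \<Longrightarrow> u \<in> Z2"
    and deriv: "sg (poly (pderiv g1) x) = sg (poly (pderiv g2) y)"
  shows "\<exists>w. (\<forall>z\<in>Z2. \<not> (min y w \<le> z \<and> z \<le> max y w)) \<and> sg (poly g2 w) = sg (poly g1 x)"
proof (cases "0 < poly (pderiv g1) x")
  case True
  with deriv have "0 < poly (pderiv g2) y" by (metis sg_simps(1))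
  with True show ?thesis using move_pos[OF sgR roots1 roots2] by blast
next
  case False
  with roots1[of x] x_notin have neg1: "poly (pderiv g1) x < 0" by force
  with deriv have neg2: "poly (pderiv g2) y < 0" by (metis sg_simps(3))
  have "\<exists>w. (\<forall>z\<in>Z2. \<not> (min y w \<le> z \<and> z \<le> max y w)) \<and> sg (poly (- g2) w) = sg (poly (- g1) x)"
    using sgR roots1 roots2 neg1 neg2 by (intro move_pos) (auto simp: pderiv_minus)
  then show ?thesis by simp
qed

end

section \<open>Thom's lemma\<close>

lemma poly_constant_if_pderiv_eq_0:
  fixes p :: "'a::linordered_field poly"
  assumes "pderiv p = 0"
  shows "poly p x = poly p y"
proof -
  have "degree p = 0" using assms by (simp add: pderiv_eq_0_iff)
  then show ?thesis by (auto elim: degree_eq_zeroE)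
qed

lemma monotone_if_pderiv_sg_constant:
  fixes p :: "'a::real_closed_field poly"
  assumes s: "\<And>w. x \<le> w \<Longrightarrow> w \<le> y \<Longrightarrow> sg (poly (pderiv p) w) = s" and xy: "x < y"
  shows "(s = 1 \<longrightarrow> (\<forall>u v. x \<le> u \<longrightarrow> u < v \<longrightarrow> v \<le> y \<longrightarrow> poly p u < poly p v)) \<and>
    (s = -1 \<longrightarrow> (\<forall>u v. x \<le> u \<longrightarrow> u < v \<longrightarrow> v \<le> y \<longrightarrow> poly p v < poly p u)) \<and>
    (s = 0 \<longrightarrow> pderiv p = 0)"
proof (intro conjI impI allI)
  fix u v assume 1: "s = 1" and uv: "x \<le> u" "u < v" "v \<le> y"
  have "0 < poly (pderiv p) w" if "u < w" "w < v" for w using s[of w] that uv 1 by simp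
  then show "poly p u < poly p v" by (intro pderiv_pos_less) (use uv in auto)
next
  fix u v assume 1: "s = -1" and uv: "x \<le> u" "u < v" "v \<le> y"
  have "0 < poly (pderiv (-p)) w" if "u < w" "w < v" for w using s[of w] that uv 1 by (simp add: pderiv_minus)
  then have "poly (-p) u < poly (-p) v" by (intro pderiv_pos_less) (use uv in auto)
  then show "poly p v < poly p u" by simp
next
  assume "s = 0"
  then show "pderiv p = 0" using s by (intro poly_eq_0_on_interval[OF xy]) auto
qed

text \<open>One half of Thom's lemma: prescribing the signs of a polynomial and of all its derivatives defines
  a convex set. By induction the derivative has constant sign between \<open>x\<close> and \<open>y\<close>, so the polynomial is
  monotone there, and equal signs at the ends force the same sign in between.\<close>

lemma thom_convex:
  fixes p :: "'a::real_closed_field poly"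
  assumes "x < y" "\<And>j. sg (poly ((pderiv ^^ j) p) x) = sg (poly ((pderiv ^^ j) p) y)"
    and "x \<le> w" "w \<le> y"
  shows "sg (poly p w) = sg (poly p x)"
  using assms
proof (induction "degree p" arbitrary: p w rule: less_induct)
  case less
  show ?case
  proof (cases "pderiv p = 0")
    case True then show ?thesis using poly_constant_if_pderiv_eq_0 by metis
  next
    case False
    then have "degree (pderiv p) < degree p"
      by (metis degree_pderiv diff_less neq0_conv pderiv_eq_0_iff zero_less_one)
    moreover have "sg (poly ((pderiv ^^ j) (pderiv p)) x) = sg (poly ((pderiv ^^ j) (pderiv p)) y)" for j
      using less.prems(2)[of "Suc j"] by (simp add: funpow_swap1)
    ultimately have c: "sg (poly (pderiv p) v) = sg (poly (pderiv p) x)" if "x \<le> v" "v \<le> y" for v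
      using less.hyps[of "pderiv p" v] less.prems(1) that by blast
    note mono = monotone_if_pderiv_sg_constant[of x y p "sg (poly (pderiv p) x)", OF c less.prems(1)]
    have e: "sg (poly p x) = sg (poly p y)" using less.prems(2)[of 0] by simp
    consider "w = x" | "w = y" | "x < w" "w < y" using less.prems by force
    then show ?thesis
    proof cases
      case 3
      consider "sg (poly (pderiv p) x) = 1" | "sg (poly (pderiv p) x) = -1" | "sg (poly (pderiv p) x) = 0"
        using sg_range by blast
      then show ?thesis
      proof cases
        case 1
        then have "poly p x < poly p w" "poly p w < poly p y" using mono 3 by auto
        then show ?thesis using e sg_mono[of "poly p x" "poly p w"] sg_mono[of "poly p w" "poly p y"] by simp
      next
        case 2
        then have "poly p w < poly p x" "poly p y < poly p w" using mono 3 by auto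
        then show ?thesis using e sg_mono[of "poly p w" "poly p x"] sg_mono[of "poly p y" "poly p w"] by simp
      next
        case 3 then show ?thesis using mono False by auto
      qed
    qed (use e in auto)
  qed
qed

text \<open>Homomorphisms into a field turn this into the usual derivative of the image polynomial.
Working before the homomorphism is chosen is what allows one set of polynomials to serve two fields.\<close>

definition formal_deriv :: "'r::comm_ring_1 poly \<Rightarrow> 'r poly" where
  "formal_deriv p = (\<Sum>i\<le>degree p. monom (of_nat (Suc i) * coeff p (Suc i)) i)"

lemma coeff_formal_deriv: "coeff (formal_deriv p) n = of_nat (Suc n) * coeff p (Suc n)"
  by (auto simp: formal_deriv_def coeff_sum coeff_eq_0 simp del: of_nat_Suc)

definition is_hom :: "('r::comm_ring_1 \<Rightarrow> 's::comm_ring_1) \<Rightarrow> bool" where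
  "is_hom \<phi> \<longleftrightarrow> \<phi> 1 = 1 \<and> (\<forall>x y. \<phi> (x + y) = \<phi> x + \<phi> y) \<and> (\<forall>x y. \<phi> (x * y) = \<phi> x * \<phi> y)"

context
  fixes \<phi> :: "'r::comm_ring_1 \<Rightarrow> 's::comm_ring_1"
  assumes hom: "is_hom \<phi>"
begin

lemma is_hom_add: "\<phi> (x + y) = \<phi> x + \<phi> y" and is_hom_mult: "\<phi> (x * y) = \<phi> x * \<phi> y"
  and is_hom_one: "\<phi> 1 = 1"
  using hom by (auto simp: is_hom_def)

lemma is_hom_zero: "\<phi> 0 = 0"
  using is_hom_add[of 0 0] by simp

lemma is_hom_uminus: "\<phi> (- x) = - \<phi> x"
  using is_hom_add[of x "- x"] by (simp add: is_hom_zero eq_neg_iff_add_eq_0 add.commute)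

lemma is_hom_diff: "\<phi> (x - y) = \<phi> x - \<phi> y"
  using is_hom_add[of x "- y"] by (simp add: is_hom_uminus)

lemma is_hom_sum: "\<phi> (sum f A) = (\<Sum>x\<in>A. \<phi> (f x))"
  by (induction A rule: infinite_finite_induct) (auto simp: is_hom_zero is_hom_add)

lemma is_hom_prod: "\<phi> (prod f A) = (\<Prod>x\<in>A. \<phi> (f x))"
  by (induction A rule: infinite_finite_induct) (auto simp: is_hom_one is_hom_mult)

lemma is_hom_power: "\<phi> (x ^ n) = \<phi> x ^ n"
  by (induction n) (auto simp: is_hom_one is_hom_mult)

lemma is_hom_of_nat: "\<phi> (of_nat n) = of_nat n"
  by (induction n) (auto simp: is_hom_one is_hom_add is_hom_zero)

lemma map_poly_hom_add: "map_poly \<phi> (p + q) = map_poly \<phi> p + map_poly \<phi> q"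
  by (intro poly_eqI) (simp add: coeff_map_poly is_hom_zero is_hom_add)

lemma map_poly_hom_mult: "map_poly \<phi> (p * q) = map_poly \<phi> p * map_poly \<phi> q"
  by (intro poly_eqI) (simp add: coeff_map_poly is_hom_zero is_hom_mult is_hom_sum coeff_mult)

lemma map_poly_hom_smult: "map_poly \<phi> (smult c p) = smult (\<phi> c) (map_poly \<phi> p)"
  by (intro poly_eqI) (simp add: coeff_map_poly is_hom_zero is_hom_mult)


end

lemma map_poly_hom_pderiv:
  fixes \<phi> :: "'r::comm_ring_1 \<Rightarrow> 'a::idom"
  assumes "is_hom \<phi>"
  shows "map_poly \<phi> (formal_deriv p) = pderiv (map_poly \<phi> p)"
  by (intro poly_eqI) (simp add: coeff_map_poly is_hom_zero[OF assms] is_hom_mult[OF assms] is_hom_add[OF assms]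
    is_hom_one[OF assms] is_hom_of_nat[OF assms] coeff_formal_deriv coeff_pderiv)

lemma map_poly_hom_pderiv_funpow:
  fixes \<phi> :: "'r::comm_ring_1 \<Rightarrow> 'a::idom"
  assumes "is_hom \<phi>"
  shows "map_poly \<phi> ((formal_deriv ^^ j) p) = (pderiv ^^ j) (map_poly \<phi> p)"
  by (induction j) (auto simp: map_poly_hom_pderiv[OF assms])

abbreviation sgp :: "('r::comm_ring_1 \<Rightarrow> 'a::linordered_idom) \<Rightarrow> 'r poly \<Rightarrow> 'a \<Rightarrow> int" where
  "sgp \<phi> p x \<equiv> sg (poly (map_poly \<phi> p) x)"

definition sign_match :: "('r::comm_ring_1 \<Rightarrow> 'a::linordered_idom) \<Rightarrow> ('r \<Rightarrow> 'b::linordered_idom) \<Rightarrow> 'r poly set \<Rightarrow> bool" where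
  "sign_match \<phi> \<psi> Q \<longleftrightarrow> (\<forall>x. \<exists>y. \<forall>q\<in>Q. sgp \<phi> q x = sgp \<psi> q y)"

lemma formal_deriv_funpow_closed:
  assumes "\<And>h. h \<in> H \<Longrightarrow> formal_deriv h \<in> H" "h \<in> H"
  shows "(formal_deriv ^^ j) h \<in> H"
  using assms by (induction j) auto

lemma degree_formal_deriv_less:
  fixes p :: "'r::comm_ring_1 poly"
  assumes "degree p > 0"
  shows "degree ((formal_deriv ^^ Suc j) p) < degree p"
proof -
  have 1: "degree (formal_deriv q) \<le> degree q - 1" for q :: "'r poly"
    by (rule degree_le) (auto simp: coeff_formal_deriv coeff_eq_0)
  have "degree ((formal_deriv ^^ Suc j) p) \<le> degree p - 1"
  proof (induction j)
    case 0 show ?case using 1[of p] by simp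
  next
    case (Suc j)
    have "degree ((formal_deriv ^^ Suc (Suc j)) p) \<le> degree ((formal_deriv ^^ Suc j) p) - 1"
      using 1[of "(formal_deriv ^^ Suc j) p"] by simp
    with Suc show ?case by linarith
  qed
  with assms show ?thesis by linarith
qed

lemma thom_no_root:
  fixes \<phi> :: "'r::comm_ring_1 \<Rightarrow> 'a::real_closed_field"
  assumes hom: "is_hom \<phi>" and closed: "\<And>h. h \<in> H \<Longrightarrow> formal_deriv h \<in> H"
    and less: "x < x'" and eq: "\<And>h. h \<in> H \<Longrightarrow> sgp \<phi> h x = sgp \<phi> h x'"
    and h: "h \<in> H" "map_poly \<phi> h \<noteq> 0"
  shows "poly (map_poly \<phi> h) x \<noteq> 0"
proof
  assume 0: "poly (map_poly \<phi> h) x = 0"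
  have "sg (poly ((pderiv ^^ j) (map_poly \<phi> h)) x) = sg (poly ((pderiv ^^ j) (map_poly \<phi> h)) x')" for j
    using eq[OF formal_deriv_funpow_closed[OF closed h(1), of j]] by (simp add: map_poly_hom_pderiv_funpow[OF hom])
  from thom_convex[OF less this] 0 have "poly (map_poly \<phi> h) w = 0" if "x < w" "w < x'" for w
    using that by (simp add: less_imp_le)
  then have "map_poly \<phi> h = 0" by (rule poly_eq_0_on_interval[OF less])
  with h(2) show False by simp
qed

text \<open>The other half of Thom's lemma, across two fields: the order of two points can be read off from
  their sign vectors. Take a polynomial of least degree in \<open>H\<close> whose signs differ. Its derivative has
  the same nonzero sign at both points, hence by convexity throughout, in both fields, and so the
  direction in which the polynomial grows decides the order.\<close>

lemma thom_order:
  fixes \<phi> :: "'r::comm_ring_1 \<Rightarrow> 'a::real_closed_field" and \<psi> :: "'r \<Rightarrow> 'b::real_closed_field"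
  assumes hom: "is_hom \<phi>" "is_hom \<psi>" and closed: "\<And>h. h \<in> H \<Longrightarrow> formal_deriv h \<in> H"
    and less: "x < x'"
    and eq: "\<And>h. h \<in> H \<Longrightarrow> sgp \<phi> h x = sgp \<psi> h y" "\<And>h. h \<in> H \<Longrightarrow> sgp \<phi> h x' = sgp \<psi> h y'"
    and diff: "\<exists>h\<in>H. sgp \<phi> h x \<noteq> sgp \<phi> h x'"
  shows "y < y'"
proof -
  let ?P = "\<lambda>h. h \<in> H \<and> sgp \<phi> h x \<noteq> sgp \<phi> h x'"
  obtain h where h: "?P h" and hmin: "\<And>g. ?P g \<Longrightarrow> degree h \<le> degree g"
    using diff ex_has_least_nat[of ?P _ degree] by blast
  have "degree h > 0"
  proof (rule ccontr)
    assume "\<not> ?thesis"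
    then obtain c where "h = [:c:]" by (auto elim: degree_eq_zeroE)
    with h show False by (simp add: map_poly_pCons is_hom_zero[OF hom(1)])
  qed
  let ?f = "map_poly \<phi> h" and ?g = "map_poly \<psi> h"
  have dH: "(formal_deriv ^^ j) h \<in> H" for j using formal_deriv_funpow_closed[OF closed] h by blast
  have e: "sgp \<phi> ((formal_deriv ^^ Suc j) h) x = sgp \<phi> ((formal_deriv ^^ Suc j) h) x'" for j
    using hmin[of "(formal_deriv ^^ Suc j) h"] degree_formal_deriv_less[OF \<open>degree h > 0\<close>, of j] dH[of "Suc j"]
    by (metis not_less)
  have e1: "sg (poly ((pderiv ^^ j) (pderiv ?f)) x) = sg (poly ((pderiv ^^ j) (pderiv ?f)) x')" for j
    using e[of j] by (simp add: map_poly_hom_pderiv_funpow[OF hom(1)] map_poly_hom_pderiv[OF hom(1)] funpow_swap1)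
  have e2: "sg (poly ((pderiv ^^ j) (pderiv ?g)) y) = sg (poly ((pderiv ^^ j) (pderiv ?g)) y')" for j
    using e[of j] eq[OF dH[of "Suc j"]]
    by (simp add: map_poly_hom_pderiv_funpow[OF hom(2)] map_poly_hom_pderiv[OF hom(2)] 
      map_poly_hom_pderiv_funpow[OF hom(1)] map_poly_hom_pderiv[OF hom(1)] funpow_swap1)
  define s where "s = sg (poly (pderiv ?f) x)"
  have s2: "s = sg (poly (pderiv ?g) y)" "s = sg (poly (pderiv ?g) y')"
    using eq(1)[OF dH[of 1]] e2[of 0]
    by (simp_all add: s_def map_poly_hom_pderiv[OF hom(2)] map_poly_hom_pderiv[OF hom(1)])
  have c1: "sg (poly (pderiv ?f) w) = s" if "x \<le> w" "w \<le> x'" for w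
    unfolding s_def using thom_convex[OF less e1 that] .
  note m1 = monotone_if_pderiv_sg_constant[OF c1 less]
  show ?thesis
  proof (rule ccontr)
    assume "\<not> y < y'"
    moreover have "y \<noteq> y'" using h eq by metis
    ultimately have less2: "y' < y" by simp
    have c2: "sg (poly (pderiv ?g) w) = s" if "y' \<le> w" "w \<le> y" for w
      using thom_convex[OF less2 e2[symmetric] that] s2 by simp
    note m2 = monotone_if_pderiv_sg_constant[OF c2 less2]
    have ne: "sg (poly ?f x) \<noteq> sg (poly ?f x')" using h by simp
    have E: "sg (poly ?f x) = sg (poly ?g y)" "sg (poly ?f x') = sg (poly ?g y')"
      using eq h by auto
    consider "s = 1" | "s = -1" | "s = 0" unfolding s_def using sg_range by blast
    then show False
    proof cases
      case 1
      then have "poly ?f x < poly ?f x'" "poly ?g y' < poly ?g y" using m1 m2 less less2 by auto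
      with ne E sg_mono[of "poly ?f x" "poly ?f x'"] sg_mono[of "poly ?g y'" "poly ?g y"] show False by simp
    next
      case 2
      then have "poly ?f x' < poly ?f x" "poly ?g y < poly ?g y'" using m1 m2 less less2 by auto
      with ne E sg_mono[of "poly ?f x'" "poly ?f x"] sg_mono[of "poly ?g y" "poly ?g y'"] show False by simp
    next
      case 3
      then have "pderiv ?f = 0" using m1 by simp
      with ne poly_constant_if_pderiv_eq_0[of ?f x x'] show False by simp
    qed
  qed
qed

section \<open>Elimination of one variable\<close>

text \<open>Suppose the signs on \<open>H\<close> and on the remainders of \<open>q\<close> modulo the members of \<open>H\<close> can be matched. At a
  root of \<open>h \<in> H\<close> the sign of \<open>q\<close> is that of a remainder, so it is matched too. In a gap between the
  roots of \<open>H\<close> the polynomial \<open>q\<close> is monotone, because \<open>H\<close> contains its derivative, and a point with the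
  right sign is found by moving inside the gap. The signs on \<open>H\<close> do not change during the move.\<close>

lemma sign_match_insert:
  fixes \<phi> :: "'r::comm_ring_1 \<Rightarrow> 'a::real_closed_field" and \<psi> :: "'r \<Rightarrow> 'b::real_closed_field"
  assumes hom: "is_hom \<phi>" "is_hom \<psi>" and fin: "finite H"
    and closed: "\<And>h. h \<in> H \<Longrightarrow> formal_deriv h \<in> H"
    and zero: "\<And>h. h \<in> H \<Longrightarrow> map_poly \<phi> h = 0 \<longleftrightarrow> map_poly \<psi> h = 0"
    and q: "formal_deriv q \<in> H" "map_poly \<phi> (formal_deriv q) \<noteq> 0"
    and HQ: "H \<subseteq> Q"
    and rem: "\<And>h. h \<in> H \<Longrightarrow> map_poly \<phi> h \<noteq> 0 \<Longrightarrow> \<exists>r\<in>Q.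
        (\<forall>x. poly (map_poly \<phi> h) x = 0 \<longrightarrow> sgp \<phi> q x = sgp \<phi> r x) \<and>
        (\<forall>y. poly (map_poly \<psi> h) y = 0 \<longrightarrow> sgp \<psi> q y = sgp \<psi> r y)"
    and match: "sign_match \<phi> \<psi> Q" "sign_match \<psi> \<phi> Q"
  shows "sign_match \<phi> \<psi> (insert q H)"
  unfolding sign_match_def
proof
  fix x
  obtain y where y: "\<And>r. r \<in> Q \<Longrightarrow> sgp \<phi> r x = sgp \<psi> r y"
    using match(1) unfolding sign_match_def by blast
  define Z1 where "Z1 = {u. \<exists>h\<in>H. map_poly \<phi> h \<noteq> 0 \<and> poly (map_poly \<phi> h) u = 0}"
  define Z2 where "Z2 = {u. \<exists>h\<in>H. map_poly \<psi> h \<noteq> 0 \<and> poly (map_poly \<psi> h) u = 0}"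
  define R where "R a b \<longleftrightarrow> (\<forall>r\<in>Q. sgp \<phi> r a = sgp \<psi> r b)" for a b
  have RZ: "a \<in> Z1 \<longleftrightarrow> b \<in> Z2" if "R a b" for a b
    using that zero HQ unfolding R_def Z1_def Z2_def
    by (intro iffI; clarsimp) (metis sg_simps(2) sg_simps(4) subsetD)+
  have Rq: "sgp \<phi> q a = sgp \<psi> q b" if ab: "R a b" and "a \<in> Z1" for a b
  proof -
    obtain h where h: "h \<in> H" "map_poly \<phi> h \<noteq> 0" "poly (map_poly \<phi> h) a = 0"
      using \<open>a \<in> Z1\<close> by (auto simp: Z1_def)
    have "poly (map_poly \<psi> h) b = 0" using ab h HQ unfolding R_def by (metis sg_simps(2) subsetD)
    with rem[OF h(1,2)] h(3) ab show ?thesis unfolding R_def by metis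
  qed
  have Rxy: "R x y" using y by (simp add: R_def)
  show "\<exists>y. \<forall>p\<in>insert q H. sgp \<phi> p x = sgp \<psi> p y"
  proof (cases "x \<in> Z1")
    case True
    with Rq[OF Rxy] y HQ show ?thesis by blast
  next
    case False
    have ord: "b < b'" if "R a b" "R a' b'" "a < a'" "(a \<in> Z1) \<noteq> (a' \<in> Z1) \<or> a \<in> Z1" for a a' b b'
    proof (rule thom_order[OF hom closed \<open>a < a'\<close>])
      show "\<And>h. h \<in> H \<Longrightarrow> sgp \<phi> h a = sgp \<psi> h b" "\<And>h. h \<in> H \<Longrightarrow> sgp \<phi> h a' = sgp \<psi> h b'"
        using that HQ by (auto simp: R_def)
      show "\<exists>h\<in>H. sgp \<phi> h a \<noteq> sgp \<phi> h a'"
      proof (rule ccontr)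
        assume "\<not> ?thesis"
        then have same: "\<And>h. h \<in> H \<Longrightarrow> sgp \<phi> h a = sgp \<phi> h a'" by blast
        have "a \<in> Z1" using that(4) same unfolding Z1_def by (auto simp: sg_eq_iff)
        with thom_no_root[OF hom(1) closed \<open>a < a'\<close> same] show False by (auto simp: Z1_def)
      qed
    qed
    interpret gap_correspondence R Z1 Z2 x y
    proof
      have "Z2 \<subseteq> (\<Union>h\<in>{h\<in>H. map_poly \<psi> h \<noteq> 0}. {u. poly (map_poly \<psi> h) u = 0})"
        by (auto simp: Z2_def)
      moreover have "finite (\<Union>h\<in>{h\<in>H. map_poly \<psi> h \<noteq> 0}. {u. poly (map_poly \<psi> h) u = 0})"
        using fin by (auto intro: poly_roots_finite)
      ultimately show "finite Z2" by (rule finite_subset)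
      show "x \<notin> Z1" by fact
      then show "y \<notin> Z2" using RZ[OF Rxy] by simp
      show "\<exists>b\<in>Z2. R a b" if "a \<in> Z1" for a
        using match(1) that RZ unfolding sign_match_def R_def by metis
      show "\<exists>a\<in>Z1. R a b" if "b \<in> Z2" for b
        using match(2) that RZ unfolding sign_match_def R_def by metis
      show "x < a \<longleftrightarrow> y < b" if "a \<in> Z1" "b \<in> Z2" "R a b" for a b
      proof -
        have "a \<noteq> x" using that False by auto
        with ord[OF Rxy that(3)] ord[OF that(3) Rxy] that(1) False show ?thesis
          by (metis linorder_neqE not_less_iff_gr_or_eq)
      qed
      show "b < b'" if "a \<in> Z1" "a' \<in> Z1" "b \<in> Z2" "b' \<in> Z2" "R a b" "R a' b'" "a < a'" for a a' b b'
        using ord[of a b a' b'] that by blast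
    qed
    have "\<exists>w. (\<forall>z\<in>Z2. \<not> (min y w \<le> z \<and> z \<le> max y w)) \<and> sgp \<psi> q w = sgp \<phi> q x"
    proof (rule move)
      show "sgp \<phi> q a = sgp \<psi> q b" if "a \<in> Z1" "b \<in> Z2" "R a b" for a b using Rq that by blast
      show "u \<in> Z1" if "poly (pderiv (map_poly \<phi> q)) u = 0" for u
        unfolding Z1_def mem_Collect_eq
        by (rule bexI[OF _ q(1)]) (use that q in \<open>simp add: map_poly_hom_pderiv[OF hom(1)]\<close>)
      show "u \<in> Z2" if "poly (pderiv (map_poly \<psi> q)) u = 0" for u
        unfolding Z2_def mem_Collect_eq
        by (rule bexI[OF _ q(1)]) (use that q zero[OF q(1)] in \<open>simp add: map_poly_hom_pderiv[OF hom(2)]\<close>)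
      show "sg (poly (pderiv (map_poly \<phi> q)) x) = sg (poly (pderiv (map_poly \<psi> q)) y)"
        using y[of "formal_deriv q"] q HQ by (auto simp: map_poly_hom_pderiv[OF hom(1)] map_poly_hom_pderiv[OF hom(2)])
    qed
    then obtain w where w: "\<And>z. z \<in> Z2 \<Longrightarrow> \<not> (min y w \<le> z \<and> z \<le> max y w)"
      "sgp \<psi> q w = sgp \<phi> q x" by blast
    have "sgp \<psi> h y = sgp \<psi> h w" if "h \<in> H" for h
    proof (cases "map_poly \<psi> h = 0")
      case False
      then show ?thesis using that w(1) by (intro sg_no_root_between) (auto simp: Z2_def)
    qed simp
    with w(2) y HQ show ?thesis by (metis insert_iff subsetD)
  qed
qed

text \<open>A coefficient may be nonzero in \<open>'r\<close> and yet vanish under \<open>\<phi>\<close>. Deleting such coefficients does not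
  change the image, and the leading coefficient of what is left, if anything is, has nonzero image.\<close>

definition drop_vanishing :: "('r::comm_ring_1 \<Rightarrow> 'a::zero) \<Rightarrow> 'r poly \<Rightarrow> 'r poly" where
  "drop_vanishing \<phi> q = map_poly (\<lambda>c. if \<phi> c = 0 then 0 else c) q"

lemma coeff_drop_vanishing: "coeff (drop_vanishing \<phi> q) n = (if \<phi> (coeff q n) = 0 then 0 else coeff q n)"
  unfolding drop_vanishing_def by (subst coeff_map_poly) auto

lemma degree_drop_vanishing: "degree (drop_vanishing \<phi> q) \<le> degree q"
  by (rule degree_le) (auto simp: coeff_drop_vanishing coeff_eq_0)

lemma map_poly_drop_vanishing:
  assumes "is_hom \<psi>" "\<And>n. \<phi> (coeff q n) = 0 \<Longrightarrow> \<psi> (coeff q n) = 0"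
  shows "map_poly \<psi> (drop_vanishing \<phi> q) = map_poly \<psi> q"
  using assms by (intro poly_eqI) (auto simp: coeff_map_poly is_hom_zero coeff_drop_vanishing)

definition normal_wrt :: "('r::comm_ring_1 \<Rightarrow> 'a::zero) \<Rightarrow> 'r poly \<Rightarrow> bool" where
  "normal_wrt \<phi> q \<longleftrightarrow> q = 0 \<or> \<phi> (lead_coeff q) \<noteq> 0"

lemma normal_drop_vanishing:
  assumes "is_hom \<phi>"
  shows "normal_wrt \<phi> (drop_vanishing \<phi> q)"
  unfolding normal_wrt_def
  using coeff_drop_vanishing[of \<phi> q "degree (drop_vanishing \<phi> q)"]
  by (auto simp: is_hom_zero[OF assms])

lemma normal_formal_deriv:
  fixes \<phi> :: "'r::comm_ring_1 \<Rightarrow> 'a::real_closed_field"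
  assumes hom: "is_hom \<phi>" and n: "normal_wrt \<phi> q"
  shows "normal_wrt \<phi> (formal_deriv q)" and "degree q > 0 \<Longrightarrow> formal_deriv q \<noteq> 0"
proof -
  have *: "normal_wrt \<phi> (formal_deriv q) \<and> formal_deriv q \<noteq> 0" if d: "degree q > 0"
  proof -
    have nz: "\<phi> (lead_coeff q) \<noteq> 0" using n d by (auto simp: normal_wrt_def)
    obtain m where m: "degree q = Suc m" using d by (cases "degree q") auto
    have "\<phi> (coeff (formal_deriv q) m) = of_nat (Suc m) * \<phi> (lead_coeff q)"
      by (simp add: coeff_formal_deriv is_hom_mult[OF hom] is_hom_of_nat[OF hom] m del: of_nat_Suc)
    also have "\<dots> \<noteq> 0" using nz by (simp del: of_nat_Suc)
    finally have c: "\<phi> (coeff (formal_deriv q) m) \<noteq> 0" .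
    have cm: "coeff (formal_deriv q) m \<noteq> 0"
    proof
      assume "coeff (formal_deriv q) m = 0"
      with c show False by (simp add: is_hom_zero[OF hom])
    qed
    have "degree (formal_deriv q) = m"
    proof (rule antisym)
      show "degree (formal_deriv q) \<le> m"
        by (rule degree_le) (auto simp: coeff_formal_deriv coeff_eq_0 m)
      show "m \<le> degree (formal_deriv q)" using cm by (rule le_degree)
    qed
    with c cm show ?thesis by (auto simp: normal_wrt_def)
  qed
  show "formal_deriv q \<noteq> 0" if "degree q > 0" using * that by blast
  show "normal_wrt \<phi> (formal_deriv q)"
  proof (cases "degree q > 0")
    case False
    then have "formal_deriv q = 0" by (intro poly_eqI) (simp add: coeff_formal_deriv coeff_eq_0)
    then show ?thesis by (simp add: normal_wrt_def)
  qed (use * in blast)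
qed

text \<open>The pseudo-remainder, multiplied once more by the same power of the leading coefficient. Modulo \<open>h\<close> it
  is then \<open>q\<close> times a square, so at roots of \<open>h\<close> it has the sign of \<open>q\<close>, whatever the sign of the leading
  coefficient.\<close>

definition even_prem :: "'r::comm_ring_1 poly \<Rightarrow> 'r poly \<Rightarrow> 'r poly" where
  "even_prem q h = smult (lead_coeff h ^ (Suc (degree q) - degree h)) (snd (pseudo_divmod q h))"

lemma degree_even_prem:
  assumes "h \<noteq> 0" "degree h \<le> Suc d"
  shows "degree (even_prem q h) \<le> d"
proof -
  have "snd (pseudo_divmod q h) = 0 \<or> degree (snd (pseudo_divmod q h)) < degree h"
    using pseudo_divmod(2)[OF assms(1), of q] by (metis prod.collapse)
  with assms(2) degree_smult_le[of "lead_coeff h ^ (Suc (degree q) - degree h)" "snd (pseudo_divmod q h)"]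
  show ?thesis unfolding even_prem_def by auto
qed

lemma sgp_even_prem:
  fixes \<phi> :: "'r::comm_ring_1 \<Rightarrow> 'a::real_closed_field"
  assumes hom: "is_hom \<phi>" and h: "h \<noteq> 0" "\<phi> (lead_coeff h) \<noteq> 0" and root: "poly (map_poly \<phi> h) x = 0"
  shows "sgp \<phi> q x = sgp \<phi> (even_prem q h) x"
proof -
  let ?c = "lead_coeff h ^ (Suc (degree q) - degree h)"
  let ?s = "fst (pseudo_divmod q h)" and ?r = "snd (pseudo_divmod q h)"
  have "smult ?c q = h * ?s + ?r"
    using pseudo_divmod(1)[OF h(1), of q ?s ?r] by simp
  then have "smult ?c (smult ?c q) = h * smult ?c ?s + even_prem q h"
    by (simp add: even_prem_def smult_add_right)
  note eq = this
  have "\<phi> ?c * (\<phi> ?c * poly (map_poly \<phi> q) x) = poly (map_poly \<phi> (smult ?c (smult ?c q))) x"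
    by (simp only: map_poly_hom_smult[OF hom] poly_smult)
  also have "\<dots> = poly (map_poly \<phi> (h * smult ?c ?s + even_prem q h)) x" by (simp only: eq)
  also have "\<dots> = poly (map_poly \<phi> (even_prem q h)) x"
    using root by (simp add: map_poly_hom_add[OF hom] map_poly_hom_mult[OF hom] map_poly_hom_smult[OF hom])
  finally have "\<phi> ?c * (\<phi> ?c * poly (map_poly \<phi> q) x) = poly (map_poly \<phi> (even_prem q h)) x" .
  moreover have "\<phi> ?c \<noteq> 0" using h(2) by (simp add: is_hom_power[OF hom])
  then have "sg (\<phi> ?c * \<phi> ?c) = 1" by (simp add: zero_less_mult_iff) (metis linorder_neqE)
  ultimately show ?thesis
    by (metis mult.assoc sg_mult mult_1)
qed

lemma sign_match_mono: "sign_match \<phi> \<psi> Q \<Longrightarrow> P \<subseteq> Q \<Longrightarrow> sign_match \<phi> \<psi> P"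
  unfolding sign_match_def by blast

lemma sign_match_drop_vanishing:
  assumes "\<And>q. q \<in> Q \<Longrightarrow> map_poly \<phi> (f q) = map_poly \<phi> q" "\<And>q. q \<in> Q \<Longrightarrow> map_poly \<psi> (f q) = map_poly \<psi> q"
    and "sign_match \<phi> \<psi> (f ` Q)"
  shows "sign_match \<phi> \<psi> Q"
  using assms unfolding sign_match_def by (metis image_eqI)

definition deriv_closure :: "'r::comm_ring_1 poly set \<Rightarrow> 'r poly set" where
  "deriv_closure B = {(formal_deriv ^^ j) h | j h. h \<in> B}"

lemma formal_deriv_funpow_eq_0:
  assumes "degree p < j"
  shows "(formal_deriv ^^ j) p = 0"
  using assms
proof (induction j arbitrary: p)
  case (Suc j)
  show ?case
  proof (cases "degree p = 0")
    case True
    then have "formal_deriv p = 0" by (intro poly_eqI) (simp add: coeff_formal_deriv coeff_eq_0)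
    moreover have "(formal_deriv ^^ j) (0 :: 'a poly) = 0"
      by (induction j) (auto simp: formal_deriv_def)
    ultimately show ?thesis by (simp only: funpow_Suc_right o_apply)
  next
    case False
    then have "degree (formal_deriv p) < j"
      using degree_formal_deriv_less[of p 0] Suc.prems by simp
    from Suc.IH[OF this] show ?thesis by (simp only: funpow_Suc_right o_apply)
  qed
qed simp

lemma deriv_closure:
  shows "finite B \<Longrightarrow> finite (deriv_closure B)" and "h \<in> deriv_closure B \<Longrightarrow> formal_deriv h \<in> deriv_closure B"
    and "B \<subseteq> deriv_closure B"
proof -
  assume "finite B"
  let ?n = "Suc (Max (insert 0 (degree ` B)))"
  have "deriv_closure B \<subseteq> insert 0 ((\<lambda>(j, h). (formal_deriv ^^ j) h) ` ({..?n} \<times> B))"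
  proof
    fix g assume "g \<in> deriv_closure B"
    then obtain j h where jh: "g = (formal_deriv ^^ j) h" "h \<in> B" by (auto simp: deriv_closure_def)
    show "g \<in> insert 0 ((\<lambda>(j, h). (formal_deriv ^^ j) h) ` ({..?n} \<times> B))"
    proof (cases "j \<le> ?n")
      case False
      have "degree h \<le> Max (insert 0 (degree ` B))" using jh(2) \<open>finite B\<close> by (intro Max_ge) auto
      with False have "degree h < j" by linarith
      then show ?thesis using formal_deriv_funpow_eq_0 jh by blast
    qed (use jh in auto)
  qed
  then show "finite (deriv_closure B)" by (rule finite_subset) (use \<open>finite B\<close> in auto)
next
  show "formal_deriv h \<in> deriv_closure B" if "h \<in> deriv_closure B"
    using that unfolding deriv_closure_def by clarsimp (metis funpow.simps(2) o_apply)
next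
  show "B \<subseteq> deriv_closure B" unfolding deriv_closure_def by clarsimp (metis funpow_0)
qed

text \<open>The induction is on a bound for the degrees and, within it, on the number of polynomials
  of the maximal degree. A polynomial \<open>q\<close> of maximal degree is replaced by its derivatives, by those of the
  other polynomials, and by the remainders of \<open>q\<close> modulo all the polynomials then present; everything that is
  new has smaller degree. The
  leading coefficients of the new polynomials join the control set \<open>C\<close>, so that they do not vanish under \<open>\<psi>\<close>
  either. Both directions are proved together, since each one uses the other to know that no unmatched roots
  lie in a gap.\<close>

theorem sign_match_controlled:
  fixes \<phi> :: "'r::comm_ring_1 \<Rightarrow> 'a::real_closed_field"
  assumes hom: "is_hom \<phi>" and "finite Q"
  shows "\<exists>C. finite C \<and> (\<forall>\<psi> :: 'r \<Rightarrow> 'b::real_closed_field. is_hom \<psi> \<longrightarrow> (\<forall>c\<in>C. sg (\<phi> c) = sg (\<psi> c))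
     \<longrightarrow> sign_match \<phi> \<psi> Q \<and> sign_match \<psi> \<phi> Q)" (is "\<exists>C. ?ctl C Q")
proof -
  have "\<exists>C. ?ctl C Q" if "finite Q" "\<And>q. q \<in> Q \<Longrightarrow> degree q \<le> d" for d and Q :: "'r poly set"
    using that
  proof (induction d arbitrary: Q)
    case 0
    have "?ctl ((\<lambda>q. coeff q 0) ` Q) Q"
    proof (intro conjI allI impI)
      show "finite ((\<lambda>q. coeff q 0) ` Q)" using 0 by simp
      fix \<psi> :: "'r \<Rightarrow> 'b" assume hom': "is_hom \<psi>" and c: "\<forall>c\<in>(\<lambda>q. coeff q 0) ` Q. sg (\<phi> c) = sg (\<psi> c)"
      have "sgp \<phi> q x = sgp \<psi> q y" if q: "q \<in> Q" for q x y
      proof -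
        have "degree q = 0" using 0(2)[OF q] by simp
        then obtain c' where "q = [:c':]" by (rule degree_eq_zeroE)
        with c q show ?thesis by (auto simp: map_poly_pCons is_hom_zero[OF hom] is_hom_zero[OF hom'] dest!: bspec)
      qed
      then show "sign_match \<phi> \<psi> Q" "sign_match \<psi> \<phi> Q" unfolding sign_match_def by metis+
    qed
    then show ?case by blast
  next
    case (Suc d)
    note outer = Suc.IH
    show ?case using Suc.prems
    proof (induction "card {q \<in> Q. degree q = Suc d}" arbitrary: Q rule: less_induct)
      case less
      define N where "N = drop_vanishing \<phi> ` Q"
      have N: "finite N" "\<And>q. q \<in> N \<Longrightarrow> degree q \<le> Suc d" "\<And>q. q \<in> N \<Longrightarrow> normal_wrt \<phi> q"
      proof -
        show "finite N" using less.prems(1) by (simp add: N_def)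
        fix q assume "q \<in> N"
        then obtain p where p: "p \<in> Q" "q = drop_vanishing \<phi> p" by (auto simp: N_def)
        show "degree q \<le> Suc d"
          unfolding p(2) by (rule order_trans[OF degree_drop_vanishing less.prems(2)[OF p(1)]])
        show "normal_wrt \<phi> q" unfolding p(2) by (rule normal_drop_vanishing[OF hom])
      qed
      have "{q \<in> N. degree q = Suc d} \<subseteq> drop_vanishing \<phi> ` {q \<in> Q. degree q = Suc d}"
      proof
        fix p assume "p \<in> {q \<in> N. degree q = Suc d}"
        then obtain q where q: "q \<in> Q" "p = drop_vanishing \<phi> q" "degree p = Suc d" by (auto simp: N_def)
        with less.prems(2)[OF q(1)] degree_drop_vanishing[of \<phi> q] show "p \<in> drop_vanishing \<phi> ` {q \<in> Q. degree q = Suc d}"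
          by auto
      qed
      then have cardN: "card {q \<in> N. degree q = Suc d} \<le> card {q \<in> Q. degree q = Suc d}"
        using less.prems(1) by (intro order_trans[OF card_mono card_image_le]) auto
      have "\<exists>C. ?ctl C N"
      proof (cases "\<exists>q\<in>N. degree q = Suc d")
        case False
        then have "\<And>q. q \<in> N \<Longrightarrow> degree q \<le> d" using N(2) by (metis le_SucE)
        with outer N(1) show ?thesis by blast
      next
        case True
        then obtain q where q: "q \<in> N" "degree q = Suc d" by blast
        define H where "H = deriv_closure (insert (formal_deriv q) (N - {q}))"
        define P where "P = H \<union> even_prem q ` (H - {0})"
        have finH: "finite H" unfolding H_def using N(1) by (intro deriv_closure) auto
        have closed: "\<And>h. h \<in> H \<Longrightarrow> formal_deriv h \<in> H" unfolding H_def by (rule deriv_closure)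
        have sub: "formal_deriv q \<in> H" "N - {q} \<subseteq> H" using deriv_closure(3)[of "insert (formal_deriv q) (N - {q})"] unfolding H_def by auto
        have nH: "normal_wrt \<phi> h" if hH: "h \<in> H" for h
        proof -
          obtain j g where g: "h = (formal_deriv ^^ j) g" "g \<in> insert (formal_deriv q) (N - {q})"
            using hH unfolding H_def deriv_closure_def by blast
          have "normal_wrt \<phi> g" using g(2) N(3) q normal_formal_deriv(1)[OF hom] by auto
          then show ?thesis unfolding g(1) by (induction j) (auto intro: normal_formal_deriv(1)[OF hom])
        qed
        have dq: "degree (formal_deriv q) \<le> d" using degree_formal_deriv_less[of q 0] q(2) by simp
        have degH: "h \<in> N - {q} \<or> degree h \<le> d" if hH: "h \<in> H" for h
        proof -
          obtain j g where g: "h = (formal_deriv ^^ j) g" "g \<in> insert (formal_deriv q) (N - {q})"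
            using hH unfolding H_def deriv_closure_def by blast
          have dg: "degree g \<le> Suc d" using g(2) N(2) dq by auto
          show ?thesis
          proof (cases j)
            case 0 with g dq show ?thesis by auto
          next
            case (Suc i)
            show ?thesis
            proof (cases "degree g > 0")
              case True
              from degree_formal_deriv_less[OF this, of i] dg Suc g(1) show ?thesis by simp
            next
              case False
              then have "h = 0" using formal_deriv_funpow_eq_0[of g j] g(1) Suc by simp
              then show ?thesis by simp
            qed
          qed
        qed
        have degH': "degree h \<le> Suc d" if "h \<in> H" for h using degH[OF that] N(2) by auto
        have "{p \<in> P. degree p = Suc d} \<subseteq> {p \<in> N. degree p = Suc d} - {q}"
          using degH degree_even_prem[OF _ degH', of _ q] unfolding P_def by fastforce
        then have "card {p \<in> P. degree p = Suc d} < card {p \<in> N. degree p = Suc d}"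
          using q N(1) by (intro psubset_card_mono) auto
        moreover have "finite P" unfolding P_def using finH by simp
        moreover have "degree p \<le> Suc d" if "p \<in> P" for p
          using that degH' degree_even_prem[OF _ degH', of _ q] unfolding P_def by (auto intro: le_SucI)
        ultimately obtain C where C: "?ctl C P" using less.hyps[of P] cardN by (meson order_less_le_trans)
        define D where "D = C \<union> lead_coeff ` H"
        have "?ctl D N"
        proof (intro conjI allI impI)
          show "finite D" using C finH by (simp add: D_def)
          fix \<psi> :: "'r \<Rightarrow> 'b" assume hom': "is_hom \<psi>" and c: "\<forall>c\<in>D. sg (\<phi> c) = sg (\<psi> c)"
          have m: "sign_match \<phi> \<psi> P" "sign_match \<psi> \<phi> P" using C hom' c by (auto simp: D_def)
          have lc: "\<phi> (lead_coeff h) \<noteq> 0 \<and> \<psi> (lead_coeff h) \<noteq> 0" if "h \<in> H" "h \<noteq> 0" for h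
          proof -
            have "sg (\<phi> (lead_coeff h)) = sg (\<psi> (lead_coeff h))" using c that by (simp add: D_def)
            with nH[OF that(1)] that(2) show ?thesis by (auto simp: normal_wrt_def sg_eq_iff)
          qed
          have z: "map_poly \<phi> h = 0 \<longleftrightarrow> h = 0" "map_poly \<psi> h = 0 \<longleftrightarrow> h = 0" if "h \<in> H" for h
            using lc[OF that] coeff_map_poly[of \<phi> h "degree h"] coeff_map_poly[of \<psi> h "degree h"]
              is_hom_zero[OF hom] is_hom_zero[OF hom'] by (metis coeff_0 map_poly_0)+
          have q': "formal_deriv q \<noteq> 0"
            using normal_formal_deriv(2)[OF hom N(3)[OF q(1)]] q(2) by simp
          have e: "sgp \<phi> q x = sgp \<phi> (even_prem q h) x" if "h \<in> H" "h \<noteq> 0" "poly (map_poly \<phi> h) x = 0" for h x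
            using sgp_even_prem[OF hom that(2) _ that(3)] lc[OF that(1,2)] by blast
          have e': "sgp \<psi> q x = sgp \<psi> (even_prem q h) x" if "h \<in> H" "h \<noteq> 0" "poly (map_poly \<psi> h) x = 0" for h x
            using sgp_even_prem[OF hom' that(2) _ that(3)] lc[OF that(1,2)] by blast
          have NP: "N \<subseteq> insert q H" using sub(2) by blast
          have "sign_match \<phi> \<psi> (insert q H)"
          proof (rule sign_match_insert[OF hom hom' finH closed _ sub(1) _ _ _ m])
            show "\<exists>r\<in>P. (\<forall>x. poly (map_poly \<phi> h) x = 0 \<longrightarrow> sgp \<phi> q x = sgp \<phi> r x) \<and>
               (\<forall>y. poly (map_poly \<psi> h) y = 0 \<longrightarrow> sgp \<psi> q y = sgp \<psi> r y)" if "h \<in> H" "map_poly \<phi> h \<noteq> 0" for h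
              using that e e' z by (intro bexI[of _ "even_prem q h"]) (auto simp: P_def)
          qed (use z q' sub in \<open>auto simp: P_def\<close>)
          then show "sign_match \<phi> \<psi> N" using NP by (rule sign_match_mono)
          have "sign_match \<psi> \<phi> (insert q H)"
          proof (rule sign_match_insert[OF hom' hom finH closed _ sub(1) _ _ _ m(2,1)])
            show "\<exists>r\<in>P. (\<forall>x. poly (map_poly \<psi> h) x = 0 \<longrightarrow> sgp \<psi> q x = sgp \<psi> r x) \<and>
               (\<forall>y. poly (map_poly \<phi> h) y = 0 \<longrightarrow> sgp \<phi> q y = sgp \<phi> r y)" if "h \<in> H" "map_poly \<psi> h \<noteq> 0" for h
              using that e e' z by (intro bexI[of _ "even_prem q h"]) (auto simp: P_def)
          qed (use z q' sub in \<open>auto simp: P_def\<close>)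
          then show "sign_match \<psi> \<phi> N" using NP by (rule sign_match_mono)
        qed
        then show ?thesis by blast
      qed
      then obtain C where C: "?ctl C N" by blast
      let ?D = "C \<union> (\<Union>q\<in>Q. set (coeffs q))"
      have "?ctl ?D Q"
      proof (intro conjI allI impI)
        show "finite ?D" using C less.prems(1) by simp
        fix \<psi> :: "'r \<Rightarrow> 'b" assume hom': "is_hom \<psi>" and c: "\<forall>c\<in>?D. sg (\<phi> c) = sg (\<psi> c)"
        have m: "sign_match \<phi> \<psi> N" "sign_match \<psi> \<phi> N" using C hom' c by auto
        have 1: "map_poly \<psi> (drop_vanishing \<phi> q) = map_poly \<psi> q" if "q \<in> Q" for q
        proof (rule map_poly_drop_vanishing[OF hom'])
          fix n assume 0: "\<phi> (coeff q n) = 0"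
          show "\<psi> (coeff q n) = 0"
          proof (cases "coeff q n = 0")
            case True then show ?thesis by (simp add: is_hom_zero[OF hom'])
          next
            case False
            then have "coeff q n \<in> set (coeffs q)" by (metis coeff_in_coeffs coeff_eq_0 not_le coeff_0)
            with c that 0 show ?thesis by (metis UN_I UnI2 sg_simps(2))
          qed
        qed
        have 2: "map_poly \<phi> (drop_vanishing \<phi> q) = map_poly \<phi> q" for q
          by (rule map_poly_drop_vanishing[OF hom])
        show "sign_match \<phi> \<psi> Q" "sign_match \<psi> \<phi> Q"
          using sign_match_drop_vanishing[of Q _ "drop_vanishing \<phi>"] 1 2 m unfolding N_def by blast+
      qed
      then show ?case by blast
    qed
  qed
  from this[OF assms(2), of "Max (degree ` Q)"] assms(2) show ?thesis by simp
qed

section \<open>The real closure of an ordered field\<close>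

text \<open>A preliminary form of the set of nonnegative elements of an ordered subfield. Totality and closure under
  inverses are not demanded: they hold for the maximal ones. Squares are demanded only of differences, that is,
  of elements of the subring generated by \<open>P\<close>, because a square of an arbitrary field element need not
  be nonnegative.\<close>

definition precone :: "'c::field set \<Rightarrow> bool" where
  "precone P \<longleftrightarrow> 0 \<in> P \<and> 1 \<in> P \<and> (\<forall>x\<in>P. \<forall>y\<in>P. x + y \<in> P \<and> x * y \<in> P \<and> (x - y)^2 \<in> P)
     \<and> (\<forall>x\<in>P. - x \<in> P \<longrightarrow> x = 0)"

definition maximal_precone :: "'c::field set \<Rightarrow> bool" where
  "maximal_precone M \<longleftrightarrow> precone M \<and> (\<forall>P. precone P \<longrightarrow> M \<subseteq> P \<longrightarrow> P = M)"

lemma precone_extends_to_maximal: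
  assumes "precone P"
  shows "\<exists>M. maximal_precone M \<and> P \<subseteq> M"
proof -
  let ?A = "{Q. precone Q \<and> P \<subseteq> Q}"
  have "\<exists>M\<in>?A. \<forall>Q\<in>?A. M \<subseteq> Q \<longrightarrow> Q = M"
  proof (rule subset_Zorn_nonempty)
    show "?A \<noteq> {}" using assms by auto
    fix C assume C: "C \<noteq> {}" "subset.chain ?A C"
    have mem: "Q \<in> C \<Longrightarrow> precone Q \<and> P \<subseteq> Q" for Q using C(2) by (auto simp: subset_chain_def)
    have two: "\<exists>Q\<in>C. x \<in> Q \<and> y \<in> Q" if "x \<in> \<Union>C" "y \<in> \<Union>C" for x y
    proof -
      from that obtain Q R where Q: "Q \<in> C" "x \<in> Q" "R \<in> C" "y \<in> R" by blast
      then have "Q \<subseteq> R \<or> R \<subseteq> Q" using C(2) by (auto simp: subset_chain_def)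
      with Q show ?thesis by blast
    qed
    have "precone (\<Union>C)"
      unfolding precone_def
    proof (intro conjI ballI impI)
      show "0 \<in> \<Union>C" "1 \<in> \<Union>C" using C(1) mem by (auto simp: precone_def)
      fix x assume x: "x \<in> \<Union>C"
      show "x = 0" if "- x \<in> \<Union>C" using two[OF x that] mem by (auto simp: precone_def)
      fix y assume y: "y \<in> \<Union>C"
      from two[OF x y] obtain Q where "Q \<in> C" "x \<in> Q" "y \<in> Q" by blast
      then show "x + y \<in> \<Union>C" "x * y \<in> \<Union>C" "(x - y)^2 \<in> \<Union>C" using mem[of Q] unfolding precone_def by blast+
    qed
    then show "\<Union>C \<in> ?A" using C(1) mem by blast
  qed
  then obtain M where M: "precone M" "P \<subseteq> M" "\<And>Q. precone Q \<Longrightarrow> P \<subseteq> Q \<Longrightarrow> M \<subseteq> Q \<Longrightarrow> Q = M"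
    by auto
  have "maximal_precone M" unfolding maximal_precone_def
  proof (intro conjI allI impI)
    fix Q assume Q: "precone Q" "M \<subseteq> Q"
    with M(2) have "P \<subseteq> Q" by (rule_tac order_trans)
    with M(3) Q show "Q = M" by blast
  qed (rule M(1))
  with M(2) show ?thesis by blast
qed

locale max_precone =
  fixes M :: "'c::field set"
  assumes maximal: "maximal_precone M"
begin

lemma zero: "0 \<in> M" and one: "1 \<in> M"
  and add: "x \<in> M \<Longrightarrow> y \<in> M \<Longrightarrow> x + y \<in> M"
  and mult: "x \<in> M \<Longrightarrow> y \<in> M \<Longrightarrow> x * y \<in> M"
  and diff_square: "x \<in> M \<Longrightarrow> y \<in> M \<Longrightarrow> (x - y)^2 \<in> M"
  and antisym: "x \<in> M \<Longrightarrow> - x \<in> M \<Longrightarrow> x = 0"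
proof -
  have M: "precone M" using maximal by (simp add: maximal_precone_def)
  show "0 \<in> M" "1 \<in> M" using M by (simp_all add: precone_def)
  show "x + y \<in> M" "x * y \<in> M" "(x - y)^2 \<in> M" if "x \<in> M" "y \<in> M" using M that by (simp_all add: precone_def)
  show "x = 0" if "x \<in> M" "- x \<in> M" using M that by (simp add: precone_def)
qed

lemma maximalD: "precone P \<Longrightarrow> M \<subseteq> P \<Longrightarrow> P = M"
  using maximal by (simp add: maximal_precone_def)

lemma sum_eq_0:
  assumes "x \<in> M" "y \<in> M" "x + y = 0"
  shows "x = 0 \<and> y = 0"
proof -
  have y: "y = - x" using assms(3) by (simp add: eq_neg_iff_add_eq_0 add.commute)
  with antisym[OF assms(1)] assms(2) have "x = 0" by simp
  with y show ?thesis by simp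
qed

text \<open>By maximality \<open>x\<close> already belongs to \<open>M\<close> unless \<open>M + x M\<close> contains a nonzero element together with its
  negative; then \<open>p + x q = 0\<close>, so that \<open>x = - p / q\<close> is not positive.\<close>

lemma adjoin:
  assumes x: "x = a - b" "a \<in> M" "b \<in> M"
  shows "x \<in> M \<or> (\<exists>p\<in>M. \<exists>q\<in>M. q \<noteq> 0 \<and> p + x * q = 0)"
proof -
  define N where "N = {p + x * q | p q. p \<in> M \<and> q \<in> M}"
  have NI: "p \<in> M \<Longrightarrow> q \<in> M \<Longrightarrow> p + x * q \<in> N" for p q by (auto simp: N_def)
  have x2: "x^2 \<in> M" using x diff_square by simp
  have sub: "M \<subseteq> N" using NI[OF _ zero] by auto
  show ?thesis
  proof (cases "\<forall>y\<in>N. - y \<in> N \<longrightarrow> y = 0")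
    case True
    have "precone N"
      unfolding precone_def
    proof (intro conjI ballI)
      show "0 \<in> N" "1 \<in> N" using sub zero one by auto
      fix y z assume "y \<in> N" "z \<in> N"
      then obtain p q r s where y: "y = p + x * q" "p \<in> M" "q \<in> M" and z: "z = r + x * s" "r \<in> M" "s \<in> M"
        by (auto simp: N_def)
      have "y + z = (p + r) + x * (q + s)" unfolding y z by (simp add: algebra_simps)
      then show "y + z \<in> N" using NI[of "p + r" "q + s"] add y z by metis
      have "y * z = (p * r + x^2 * (q * s)) + x * (p * s + q * r)"
        unfolding y z by (simp add: algebra_simps power2_eq_square)
      then show "y * z \<in> N" using NI[of "p * r + x^2 * (q * s)" "p * s + q * r"] add mult y z x2 by metis
      have "y - z = (p + a * q + r * 0 + b * s) - (r + b * q + a * s)"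
        unfolding y z x by (simp add: algebra_simps)
      moreover have "p + a * q + r * 0 + b * s \<in> M" "r + b * q + a * s \<in> M"
        using y z x add mult zero by simp_all
      ultimately have "(y - z)^2 \<in> M" using diff_square by metis
      then show "(y - z)^2 \<in> N" using sub by blast
    qed (use True in blast)
    then have "N = M" using maximalD sub by blast
    then show ?thesis using NI[OF zero one] by simp
  next
    case False
    then obtain p q r s where y: "p \<in> M" "q \<in> M" "r \<in> M" "s \<in> M" "p + x * q \<noteq> 0"
      "- (p + x * q) = r + x * s"
      by (auto simp: N_def)
    have "(p + r) + x * (q + s) = (p + x * q) + (r + x * s)" by (simp add: algebra_simps)
    also have "\<dots> = 0" unfolding y(6)[symmetric] by simp
    finally have 0: "(p + r) + x * (q + s) = 0" .
    have "q + s \<noteq> 0"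
    proof
      assume qs: "q + s = 0"
      with 0 have "p + r = 0" by simp
      with qs have "p = 0" "q = 0" using sum_eq_0[of p r] sum_eq_0[of q s] y by blast+
      with y(5) show False by simp
    qed
    with 0 add[OF y(1,3)] add[OF y(2,4)] show ?thesis by blast
  qed
qed

lemma total: "a \<in> M \<Longrightarrow> b \<in> M \<Longrightarrow> a - b \<in> M \<or> b - a \<in> M"
proof (rule ccontr)
  assume ab: "a \<in> M" "b \<in> M" and n: "\<not> (a - b \<in> M \<or> b - a \<in> M)"
  obtain p q where 1: "p \<in> M" "q \<in> M" "q \<noteq> 0" "p + (a - b) * q = 0"
    using adjoin[OF refl ab] n by blast
  obtain r s where 2: "r \<in> M" "s \<in> M" "s \<noteq> 0" "r + (b - a) * s = 0"
    using adjoin[OF refl ab(2,1)] n by blast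
  have "p * s + r * q = (p + (a - b) * q) * s + (r + (b - a) * s) * q" by (simp add: algebra_simps)
  also have "\<dots> = 0" using 1 2 by simp
  finally have "p * s = 0" using sum_eq_0[of "p * s" "r * q"] 1 2 mult by blast
  with 1 2 have "a - b = 0" by auto
  with n zero show False by simp
qed

definition cone_field :: "'c set" where "cone_field = {x. x \<in> M \<or> - x \<in> M}"

lemma cone_field_uminus: "x \<in> cone_field \<Longrightarrow> - x \<in> cone_field"
  by (auto simp: cone_field_def)

lemma cone_field_add:
  assumes "x \<in> cone_field" "y \<in> cone_field"
  shows "x + y \<in> cone_field"
proof -
  consider "x \<in> M" "y \<in> M" | "x \<in> M" "- y \<in> M" | "- x \<in> M" "y \<in> M" | "- x \<in> M" "- y \<in> M"
    using assms unfolding cone_field_def by blast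
  then show ?thesis
  proof cases
    case 1 then show ?thesis using add by (simp add: cone_field_def)
  next
    case 2
    have "x - - y = x + y" "- y - x = - (x + y)" by simp_all
    with total[OF 2] show ?thesis unfolding cone_field_def mem_Collect_eq by metis
  next
    case 3
    have "y - - x = x + y" "- x - y = - (x + y)" by simp_all
    with total[OF 3(2,1)] show ?thesis unfolding cone_field_def mem_Collect_eq by metis
  next
    case 4
    have "- x + - y = - (x + y)" by simp
    with add[OF 4] show ?thesis unfolding cone_field_def mem_Collect_eq by metis
  qed
qed

lemma cone_field_mult:
  assumes "x \<in> cone_field" "y \<in> cone_field"
  shows "x * y \<in> cone_field"
proof -
  consider "x \<in> M" "y \<in> M" | "x \<in> M" "- y \<in> M" | "- x \<in> M" "y \<in> M" | "- x \<in> M" "- y \<in> M"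
    using assms unfolding cone_field_def by blast
  then show ?thesis
  proof cases
    case 1 then show ?thesis using mult by (simp add: cone_field_def)
  next
    case 2 from mult[OF 2] show ?thesis by (simp add: cone_field_def)
  next
    case 3 from mult[OF 3] show ?thesis by (simp add: cone_field_def)
  next
    case 4 from mult[OF 4] show ?thesis by (simp add: cone_field_def)
  qed
qed

text \<open>Quotients of elements of \<open>M\<close> form a precone as well.\<close>

lemma inverse: "x \<in> M \<Longrightarrow> inverse x \<in> M"
proof -
  assume x: "x \<in> M"
  define N where "N = {p / q | p q. p \<in> M \<and> q \<in> M \<and> q \<noteq> 0}"
  have NI: "p \<in> M \<Longrightarrow> q \<in> M \<Longrightarrow> q \<noteq> 0 \<Longrightarrow> p / q \<in> N" for p q by (auto simp: N_def)
  have sub: "M \<subseteq> N" using NI[OF _ one] by auto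
  have "precone N"
    unfolding precone_def
  proof (intro conjI ballI impI)
    show "0 \<in> N" "1 \<in> N" using sub zero one by auto
    fix y assume "y \<in> N"
    then obtain p q where y: "y = p / q" "p \<in> M" "q \<in> M" "q \<noteq> 0" by (auto simp: N_def)
    show "y = 0" if ny: "- y \<in> N"
    proof -
      obtain r s where z: "- y = r / s" "r \<in> M" "s \<in> M" "s \<noteq> 0" using ny by (auto simp: N_def)
      have "p = y * q" "r = (- y) * s" using y z by simp_all
      then have "p * s + r * q = 0" by simp
      then have "p * s = 0" using sum_eq_0[of "p * s" "r * q"] y z mult by blast
      with y z show ?thesis by simp
    qed
    fix z assume "z \<in> N"
    then obtain r s where z: "z = r / s" "r \<in> M" "s \<in> M" "s \<noteq> 0" by (auto simp: N_def)
    have "y + z = (p * s + r * q) / (q * s)" unfolding y z using y(4) z(4) by (simp add: add_frac_eq)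
    then show "y + z \<in> N" using NI[of "p * s + r * q" "q * s"] y z add mult by simp
    have "y * z = (p * r) / (q * s)" unfolding y z by simp
    then show "y * z \<in> N" using NI[of "p * r" "q * s"] y z add mult by simp
    have "(y - z)^2 = (p * s - r * q)^2 / ((q * s) * (q * s))"
      unfolding y z using y(4) z(4) by (simp add: diff_frac_eq power_divide power2_eq_square)
    moreover have "(p * s - r * q)^2 \<in> M" using y z mult diff_square by simp
    ultimately show "(y - z)^2 \<in> N" using NI[of "(p * s - r * q)^2" "(q * s) * (q * s)"] y z mult by simp
  qed
  then have "N = M" using maximalD sub by blast
  moreover have "inverse x \<in> N" using NI[OF one x] zero sub by (cases "x = 0") (auto simp: divide_inverse)
  ultimately show "inverse x \<in> M" by simp
qed

lemma cone_field_inverse: "x \<in> cone_field \<Longrightarrow> inverse x \<in> cone_field"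
proof -
  assume "x \<in> cone_field"
  then consider "x \<in> M" | "- x \<in> M" unfolding cone_field_def by blast
  then show "inverse x \<in> cone_field"
  proof cases
    case 1 from inverse[OF 1] show ?thesis by (simp add: cone_field_def)
  next
    case 2
    have "inverse (- x) = - inverse x" by (rule inverse_minus_eq)
    with inverse[OF 2] show ?thesis by (simp add: cone_field_def)
  qed
qed

end

text \<open>A fixed choice of a maximal cone inside the algebraic closure, so that the real closure becomes a type.\<close>

definition closure_cone :: "'a::linordered_field alg_closure set" where
  "closure_cone = (SOME M. maximal_precone M \<and> to_ac ` {x. 0 \<le> x} \<subseteq> M)"

lemma closure_cone: "maximal_precone (closure_cone :: 'a::linordered_field alg_closure set)"
    "to_ac ` {x::'a. 0 \<le> x} \<subseteq> closure_cone"
proof -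
  have "precone (to_ac ` {x::'a. 0 \<le> x})"
    unfolding precone_def
  proof (intro conjI ballI impI)
    show "0 \<in> to_ac ` {x::'a. 0 \<le> x}" by (rule image_eqI[of _ _ 0]) auto
    show "1 \<in> to_ac ` {x::'a. 0 \<le> x}" by (rule image_eqI[of _ _ 1]) auto
    fix u assume "u \<in> to_ac ` {x::'a. 0 \<le> x}"
    then obtain x :: 'a where x: "u = to_ac x" "0 \<le> x" by blast
    show "u = 0" if "- u \<in> to_ac ` {x::'a. 0 \<le> x}"
    proof -
      obtain y :: 'a where y: "- u = to_ac y" "0 \<le> y" using \<open>- u \<in> _\<close> by blast
      have "to_ac y = to_ac (- x)" using y x by simp
      then have "y = - x" by (simp only: to_ac_eq_iff)
      with x y show ?thesis by simp
    qed
    fix v assume "v \<in> to_ac ` {x::'a. 0 \<le> x}"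
    then obtain y :: 'a where y: "v = to_ac y" "0 \<le> y" by blast
    show "u + v \<in> to_ac ` {x::'a. 0 \<le> x}" by (rule image_eqI[of _ _ "x + y"]) (use x y in auto)
    show "u * v \<in> to_ac ` {x::'a. 0 \<le> x}" by (rule image_eqI[of _ _ "x * y"]) (use x y in auto)
    show "(u - v)^2 \<in> to_ac ` {x::'a. 0 \<le> x}" by (rule image_eqI[of _ _ "(x - y)^2"]) (use x y in auto)
  qed
  from precone_extends_to_maximal[OF this]
  have "maximal_precone (closure_cone :: 'a alg_closure set) \<and> to_ac ` {x::'a. 0 \<le> x} \<subseteq> closure_cone"
    unfolding closure_cone_def by (rule someI_ex)
  then show "maximal_precone (closure_cone :: 'a::linordered_field alg_closure set)"
    "to_ac ` {x::'a. 0 \<le> x} \<subseteq> closure_cone" by auto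
qed

interpretation CC: max_precone "closure_cone :: 'a::linordered_field alg_closure set"
  by standard (rule closure_cone)

typedef (overloaded) 'a real_closure = "CC.cone_field :: 'a::linordered_field alg_closure set"
  using CC.zero by (auto simp: CC.cone_field_def)

setup_lifting type_definition_real_closure

instantiation real_closure :: (linordered_field) linordered_field
begin

lift_definition zero_real_closure :: "'a real_closure" is 0 by (simp add: CC.cone_field_def CC.zero)
lift_definition one_real_closure :: "'a real_closure" is 1 by (simp add: CC.cone_field_def CC.one)
lift_definition uminus_real_closure :: "'a real_closure \<Rightarrow> 'a real_closure" is uminus
  by (rule CC.cone_field_uminus)
lift_definition plus_real_closure :: "'a real_closure \<Rightarrow> 'a real_closure \<Rightarrow> 'a real_closure" is "(+)"
  by (rule CC.cone_field_add)
lift_definition minus_real_closure :: "'a real_closure \<Rightarrow> 'a real_closure \<Rightarrow> 'a real_closure" is "\<lambda>x y. x + - y"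
  by (intro CC.cone_field_add CC.cone_field_uminus)
lift_definition times_real_closure :: "'a real_closure \<Rightarrow> 'a real_closure \<Rightarrow> 'a real_closure" is "(*)"
  by (rule CC.cone_field_mult)
lift_definition inverse_real_closure :: "'a real_closure \<Rightarrow> 'a real_closure" is inverse
  by (rule CC.cone_field_inverse)
definition divide_real_closure :: "'a real_closure \<Rightarrow> 'a real_closure \<Rightarrow> 'a real_closure" where
  "divide_real_closure x y = x * inverse y"
lift_definition less_eq_real_closure :: "'a real_closure \<Rightarrow> 'a real_closure \<Rightarrow> bool"
  is "\<lambda>x y. y - x \<in> closure_cone" .
definition less_real_closure :: "'a real_closure \<Rightarrow> 'a real_closure \<Rightarrow> bool" where
  "less_real_closure x y \<longleftrightarrow> x \<le> y \<and> \<not> y \<le> x"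
definition abs_real_closure :: "'a real_closure \<Rightarrow> 'a real_closure" where
  "abs_real_closure x = (if x < 0 then - x else x)"
definition sgn_real_closure :: "'a real_closure \<Rightarrow> 'a real_closure" where
  "sgn_real_closure x = (if x = 0 then 0 else if 0 < x then 1 else - 1)"

lemmas real_closure_rep = zero_real_closure.rep_eq one_real_closure.rep_eq uminus_real_closure.rep_eq
  plus_real_closure.rep_eq minus_real_closure.rep_eq times_real_closure.rep_eq inverse_real_closure.rep_eq

lemma real_closure_eqI: "Rep_real_closure x = Rep_real_closure y \<Longrightarrow> x = y"
  by (simp only: Rep_real_closure_inject)

lemma real_closure_le_iff: "x \<le> y \<longleftrightarrow> Rep_real_closure y - Rep_real_closure x \<in> closure_cone"
  by (rule less_eq_real_closure.rep_eq)

instance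
proof
  fix x y z :: "'a real_closure"
  note eqI = real_closure_eqI and rep = real_closure_rep and le = real_closure_le_iff
  let ?r = "Rep_real_closure :: 'a real_closure \<Rightarrow> _"
  show "x + y + z = x + (y + z)" by (rule eqI) (simp add: rep)
  show "x + y = y + x" by (rule eqI) (simp add: rep)
  show "0 + x = x" by (rule eqI) (simp add: rep)
  show "- x + x = 0" by (rule eqI) (simp add: rep)
  show "x - y = x + - y" by (rule eqI) (simp add: rep)
  show "x + y - x = y" by (rule eqI) (simp add: rep)
  show "x - y - z = x - (y + z)" by (rule eqI) (simp add: rep)
  show "0 * x = 0" by (rule eqI) (simp add: rep)
  show "x * 0 = 0" by (rule eqI) (simp add: rep)
  show "x * y * z = x * (y * z)" by (rule eqI) (simp add: rep)
  show "x * y = y * x" by (rule eqI) (simp add: rep)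
  show "1 * x = x" by (rule eqI) (simp add: rep)
  show "(x + y) * z = x * z + y * z" by (rule eqI) (simp add: rep distrib_right)
  show "(0 :: 'a real_closure) \<noteq> 1" using Rep_real_closure_inject[of 0 1] by (simp add: rep)
  show "inverse x * x = 1" if "x \<noteq> 0"
    using that Rep_real_closure_inject[of x 0] by (intro eqI) (simp add: rep)
  show "x div y = x * inverse y" by (rule divide_real_closure_def)
  show "inverse (0 :: 'a real_closure) = 0" by (rule eqI) (simp add: rep)
  show "(x < y) = (x \<le> y \<and> \<not> y \<le> x)" by (rule less_real_closure_def)
  show "x \<le> x" by (simp add: le CC.zero)
  show "x \<le> z" if "x \<le> y" "y \<le> z"
    using CC.add[of "?r y - ?r x" "?r z - ?r y"] that by (simp add: le)
  show anti: "x = y" if "x \<le> y" "y \<le> x" for x y :: "'a real_closure"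
    using CC.antisym[of "?r y - ?r x"] that by (intro eqI) (simp add: le)
  show "x \<le> y \<or> y \<le> x"
  proof -
    have "?r y + - ?r x \<in> CC.cone_field"
      by (intro CC.cone_field_add CC.cone_field_uminus Rep_real_closure)
    then show ?thesis by (simp add: le CC.cone_field_def)
  qed
  show "z + x \<le> z + y" if "x \<le> y" using that by (simp add: le rep)
  show "z * x < z * y" if "x < y" "0 < z"
  proof -
    have xy: "x \<le> y" "x \<noteq> y" and z: "0 \<le> z" "z \<noteq> 0"
      using that \<open>x \<le> x\<close> by (auto simp: less_real_closure_def)
    have "?r z * (?r y - ?r x) \<in> closure_cone" using xy z by (intro CC.mult) (simp_all add: le rep)
    then have zxy: "z * x \<le> z * y" by (simp add: le rep right_diff_distrib)
    have "?r z \<noteq> 0" "?r x \<noteq> ?r y"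
      using xy z Rep_real_closure_inject[of z 0] Rep_real_closure_inject[of x y] by (auto simp: rep)
    then have "?r (z * x) \<noteq> ?r (z * y)" by (simp add: rep)
    then have "z * x \<noteq> z * y" by auto
    with zxy anti show ?thesis unfolding less_real_closure_def by blast
  qed
  show "\<bar>x\<bar> = (if x < 0 then - x else x)" by (rule abs_real_closure_def)
  show "sgn x = (if x = 0 then 0 else if 0 < x then 1 else - 1)" by (rule sgn_real_closure_def)
qed

end


text \<open>A nonzero combination of \<open>h\<close> and \<open>q\<close> of least degree divides both, so it is constant.\<close>

lemma bezout_irreducible:
  fixes q h :: "'k::field poly"
  assumes deg: "0 < degree q" and irr: "\<And>g. g dvd q \<Longrightarrow> degree g < degree q \<Longrightarrow> degree g = 0"
    and nd: "\<not> q dvd h"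
  shows "\<exists>k. q dvd k * h - 1"
proof -
  have q0: "q \<noteq> 0" using deg by auto
  let ?I = "\<lambda>g. g \<noteq> 0 \<and> (\<exists>k l. g = k * h + l * q)"
  have "?I q" using q0 by (auto intro: exI[of _ 0] exI[of _ 1])
  from ex_has_least_nat[of ?I, OF this, of degree] obtain g
    where g: "?I g" and gmin: "\<And>g'. ?I g' \<Longrightarrow> degree g \<le> degree g'" by blast
  obtain k l where kl: "g = k * h + l * q" using g by blast
  have div: "g dvd k' * h + l' * q" for k' l'
  proof -
    let ?f = "k' * h + l' * q"
    define t where "t = ?f div g"
    have "?f mod g = ?f - t * g" by (simp add: t_def minus_div_mult_eq_mod)
    also have "t * g = t * k * h + t * l * q" unfolding kl by (simp add: algebra_simps)
    also have "?f - (t * k * h + t * l * q) = (k' - t * k) * h + (l' - t * l) * q"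
      by (simp add: algebra_simps)
    finally have "?f mod g = 0 \<or> ?I (?f mod g)" by blast
    moreover have "?f mod g = 0 \<or> degree (?f mod g) < degree g" using g by (intro degree_mod_less) auto
    ultimately show ?thesis using gmin by (metis mod_eq_0_iff_dvd not_less)
  qed
  have gh: "g dvd h" using div[of 1 0] by simp
  have gq: "g dvd q" using div[of 0 1] by simp
  show ?thesis
  proof (cases "degree g < degree q")
    case True
    then have "degree g = 0" using irr gq by blast
    then obtain c where c: "g = [:c:]" by (rule degree_eq_zeroE)
    have "c \<noteq> 0" using g c by auto
    have "smult (1/c) k * h + smult (1/c) l * q = smult (1/c) (k * h + l * q)" by (simp add: smult_add_right)
    also have "\<dots> = smult (1/c) [:c:]" using kl c by simp
    also have "\<dots> = 1" using \<open>c \<noteq> 0\<close> by (simp add: one_pCons)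
    finally have eq: "smult (1/c) k * h + smult (1/c) l * q = 1" .
    have "smult (1/c) k * h - (smult (1/c) k * h + smult (1/c) l * q) = q * (- smult (1/c) l)"
      by (simp add: mult.commute)
    then have "q dvd smult (1/c) k * h - (smult (1/c) k * h + smult (1/c) l * q)" by (metis dvd_triv_left)
    then show ?thesis unfolding eq by blast
  next
    case False
    obtain m where m: "q = g * m" using gq by (auto simp: dvd_def)
    have "m \<noteq> 0" "g \<noteq> 0" using m q0 by auto
    then have "degree q = degree g + degree m" by (simp add: m degree_mult_eq)
    with False have "degree m = 0" by simp
    then obtain c where c: "m = [:c:]" by (rule degree_eq_zeroE)
    have "c \<noteq> 0" using c \<open>m \<noteq> 0\<close> by auto
    then have "g = q * [:1/c:]" unfolding m c by simp
    then have "q dvd g" by (metis dvd_triv_left)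
    with gh nd show ?thesis using dvd_trans by blast
  qed
qed

inductive_set psos :: "'k::linordered_field poly set" where
  zero: "0 \<in> psos"
| add: "N \<in> psos \<Longrightarrow> 0 \<le> c \<Longrightarrow> N + smult c (h^2) \<in> psos"

lemma psos_square: "0 \<le> c \<Longrightarrow> smult c (h^2) \<in> psos"
  using psos.add[OF psos.zero, of c h] by simp

lemma psos_add: "N \<in> psos \<Longrightarrow> N' \<in> psos \<Longrightarrow> N' + N \<in> psos"
  by (induction rule: psos.induct) (auto simp: add.assoc[symmetric] intro: psos.add)

lemma psos_mult_square: "N \<in> psos \<Longrightarrow> 0 \<le> c \<Longrightarrow> N * smult c (h^2) \<in> psos"
proof (induction rule: psos.induct)
  case zero then show ?case by (simp add: psos.zero)
next
  case (add N d g)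
  have "(N + smult d (g^2)) * smult c (h^2) = N * smult c (h^2) + smult (d * c) ((g * h)^2)"
    by (simp add: algebra_simps smult_add_right power_mult_distrib)
  with add show ?case by (auto intro!: psos.add)
qed

lemma psos_mult: "N \<in> psos \<Longrightarrow> N' \<in> psos \<Longrightarrow> N' * N \<in> psos"
proof (induction rule: psos.induct)
  case zero then show ?case by (simp add: psos.zero)
next
  case (add N d g)
  then show ?case unfolding distrib_left by (intro psos_add psos_mult_square) auto
qed

lemma psos_nonneg: "N \<in> psos \<Longrightarrow> 0 \<le> poly N x"
  by (induction rule: psos.induct) auto

lemma psos_reduce:
  assumes "N \<in> psos" and q: "0 < degree (q :: 'k::linordered_field poly)"
  shows "\<exists>N'\<in>psos. degree N' \<le> 2 * (degree q - 1) \<and> q dvd N - N'"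
  using assms(1)
proof (induction rule: psos.induct)
  case zero show ?case by (intro bexI[of _ 0]) (auto intro: psos.zero)
next
  case (add N c h)
  then obtain N' where N': "N' \<in> psos" "degree N' \<le> 2 * (degree q - 1)" "q dvd N - N'" by blast
  let ?r = "h mod q"
  have r: "degree ?r \<le> degree q - 1"
    using degree_mod_less[of q h] q by fastforce
  have "degree (?r^2) \<le> 2 * (degree q - 1)"
    using degree_power_le[of ?r 2] r by (simp add: mult.commute)
  then have "degree (N' + smult c (?r^2)) \<le> 2 * (degree q - 1)"
    using N'(2) degree_smult_le[of c "?r^2"] by (intro degree_add_le) auto
  moreover have "q dvd (N + smult c (h^2)) - (N' + smult c (?r^2))"
  proof -
    have "h - ?r = q * (h div q)" by (simp add: minus_mod_eq_mult_div)
    then have "q dvd smult c ((h - ?r) * (h + ?r))" by (metis dvd_smult dvd_mult2 dvd_triv_left)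
    moreover have "(N + smult c (h^2)) - (N' + smult c (?r^2)) = (N - N') + smult c ((h - ?r) * (h + ?r))"
    proof -
      have "(h - ?r) * (h + ?r) = h^2 - ?r^2" by (simp add: power2_eq_square algebra_simps)
      then have "smult c ((h - ?r) * (h + ?r)) = smult c (h^2) - smult c (?r^2)"
        by (simp only: smult_diff_right)
      then show ?thesis by simp
    qed
    ultimately show ?thesis using N'(3) by (metis dvd_add)
  qed
  ultimately show ?case using N'(1) add.hyps by (intro bexI[of _ "N' + smult c (?r^2)"]) (auto intro: psos.add)
qed

abbreviation rep :: "'a::linordered_field real_closure \<Rightarrow> 'a alg_closure" where "rep \<equiv> Rep_real_closure"

lemma is_hom_rep: "is_hom rep"
  by (simp add: is_hom_def real_closure_rep)

lemma rep_nonneg_iff: "0 \<le> x \<longleftrightarrow> rep x \<in> closure_cone"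
  by (simp add: real_closure_le_iff real_closure_rep)

lemma rep_surj: "u \<in> CC.cone_field \<Longrightarrow> \<exists>x. rep x = u"
  using Rep_real_closure_cases by metis

lemma poly_map_rep: "poly (map_poly rep q) (rep c) = rep (poly q c)"
  by (induction q) (simp_all add: map_poly_pCons real_closure_rep)

text \<open>It is enough to treat a polynomial \<open>q\<close> without proper factors, since a factor changes sign as well. Let
  \<open>\<theta>\<close> be a root of \<open>q\<close> in the algebraic closure. If the values at \<open>\<theta>\<close> of weighted sums of squares form a precone,
  it is the maximal one, and \<open>\<theta>\<close> lies in the real closure. Otherwise \<open>q\<close> divides some \<open>1 + N\<close> with \<open>N\<close> a
  weighted sum of squares, and \<open>N\<close> may be taken of degree at most \<open>2 deg q - 2\<close>. The cofactor then has smaller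
  degree than \<open>q\<close> and changes sign between \<open>a\<close> and \<open>b\<close> like \<open>q\<close>; a root of it would be a root of \<open>1 + N \<ge> 1\<close>.\<close>

lemma real_closure_root:
  fixes q :: "'a::linordered_field real_closure poly"
  assumes "poly q a * poly q b < 0"
  shows "\<exists>c. poly q c = 0"
  using assms
proof (induction "degree q" arbitrary: q rule: less_induct)
  case less
  have q0: "q \<noteq> 0" using less.prems by auto
  have dq: "0 < degree q"
  proof (rule ccontr)
    assume "\<not> ?thesis"
    then have "degree q = 0" by simp
    then obtain c where "q = [:c:]" by (rule degree_eq_zeroE)
    with less.prems show False using zero_le_square[of c] by simp
  qed
  show ?case
  proof (cases "\<exists>g. g dvd q \<and> 0 < degree g \<and> degree g < degree q")
    case True
    then obtain g m where g: "q = g * m" "0 < degree g" "degree g < degree q" by (auto simp: dvd_def)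
    have "m \<noteq> 0" "g \<noteq> 0" using g(1) q0 by auto
    then have "degree m < degree q" using g by (simp add: degree_mult_eq)
    moreover have "(poly g a * poly g b) * (poly m a * poly m b) < 0"
      using less.prems by (simp add: g(1) mult.assoc mult.left_commute)
    then have "poly g a * poly g b < 0 \<or> poly m a * poly m b < 0"
      by (auto simp: mult_less_0_iff)
    ultimately obtain c where "poly g c = 0 \<or> poly m c = 0" using less.hyps g(3) by blast
    then show ?thesis by (auto simp: g(1))
  next
    case False
    then have irr: "\<And>g. g dvd q \<Longrightarrow> degree g < degree q \<Longrightarrow> degree g = 0" by auto
    have "degree (map_poly rep q) = degree q"
      by (rule map_poly_degree_eq) (use q0 Rep_real_closure_inject[of "lead_coeff q" 0] in \<open>simp add: real_closure_rep\<close>)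
    then obtain \<theta> where \<theta>: "poly (map_poly rep q) \<theta> = 0"
      using alg_closed_imp_poly_has_root[of "map_poly rep q"] dq by auto
    define ev where "ev h = poly (map_poly rep h) \<theta>" for h
    have ev_add: "ev (g + h) = ev g + ev h" and ev_mult: "ev (g * h) = ev g * ev h" 
      and ev_smult: "ev (smult c h) = rep c * ev h" and ev_0: "ev 0 = 0" and ev_1: "ev 1 = 1" for g h c
      by (simp_all add: ev_def map_poly_hom_add[OF is_hom_rep] map_poly_hom_mult[OF is_hom_rep]
          map_poly_hom_smult[OF is_hom_rep] real_closure_rep)
    have ev_diff: "ev (g - h) = ev g - ev h" for g h
      using ev_add[of "g - h" h] by simp
    have ev_q: "q dvd h \<Longrightarrow> ev h = 0" for h using \<theta> by (auto simp: dvd_def ev_mult) (simp add: ev_def)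
    have q_ev: "q dvd h" if h: "ev h = 0" for h
    proof (rule ccontr)
      assume "\<not> q dvd h"
      from bezout_irreducible[OF dq irr this] obtain k where "q dvd k * h - 1" by blast
      from ev_q[OF this] h show False by (simp add: ev_diff ev_mult ev_1)
    qed
    \<comment> \<open>\<open>-1\<close> is not a weighted sum of squares modulo \<open>q\<close>\<close>
    have no_neg: "\<not> q dvd 1 + N" if N: "N \<in> psos" for N
    proof
      assume dvd: "q dvd 1 + N"
      obtain N' where N': "N' \<in> psos" "degree N' \<le> 2 * (degree q - 1)" "q dvd N - N'"
        using psos_reduce[OF N dq] by blast
      have "q dvd (1 + N) - (N - N')" using dvd N'(3) by (rule dvd_diff)
      then obtain r where r: "1 + N' = q * r" by (auto simp: dvd_def)
      have pos: "0 < poly (q * r) x" for x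
        unfolding r[symmetric] using psos_nonneg[OF N'(1), of x] by (simp add: add_pos_nonneg)
      have "r \<noteq> 0" using pos[of 0] by auto
      then have "degree q + degree r = degree (1 + N')" using r q0 by (simp add: degree_mult_eq)
      also have "\<dots> \<le> 2 * (degree q - 1)" using N'(2) by (intro degree_add_le) auto
      finally have "degree r < degree q" using dq by simp
      moreover have "poly r a * poly r b < 0"
      proof -
        have "0 < (poly q a * poly r a) * (poly q b * poly r b)" using pos[of a] pos[of b] by (simp add: zero_less_mult_iff)
        then have "0 < (poly q a * poly q b) * (poly r a * poly r b)" by (simp add: mult.assoc mult.left_commute)
        with less.prems show ?thesis by (metis less_asym zero_less_mult_iff)
      qed
      ultimately obtain c where "poly r c = 0" using less.hyps by blast
      with pos[of c] show False by simp
    qed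
    define T where "T = ev ` psos"
    have TI: "N \<in> psos \<Longrightarrow> ev N \<in> T" for N by (simp add: T_def)
    have anti: "ev N = 0" if N: "N \<in> psos" "N' \<in> psos" and sum: "ev N + ev N' = 0" for N N'
    proof (rule ccontr)
      assume nz: "ev N \<noteq> 0"
      then have "\<not> q dvd N" using ev_q by blast
      from bezout_irreducible[OF dq irr this] obtain k where k: "q dvd k * N - 1" by blast
      have kN: "ev k * ev N = 1" using ev_q[OF k] by (simp add: ev_diff ev_mult ev_1)
      have "ev (1 + smult 1 (k^2) * (N * N')) = 1 + (ev k * ev N) * (ev k * ev N')"
        by (simp add: ev_add ev_1 ev_mult power2_eq_square ev_smult real_closure_rep algebra_simps)
      also have "\<dots> = ev k * (ev N + ev N')" using kN by (simp add: algebra_simps)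
      finally have "q dvd 1 + smult 1 (k^2) * (N * N')" using sum q_ev by simp
      moreover have "smult 1 (k^2) * (N * N') \<in> psos" using N by (intro psos_mult psos_square) auto
      ultimately show False using no_neg by blast
    qed
    have one: "1 \<in> (psos :: 'a real_closure poly set)" using psos_square[OF zero_le_one, of 1] by (simp only: smult_1_left power_one)
    have "precone T"
      unfolding precone_def
    proof (intro conjI ballI impI)
      show "0 \<in> T" using TI[OF psos.zero] ev_0 by simp
      show "1 \<in> T" using TI[OF one] ev_1 by simp
      fix x assume "x \<in> T"
      then obtain N where N: "x = ev N" "N \<in> psos" by (auto simp: T_def)
      show "x = 0" if nx: "- x \<in> T"
      proof -
        obtain N' where "- x = ev N'" "N' \<in> psos" using nx by (auto simp: T_def)
        with anti[of N N'] N show ?thesis by (metis add.right_inverse)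
      qed
      fix y assume "y \<in> T"
      then obtain N' where N': "y = ev N'" "N' \<in> psos" by (auto simp: T_def)
      show "x + y \<in> T" using TI[OF psos_add[OF N'(2) N(2)]] by (simp add: N N' ev_add)
      show "x * y \<in> T" using TI[OF psos_mult[OF N'(2) N(2)]] by (simp add: N N' ev_mult)
      show "(x - y)^2 \<in> T" using TI[OF psos_square[of 1 "N - N'"]]
        by (simp add: N N' ev_mult ev_diff power2_eq_square)
    qed
    moreover have "closure_cone \<subseteq> T"
    proof
      fix u :: "'a alg_closure" assume u: "u \<in> closure_cone"
      then obtain c where c: "rep c = u" using rep_surj[of u] by (auto simp: CC.cone_field_def)
      have "ev (smult c (1^2)) = u" by (simp only: ev_smult power_one ev_1 c mult_1_right)
      moreover have "smult c (1^2) \<in> psos" using u c rep_nonneg_iff[of c] by (intro psos_square) simp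
      ultimately show "u \<in> T" by (auto simp: T_def)
    qed
    ultimately have T: "T = closure_cone" by (rule CC.maximalD)
    have sq: "(ev h)^2 \<in> closure_cone" for h
      using TI[OF psos_square[of 1 h]] by (simp add: ev_mult power2_eq_square T)
    have "\<theta> = ev [:0, 1:]" by (simp add: ev_def map_poly_pCons real_closure_rep)
    then have "(\<theta> + 1)^2 \<in> closure_cone" "(\<theta> - 1)^2 \<in> closure_cone"
      using sq[of "[:0, 1:] + 1"] sq[of "[:0, 1:] - 1"] by (simp_all only: ev_add ev_diff ev_1)
    then have "(\<theta> + 1)^2 + - ((\<theta> - 1)^2) \<in> CC.cone_field"
      by (intro CC.cone_field_add CC.cone_field_uminus) (auto simp: CC.cone_field_def)
    moreover have "(4 :: 'a alg_closure) = rep 4"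
      using is_hom_of_nat[OF is_hom_rep, of 4] by simp
    then have "inverse 4 \<in> (CC.cone_field :: 'a alg_closure set)"
      using Rep_real_closure[of "4 :: 'a real_closure"] by (intro CC.cone_field_inverse) metis
    ultimately have "inverse 4 * ((\<theta> + 1)^2 + - ((\<theta> - 1)^2)) \<in> CC.cone_field"
      by (intro CC.cone_field_mult)
    \<comment> \<open>recover \<open>\<theta>\<close> itself from squares\<close>
    moreover have "inverse 4 * ((\<theta> + 1)^2 + - ((\<theta> - 1)^2)) = \<theta>"
      by (simp add: power2_eq_square algebra_simps)
    ultimately obtain c where c: "rep c = \<theta>" using rep_surj[of \<theta>] by auto
    have "rep (poly q c) = rep 0" using \<theta> by (simp add: c[symmetric] poly_map_rep real_closure_rep)
    then show ?thesis by (auto simp: Rep_real_closure_inject)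
  qed
qed

text \<open>Split off a root. Either its linear factor changes sign between \<open>a\<close> and \<open>b\<close>, and the root lies there, or the
  cofactor does.\<close>

lemma real_closure_ivt:
  fixes q :: "'a::linordered_field real_closure poly"
  assumes ab: "a < b" and "poly q a * poly q b < 0"
  shows "\<exists>c. a < c \<and> c < b \<and> poly q c = 0"
  using assms(2)
proof (induction "degree q" arbitrary: q rule: less_induct)
  case less
  obtain c where c: "poly q c = 0" using real_closure_root[OF less.prems] by blast
  then obtain h where h: "q = [:-c, 1:] * h" by (auto simp: poly_eq_0_iff_dvd dvd_def)
  have "h \<noteq> 0" using less.prems h by auto
  then have deg: "degree h < degree q" unfolding h by (subst degree_mult_eq) auto
  have "((a - c) * (b - c)) * (poly h a * poly h b) < 0"
    using less.prems by (simp add: h algebra_simps)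
  then consider "(a - c) * (b - c) < 0" | "poly h a * poly h b < 0" by (auto simp: mult_less_0_iff)
  then show ?case
  proof cases
    case 1
    with ab have "a < c" "c < b" by (auto simp: mult_less_0_iff)
    with c show ?thesis by blast
  next
    case 2
    from less.hyps[OF deg this] h show ?thesis by auto
  qed
qed

instance real_closure :: (linordered_field) real_closed_field
proof
  fix a b :: "'a real_closure" and c :: "nat \<Rightarrow> 'a real_closure" and n
  assume ab: "a < b" and lo: "(\<Sum>k\<le>n. c k * a ^ k) < 0" and hi: "0 < (\<Sum>k\<le>n. c k * b ^ k)"
  define q where "q = (\<Sum>k\<le>n. monom (c k) k)"
  have q: "poly q x = (\<Sum>k\<le>n. c k * x ^ k)" for x by (simp add: q_def poly_sum poly_monom)
  have "poly q a * poly q b < 0" using lo hi unfolding q by (rule mult_neg_pos)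
  from real_closure_ivt[OF ab this] show "\<exists>x. a < x \<and> x < b \<and> (\<Sum>k\<le>n. c k * x ^ k) = 0" by (simp add: q)
qed

definition to_real_closure :: "'a::linordered_field \<Rightarrow> 'a real_closure" where
  "to_real_closure x = Abs_real_closure (to_ac x)"

lemma rep_to_real_closure: "rep (to_real_closure x) = to_ac x"
proof -
  have "to_ac x \<in> CC.cone_field"
  proof (cases "0 \<le> x")
    case True then show ?thesis using closure_cone(2) by (auto simp: CC.cone_field_def)
  next
    case False
    then have "to_ac (- x) \<in> closure_cone" using closure_cone(2) by (intro subsetD[OF closure_cone(2)] imageI) simp
    then show ?thesis by (simp add: CC.cone_field_def)
  qed
  then show ?thesis by (simp add: to_real_closure_def Abs_real_closure_inverse)
qed

lemma is_hom_to_real_closure: "is_hom to_real_closure"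
  unfolding is_hom_def by (auto intro!: real_closure_eqI simp: rep_to_real_closure real_closure_rep)

lemma to_real_closure_eq_0: "to_real_closure x = 0 \<longleftrightarrow> x = 0"
  using Rep_real_closure_inject[of "to_real_closure x" 0] by (simp add: rep_to_real_closure real_closure_rep)

section \<open>Transfer of sign conditions to real points\<close>

definition mon_eval :: "('n::finite \<Rightarrow> 'a::comm_ring_1) \<Rightarrow> ('n \<Rightarrow>\<^sub>0 nat) \<Rightarrow> 'a" where
  "mon_eval \<xi> m = (\<Prod>i\<in>UNIV. \<xi> i ^ Poly_Mapping.lookup m i)"

definition eval_via :: "(real \<Rightarrow> 'a::comm_ring_1) \<Rightarrow> ('n::finite \<Rightarrow> 'a) \<Rightarrow> 'n rpoly \<Rightarrow> 'a" where
  "eval_via \<iota> \<xi> p = (\<Sum>m\<in>Poly_Mapping.keys p. \<iota> (Poly_Mapping.lookup p m) * mon_eval \<xi> m)"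

lemma eval_poly_eq_eval_via: "eval_poly p x = eval_via id (\<lambda>i. x $ i) p"
  by (simp add: eval_poly_def eval_via_def mon_eval_def)

lemma mon_eval_add: "mon_eval \<xi> (m + n) = mon_eval \<xi> m * mon_eval \<xi> n"
  by (simp add: mon_eval_def lookup_add power_add prod.distrib)

lemma rpoly_sum_singles: "p = (\<Sum>m\<in>Poly_Mapping.keys p. Poly_Mapping.single m (Poly_Mapping.lookup p m))"
  by (rule poly_mapping_eqI)
    (auto simp: lookup_sum lookup_single when_def sum.delta in_keys_iff split: if_splits)

context
  fixes \<iota> :: "real \<Rightarrow> 'a::comm_ring_1" and \<xi> :: "'n::finite \<Rightarrow> 'a"
  assumes hom: "is_hom \<iota>"
begin

lemma eval_via_superset:
  assumes "finite A" "Poly_Mapping.keys p \<subseteq> A"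
  shows "eval_via \<iota> \<xi> p = (\<Sum>m\<in>A. \<iota> (Poly_Mapping.lookup p m) * mon_eval \<xi> m)"
  unfolding eval_via_def using assms
  by (intro sum.mono_neutral_left) (auto simp: in_keys_iff is_hom_zero[OF hom])

lemma eval_via_add: "eval_via \<iota> \<xi> (p + q) = eval_via \<iota> \<xi> p + eval_via \<iota> \<xi> q"
proof -
  let ?A = "Poly_Mapping.keys p \<union> Poly_Mapping.keys q"
  have "finite ?A" by simp
  moreover have "Poly_Mapping.keys (p + q) \<subseteq> ?A" by (rule Poly_Mapping.keys_add)
  ultimately show ?thesis
    by (simp add: eval_via_superset[of ?A] lookup_add is_hom_add[OF hom] distrib_right sum.distrib)
qed

lemma eval_via_zero: "eval_via \<iota> \<xi> 0 = 0"
  by (simp add: eval_via_def)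

lemma eval_via_single: "eval_via \<iota> \<xi> (Poly_Mapping.single m c) = \<iota> c * mon_eval \<xi> m"
  by (subst eval_via_superset[of "{m}"]) auto

lemma eval_via_sum: "eval_via \<iota> \<xi> (sum f A) = (\<Sum>x\<in>A. eval_via \<iota> \<xi> (f x))"
  by (induction A rule: infinite_finite_induct) (auto simp: eval_via_zero eval_via_add)

lemma eval_via_mult: "eval_via \<iota> \<xi> (p * q) = eval_via \<iota> \<xi> p * eval_via \<iota> \<xi> q"
proof -
  have "p * q = (\<Sum>m\<in>Poly_Mapping.keys p. \<Sum>n\<in>Poly_Mapping.keys q.
      Poly_Mapping.single (m + n) (Poly_Mapping.lookup p m * Poly_Mapping.lookup q n))"
    by (subst rpoly_sum_singles[of p], subst rpoly_sum_singles[of q])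
      (simp add: sum_product mult_single)
  then have "eval_via \<iota> \<xi> (p * q) = (\<Sum>m\<in>Poly_Mapping.keys p. \<Sum>n\<in>Poly_Mapping.keys q.
      (\<iota> (Poly_Mapping.lookup p m) * mon_eval \<xi> m) * (\<iota> (Poly_Mapping.lookup q n) * mon_eval \<xi> n))"
    by (simp add: eval_via_sum eval_via_single is_hom_mult[OF hom] mon_eval_add mult_ac)
  then show ?thesis by (simp add: eval_via_def sum_product)
qed

lemma is_hom_eval_via: "is_hom (eval_via \<iota> \<xi>)"
proof -
  have "eval_via \<iota> \<xi> 1 = 1"
    using eval_via_single[of 0 1] by (simp add: is_hom_one[OF hom] mon_eval_def)
  then show ?thesis by (simp add: is_hom_def eval_via_add eval_via_mult)
qed

end

lemma is_hom_id: "is_hom id" by (simp add: is_hom_def)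

lemma is_hom_comp: "is_hom f \<Longrightarrow> is_hom g \<Longrightarrow> is_hom (\<lambda>x. f (g x))"
  by (simp add: is_hom_def)

lemma is_hom_eval_poly: "is_hom (\<lambda>p. eval_poly p x)"
  unfolding eval_poly_eq_eval_via using is_hom_eval_via[OF is_hom_id, of "\<lambda>i. x $ i"] by simp

lemma is_hom_const_poly: "is_hom (const_poly :: real \<Rightarrow> 'n::finite rpoly)"
  by (simp add: is_hom_def const_poly_def single_add mult_single)

definition var_poly :: "'n::finite \<Rightarrow> 'n rpoly" where
  "var_poly i = Poly_Mapping.single (Poly_Mapping.single i 1) 1"

lemma single_eq_prod_vars:
  "Poly_Mapping.single m c = const_poly c * (\<Prod>i\<in>UNIV. var_poly (i::'n::finite) ^ Poly_Mapping.lookup m i)"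
proof -
  have pow: "var_poly i ^ k = Poly_Mapping.single (Poly_Mapping.single i k) 1" for i :: 'n and k
  proof (induction k)
    case 0 then show ?case by simp
  next
    case (Suc k)
    then show ?case by (simp add: var_poly_def mult_single single_add[symmetric])
  qed
  have prod: "(\<Prod>i\<in>A. Poly_Mapping.single (f i) 1) = (Poly_Mapping.single (\<Sum>i\<in>A. f i) 1 :: 'n rpoly)"
    for A :: "'n set" and f :: "'n \<Rightarrow> 'n \<Rightarrow>\<^sub>0 nat"
    by (induction A rule: infinite_finite_induct) (auto simp: mult_single)
  have "m = (\<Sum>i\<in>UNIV. Poly_Mapping.single i (Poly_Mapping.lookup m i))"
    by (rule poly_mapping_eqI) (simp add: lookup_sum lookup_single when_def)
  then show ?thesis by (simp add: pow prod const_poly_def mult_single)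
qed

lemma hom_eq_eval_via:
  assumes "is_hom \<kappa>"
  shows "\<kappa> p = eval_via (\<lambda>c. \<kappa> (const_poly c)) (\<lambda>i. \<kappa> (var_poly i)) p"
proof -
  have "\<kappa> p = \<kappa> (\<Sum>m\<in>Poly_Mapping.keys p. Poly_Mapping.single m (Poly_Mapping.lookup p m))"
    using rpoly_sum_singles[of p] by simp
  also have "\<dots> = eval_via (\<lambda>c. \<kappa> (const_poly c)) (\<lambda>i. \<kappa> (var_poly i)) p"
    by (simp add: is_hom_sum[OF assms] single_eq_prod_vars is_hom_mult[OF assms] is_hom_prod[OF assms]
      is_hom_power[OF assms] eval_via_def mon_eval_def)
  finally show ?thesis .
qed

text \<open>Positive reals are nonzero squares, so homomorphisms from the reals preserve signs.\<close>

lemma sg_hom_real: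
  fixes \<iota> :: "real \<Rightarrow> 'a::linordered_field"
  assumes "is_hom \<iota>"
  shows "sg (\<iota> c) = sg c"
proof -
  have pos: "0 < \<iota> c" if "0 < c" for c
  proof -
    have "\<iota> c = \<iota> (sqrt c) ^ 2" using that by (simp flip: is_hom_power[OF assms])
    moreover have "\<iota> c * \<iota> (inverse c) = 1" using that by (simp add: is_hom_one[OF assms] flip: is_hom_mult[OF assms])
    then have "\<iota> c \<noteq> 0" by auto
    ultimately show ?thesis by (simp add: less_le)
  qed
  consider "0 < c" | "c = 0" | "c < 0" by force
  then show ?thesis
  proof cases
    case 1 then show ?thesis using pos[of c] by (simp add: sg_def)
  next
    case 2 then show ?thesis by (simp add: is_hom_zero[OF assms])
  next
    case 3
    then have "\<iota> c < 0" using pos[of "- c"] by (simp add: is_hom_uminus[OF assms])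
    with 3 show ?thesis by (simp add: sg_def)
  qed
qed

text \<open>The same polynomial regarded as a polynomial in the variable \<open>v\<close>, whose coefficients do not involve \<open>v\<close>.\<close>

definition poly_in_var :: "'n::finite \<Rightarrow> 'n rpoly \<Rightarrow> 'n rpoly poly" where
  "poly_in_var v p = (\<Sum>m\<in>Poly_Mapping.keys p.
     Polynomial.monom (Poly_Mapping.single (m - Poly_Mapping.single v (Poly_Mapping.lookup m v)) (Poly_Mapping.lookup p m))
       (Poly_Mapping.lookup m v))"

lemma eval_poly_in_var:
  fixes \<iota> :: "real \<Rightarrow> 'a::comm_ring_1" and \<xi> :: "'n::finite \<Rightarrow> 'a"
  assumes hom: "is_hom \<iota>"
  shows "poly (map_poly (eval_via \<iota> \<xi>) (poly_in_var v p)) \<eta> = eval_via \<iota> (\<xi>(v := \<eta>)) p"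
proof -
  let ?\<phi> = "eval_via \<iota> \<xi>"
  have h: "is_hom ?\<phi>" by (rule is_hom_eval_via[OF hom])
  have s: "map_poly ?\<phi> (sum f A) = (\<Sum>x\<in>A. map_poly ?\<phi> (f x))" for f and A :: "('n \<Rightarrow>\<^sub>0 nat) set"
    by (induction A rule: infinite_finite_induct) (auto simp: map_poly_hom_add[OF h])
  have mono: "mon_eval \<xi> (m - Poly_Mapping.single v (Poly_Mapping.lookup m v)) * \<eta> ^ Poly_Mapping.lookup m v
      = mon_eval (\<xi>(v := \<eta>)) m" for m :: "'n \<Rightarrow>\<^sub>0 nat"
  proof -
    have "mon_eval \<xi> (m - Poly_Mapping.single v (Poly_Mapping.lookup m v))
        = (\<Prod>i\<in>UNIV - {v}. \<xi> i ^ Poly_Mapping.lookup m i)"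
      unfolding mon_eval_def
      by (subst prod.remove[of UNIV v]) (auto simp: lookup_minus lookup_single when_def intro!: prod.cong)
    moreover have "mon_eval (\<xi>(v := \<eta>)) m = \<eta> ^ Poly_Mapping.lookup m v * (\<Prod>i\<in>UNIV - {v}. \<xi> i ^ Poly_Mapping.lookup m i)"
      unfolding mon_eval_def by (subst prod.remove[of UNIV v]) (auto intro!: prod.cong)
    ultimately show ?thesis by (simp add: mult.commute)
  qed
  show ?thesis
    unfolding poly_in_var_def
    by (simp add: s poly_sum map_poly_monom is_hom_zero[OF h] poly_monom eval_via_single[OF hom] mono mult.assoc)
      (simp add: eval_via_def)
qed

text \<open>Coordinates outside \<open>S\<close> are kept at zero, which lets all finite sets \<open>F\<close> of polynomials, whatever
  their variables, be treated in one induction over \<open>S\<close>. Given the real point for \<open>S\<close>, chosen for the control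
  set of the polynomials regarded in the variable \<open>v\<close>, the elimination theorem provides its
  coordinate at \<open>v\<close>.\<close>

lemma real_point_with_same_signs_on:
  fixes \<iota> :: "real \<Rightarrow> 'a::real_closed_field" and \<xi> :: "'n::finite \<Rightarrow> 'a"
  assumes hom: "is_hom \<iota>" and "finite F"
  shows "\<exists>x :: 'n \<Rightarrow> real. \<forall>p\<in>F.
    sg (eval_via \<iota> (\<lambda>i. if i \<in> S then \<xi> i else 0) p) = sg (eval_via id (\<lambda>i. if i \<in> S then x i else 0) p)"
  using finite[of S] \<open>finite F\<close>
proof (induction S arbitrary: F rule: finite_induct)
  case empty
  have "eval_via \<iota> (\<lambda>i. 0) p = \<iota> (eval_via id (\<lambda>i. 0) p)" for p :: "'n rpoly"
    by (simp add: eval_via_def is_hom_sum[OF hom] is_hom_mult[OF hom] mon_eval_def is_hom_prod[OF hom] is_hom_power[OF hom] is_hom_zero[OF hom])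
  then show ?case by (simp add: sg_hom_real[OF hom] id_def)
next
  case (insert v S)
  let ?\<phi> = "eval_via \<iota> (\<lambda>i. if i \<in> S then \<xi> i else 0)"
  have "is_hom ?\<phi>" by (rule is_hom_eval_via[OF hom])
  from sign_match_controlled[OF this finite_imageI[OF insert.prems], of "poly_in_var v"]
  obtain C where C: "finite C" and ctl: "\<forall>\<psi> :: 'n rpoly \<Rightarrow> real. is_hom \<psi> \<longrightarrow>
      (\<forall>c\<in>C. sg (?\<phi> c) = sg (\<psi> c)) \<longrightarrow>
      sign_match ?\<phi> \<psi> (poly_in_var v ` F) \<and> sign_match \<psi> ?\<phi> (poly_in_var v ` F)"
    by blast
  obtain x :: "'n \<Rightarrow> real" where
    x: "\<forall>p\<in>C. sg (?\<phi> p) = sg (eval_via id (\<lambda>i. if i \<in> S then x i else 0) p)"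
    using insert.IH[OF C] by blast
  let ?\<psi> = "eval_via id (\<lambda>i. if i \<in> S then x i else 0)"
  have "sign_match ?\<phi> ?\<psi> (poly_in_var v ` F)"
    using ctl is_hom_eval_via[OF is_hom_id] x by blast
  then obtain y where y: "\<And>q. q \<in> poly_in_var v ` F \<Longrightarrow> sgp ?\<phi> q (\<xi> v) = sgp ?\<psi> q y"
    unfolding sign_match_def by blast
  have e1: "(\<lambda>i. if i \<in> S then \<xi> i else 0)(v := \<xi> v) = (\<lambda>i. if i \<in> insert v S then \<xi> i else 0)" by auto
  have e2: "(\<lambda>i. if i \<in> S then x i else 0)(v := y) = (\<lambda>i. if i \<in> insert v S then (x(v := y)) i else 0)"
    using insert.hyps by auto
  have "sg (eval_via \<iota> (\<lambda>i. if i \<in> insert v S then \<xi> i else 0) p)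
      = sg (eval_via id (\<lambda>i. if i \<in> insert v S then (x(v := y)) i else 0) p)" if "p \<in> F" for p
    using y[of "poly_in_var v p"] that
    unfolding eval_poly_in_var[OF hom] eval_poly_in_var[OF is_hom_id] e1 e2 by blast
  then show ?case by blast
qed

theorem real_point_with_same_signs:
  fixes \<iota> :: "real \<Rightarrow> 'a::real_closed_field" and \<xi> :: "'n::finite \<Rightarrow> 'a"
  assumes "is_hom \<iota>" and "finite F"
  shows "\<exists>x :: real ^ 'n. \<forall>p\<in>F. sg (eval_via \<iota> \<xi> p) = sg (eval_poly p x)"
proof -
  obtain x :: "'n \<Rightarrow> real" where "\<forall>p\<in>F. sg (eval_via \<iota> \<xi> p) = sg (eval_via id x p)"
    using real_point_with_same_signs_on[OF assms, of UNIV \<xi>] by auto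
  then show ?thesis by (intro exI[of _ "\<chi> i. x i"]) (simp add: eval_poly_eq_eval_via)
qed

section \<open>Prime cones\<close>

definition preordering :: "'r::comm_ring_1 set \<Rightarrow> bool" where
  "preordering T \<longleftrightarrow> (\<forall>x. x^2 \<in> T) \<and> (\<forall>x\<in>T. \<forall>y\<in>T. x + y \<in> T \<and> x * y \<in> T)"

definition support :: "'r::comm_ring_1 set \<Rightarrow> 'r set" where
  "support P = {x. x \<in> P \<and> - x \<in> P}"

text \<open>Such a \<open>P\<close> amounts to an ordering of the residue domain modulo its support.\<close>

definition prime_cone :: "'r::comm_ring_1 set \<Rightarrow> bool" where
  "prime_cone P \<longleftrightarrow> preordering P \<and> - 1 \<notin> P \<and> (\<forall>x. x \<in> P \<or> - x \<in> P)
     \<and> (\<forall>x y. x * y \<in> support P \<longrightarrow> x \<in> support P \<or> y \<in> support P)"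

lemma preorderingD:
  assumes "preordering T"
  shows "x^2 \<in> T" "x \<in> T \<Longrightarrow> y \<in> T \<Longrightarrow> x + y \<in> T" "x \<in> T \<Longrightarrow> y \<in> T \<Longrightarrow> x * y \<in> T"
    "0 \<in> T" "1 \<in> T" "x * x \<in> T"
proof -
  have sq: "x^2 \<in> T" for x using assms by (simp add: preordering_def)
  show "x^2 \<in> T" by (rule sq)
  show "0 \<in> T" using sq[of 0] by simp
  show "1 \<in> T" using sq[of 1] by simp
  show "x * x \<in> T" using sq[of x] by (simp add: power2_eq_square)
  show "x \<in> T \<Longrightarrow> y \<in> T \<Longrightarrow> x + y \<in> T" "x \<in> T \<Longrightarrow> y \<in> T \<Longrightarrow> x * y \<in> T"
    using assms by (simp_all add: preordering_def)
qed

lemma preordering_adjoin: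
  assumes T: "preordering T"
  shows "preordering {p + a * q | p q. p \<in> T \<and> q \<in> T}"
    and "T \<subseteq> {p + a * q | p q. p \<in> T \<and> q \<in> T}" and "a \<in> {p + a * q | p q. p \<in> T \<and> q \<in> T}"
proof -
  note T = preorderingD[OF assms]
  let ?N = "{p + a * q | p q. p \<in> T \<and> q \<in> T}"
  have NI: "p \<in> T \<Longrightarrow> q \<in> T \<Longrightarrow> p + a * q \<in> ?N" for p q by blast
  show sub: "T \<subseteq> ?N" using NI[OF _ T(4)] by auto
  show "a \<in> ?N" using NI[OF T(4,5)] by simp
  show "preordering ?N"
    unfolding preordering_def
  proof (intro conjI allI ballI)
    show "x^2 \<in> ?N" for x using T(1)[of x] sub by blast
    fix y z assume "y \<in> ?N" "z \<in> ?N"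
    then obtain p q r s where y: "y = p + a * q" "p \<in> T" "q \<in> T" and z: "z = r + a * s" "r \<in> T" "s \<in> T"
      by blast
    have "y + z = (p + r) + a * (q + s)" unfolding y z by (simp add: algebra_simps)
    then show "y + z \<in> ?N" using NI[of "p + r" "q + s"] T(2) y z by metis
    have yz: "y * z = (p * r + a * a * (q * s)) + a * (p * s + q * r)"
      unfolding y z by (simp add: algebra_simps)
    have "p * r + a * a * (q * s) \<in> T" "p * s + q * r \<in> T" using T(2,3,6) y z by simp_all
    then show "y * z \<in> ?N" unfolding yz by (rule NI)
  qed
qed

text \<open>Take a preordering that is maximal among those avoiding all \<open>-u\<^sup>2\<^sup>m\<close>. Adjoining any further element makes it
  meet these; multiplying two such relations shows that the cone is total, and that its support is
  prime. Since \<open>-u\<^sup>2\<close> is avoided, \<open>u\<close> stays outside the support.\<close>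

theorem prime_cone_avoiding:
  fixes T :: "'r::comm_ring_1 set"
  assumes T: "preordering T" and avoid: "\<And>m. - (u ^ (2 * m)) \<notin> T"
  shows "\<exists>P. prime_cone P \<and> T \<subseteq> P \<and> u \<notin> support P"
proof -
  let ?A = "{Q. preordering Q \<and> T \<subseteq> Q \<and> (\<forall>m. - (u ^ (2 * m)) \<notin> Q)}"
  have "\<exists>M\<in>?A. \<forall>Q\<in>?A. M \<subseteq> Q \<longrightarrow> Q = M"
  proof (rule subset_Zorn_nonempty)
    show "?A \<noteq> {}" using assms by auto
    fix C assume C: "C \<noteq> {}" "subset.chain ?A C"
    have mem: "Q \<in> C \<Longrightarrow> Q \<in> ?A" for Q using C(2) by (auto simp: subset_chain_def)
    have "preordering (\<Union>C)"
      unfolding preordering_def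
    proof (intro conjI allI ballI)
      obtain Q where "Q \<in> C" using C(1) by blast
      then show "x^2 \<in> \<Union>C" for x using mem[of Q] preorderingD(1)[of Q x] by blast
      fix x y assume "x \<in> \<Union>C" "y \<in> \<Union>C"
      then obtain Q R where Q: "Q \<in> C" "x \<in> Q" "R \<in> C" "y \<in> R" by blast
      then have "Q \<subseteq> R \<or> R \<subseteq> Q" using C(2) by (auto simp: subset_chain_def)
      then obtain S where S: "S \<in> C" "x \<in> S" "y \<in> S" using Q by blast
      then have "preordering S" using mem by blast
      from preorderingD(2,3)[OF this S(2,3)] S(1) show "x + y \<in> \<Union>C" "x * y \<in> \<Union>C" by blast+
    qed
    then show "\<Union>C \<in> ?A" using C(1) mem by blast
  qed
  then obtain P where P: "preordering P" "T \<subseteq> P" "\<And>m. - (u ^ (2 * m)) \<notin> P"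
    and max: "\<And>Q. preordering Q \<Longrightarrow> T \<subseteq> Q \<Longrightarrow> (\<And>m. - (u ^ (2 * m)) \<notin> Q) \<Longrightarrow> P \<subseteq> Q \<Longrightarrow> Q = P"
    by auto
  note D = preorderingD[OF P(1)]
  have hit: "\<exists>m p q. p \<in> P \<and> q \<in> P \<and> - (u ^ (2 * m)) = p + a * q" if a: "a \<notin> P" for a
  proof (rule ccontr)
    assume n: "\<not> ?thesis"
    let ?N = "{p + a * q | p q. p \<in> P \<and> q \<in> P}"
    have "?N = P"
    proof (rule max)
      show "preordering ?N" "P \<subseteq> ?N" using preordering_adjoin[OF P(1)] by auto
      then show "T \<subseteq> ?N" using P(2) by blast
      show "- (u ^ (2 * m)) \<notin> ?N" for m using n by blast
    qed
    with a preordering_adjoin(3)[OF P(1), of a] show False by blast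
  qed
  have even: "u ^ (2 * m) \<in> P" for m using D(1)[of "u ^ m"] by (simp add: power_mult[symmetric] mult.commute)
  have tot: "a \<in> P \<or> - a \<in> P" for a
  proof (rule ccontr)
    assume "\<not> (a \<in> P \<or> - a \<in> P)"
    then obtain m p q k r s where 1: "p \<in> P" "q \<in> P" "- (u ^ (2 * m)) = p + a * q"
      and 2: "r \<in> P" "s \<in> P" "- (u ^ (2 * k)) = r + - a * s"
      using hit[of a] hit[of "- a"] by blast
    have 3: "a * q = - (u ^ (2 * m)) - p" "a * s = u ^ (2 * k) + r" 
      using 1(3) 2(3) by (simp_all add: algebra_simps)
    have "- (u ^ (2 * (m + k))) = u ^ (2 * m) * r + p * u ^ (2 * k) + p * r + a * a * (q * s)"
    proof -
      have "a * a * (q * s) = (a * q) * (a * s)" by (simp add: mult_ac)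
      also have "\<dots> = - (u ^ (2 * m) * u ^ (2 * k)) - u ^ (2 * m) * r - p * u ^ (2 * k) - p * r"
        unfolding 3 by (simp add: algebra_simps)
      finally show ?thesis by (simp add: power_add distrib_left)
    qed
    moreover have "u ^ (2 * m) * r + p * u ^ (2 * k) + p * r + a * a * (q * s) \<in> P"
      using 1 2 even D by simp
    ultimately show False using P(3) by metis
  qed
  have supp_mult: "a * x \<in> support P" if "x \<in> support P" for a x
    using that tot[of a] D(3)[of a x] D(3)[of a "- x"] D(3)[of "- a" x] D(3)[of "- a" "- x"]
    by (auto simp: support_def)
  have supp_neg: "- x \<in> support P" if "x \<in> support P" for x using that by (simp add: support_def)
  have key: False if ab: "a * b \<in> support P" and a: "- a \<notin> P" and b: "- b \<notin> P" for a b
  proof -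
    obtain m p q k r s where 1: "p \<in> P" "q \<in> P" "- (u ^ (2 * m)) = p + - a * q"
      and 2: "r \<in> P" "s \<in> P" "- (u ^ (2 * k)) = r + - b * s"
      using hit[OF a] hit[OF b] by blast
    have 3: "a * q = u ^ (2 * m) + p" "b * s = u ^ (2 * k) + r" 
      using 1(3) 2(3) by (simp_all add: algebra_simps)
    have eq: "- (u ^ (2 * (m + k))) = u ^ (2 * m) * r + p * u ^ (2 * k) + p * r + - ((q * s) * (a * b))"
    proof -
      have "(q * s) * (a * b) = (a * q) * (b * s)" by (simp add: mult_ac)
      also have "\<dots> = u ^ (2 * m) * u ^ (2 * k) + u ^ (2 * m) * r + p * u ^ (2 * k) + p * r"
        unfolding 3 by (simp add: algebra_simps)
      finally show ?thesis by (simp add: power_add distrib_left)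
    qed
    have neg: "- ((q * s) * (a * b)) \<in> P" using supp_mult[OF ab, of "q * s"] by (simp add: support_def)
    have "u ^ (2 * m) * r + p * u ^ (2 * k) + p * r \<in> P" using 1 2 even D by simp
    from D(2)[OF this neg] eq show False using P(3) by metis
  qed
  have "prime_cone P"
    unfolding prime_cone_def
  proof (intro conjI allI impI)
    show "preordering P" by fact
    show "- 1 \<notin> P" using P(3)[of 0] by simp
    show "x \<in> P \<or> - x \<in> P" for x by (rule tot)
    fix x y assume xy: "x * y \<in> support P"
    show "x \<in> support P \<or> y \<in> support P"
    proof (rule ccontr)
      assume "\<not> ?thesis"
      then have "x \<notin> P \<or> - x \<notin> P" "y \<notin> P \<or> - y \<notin> P" by (auto simp: support_def)
      then show False
        using key[of x y] key[of "- x" y] key[of x "- y"] key[of "- x" "- y"] xy supp_neg[OF xy] by auto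
    qed
  qed
  moreover have "u \<notin> support P"
  proof
    assume "u \<in> support P"
    from supp_neg[OF supp_mult[OF this, of u]] have "- (u * u) \<in> P" by (simp add: support_def)
    with P(3)[of 1] show False by (simp add: power2_eq_square)
  qed
  ultimately show ?thesis using P(2) by blast
qed

text \<open>\<open>P\<close> behaves like a point at which \<open>S\<close> vanishes and \<open>u\<close> does not, although no real point does. No
  prime cone has this property.\<close>

definition refutes_real_points :: "'n::finite rpoly set \<Rightarrow> bool" where
  "refutes_real_points P \<longleftrightarrow> (\<exists>S u. finite S \<and> S \<subseteq> support P \<and> u \<notin> support P \<and>
     (\<forall>x. (\<forall>g\<in>S. eval_poly g x = 0) \<longrightarrow> eval_poly u x = 0))"

text \<open>The ordered domain belonging to a prime cone has to be a type of its own. Types cannot depend on a cone that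
  is fixed within a proof; but one cone for each set of variables suffices, provided it is a counterexample
  whenever there is one.\<close>

definition chosen_cone :: "'n::finite rpoly set" where
  "chosen_cone = (SOME P. prime_cone P \<and> ((\<exists>Q :: 'n rpoly set. prime_cone Q \<and> refutes_real_points Q) \<longrightarrow> refutes_real_points P))"

lemma chosen_cone:
  shows "prime_cone (chosen_cone :: 'n::finite rpoly set)"
    and "prime_cone (Q :: 'n rpoly set) \<Longrightarrow> refutes_real_points Q \<Longrightarrow> refutes_real_points (chosen_cone :: 'n rpoly set)"
proof -
  have "\<exists>P :: 'n rpoly set. prime_cone P"
  proof
    let ?P = "{p :: 'n rpoly. 0 \<le> eval_poly p 0}"
    have h: "is_hom (\<lambda>p :: 'n rpoly. eval_poly p 0)" by (rule is_hom_eval_poly)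
    have supp: "support ?P = {p. eval_poly p 0 = 0}"
      by (auto simp: support_def is_hom_uminus[OF h])
    show "prime_cone ?P"
      unfolding prime_cone_def supp preordering_def mem_Collect_eq
    proof (intro conjI allI ballI impI)
      show "0 \<le> eval_poly (x^2) 0" for x :: "'n rpoly" by (simp add: is_hom_power[OF h])
      show "\<not> 0 \<le> eval_poly (- 1 :: 'n rpoly) 0" by (simp add: is_hom_uminus[OF h] is_hom_one[OF h])
      show "0 \<le> eval_poly x 0 \<or> 0 \<le> eval_poly (- x) 0" for x :: "'n rpoly"
        by (simp add: is_hom_uminus[OF h] linear)
      show "eval_poly x 0 = 0 \<or> eval_poly y 0 = 0" if "eval_poly (x * y) 0 = 0" for x y :: "'n rpoly"
        using that by (simp add: is_hom_mult[OF h])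
      fix x y :: "'n rpoly" assume "x \<in> ?P" "y \<in> ?P"
      then show "0 \<le> eval_poly (x + y) 0" "0 \<le> eval_poly (x * y) 0"
        by (simp_all add: is_hom_add[OF h] is_hom_mult[OF h])
    qed
  qed
  then have "\<exists>P :: 'n rpoly set. prime_cone P \<and>
    ((\<exists>Q :: 'n rpoly set. prime_cone Q \<and> refutes_real_points Q) \<longrightarrow> refutes_real_points P)"
    by (cases "\<exists>Q :: 'n rpoly set. prime_cone Q \<and> refutes_real_points Q") auto
  then have *: "prime_cone (chosen_cone :: 'n rpoly set) \<and>
    ((\<exists>Q :: 'n rpoly set. prime_cone Q \<and> refutes_real_points Q) \<longrightarrow> refutes_real_points (chosen_cone :: 'n rpoly set))"
    unfolding chosen_cone_def by (rule someI_ex)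
  show "prime_cone (chosen_cone :: 'n rpoly set)" using * by (rule conjunct1)
  show "refutes_real_points (chosen_cone :: 'n rpoly set)" if "prime_cone Q" "refutes_real_points Q"
    using conjunct2[OF *] that by (intro mp[OF conjunct2[OF *]] exI[of _ Q] conjI)
qed

locale fixed_prime_cone =
  fixes P :: "'r::comm_ring_1 set"
  assumes cone: "prime_cone P"
begin

lemma square: "x * x \<in> P" and add: "x \<in> P \<Longrightarrow> y \<in> P \<Longrightarrow> x + y \<in> P" and mult: "x \<in> P \<Longrightarrow> y \<in> P \<Longrightarrow> x * y \<in> P"
  and zero: "0 \<in> P" and one: "1 \<in> P"
  using cone preorderingD[of P] by (simp_all add: prime_cone_def)

lemma total: "x \<in> P \<or> - x \<in> P" and minus_one: "- 1 \<notin> P"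
  using cone by (simp_all add: prime_cone_def)

lemma prime: "x * y \<in> support P \<Longrightarrow> x \<in> support P \<or> y \<in> support P"
  using cone by (simp add: prime_cone_def)

lemma support_zero: "0 \<in> support P" by (simp add: support_def zero)

lemma support_add: "x \<in> support P \<Longrightarrow> y \<in> support P \<Longrightarrow> x + y \<in> support P"
  using add[of x y] add[of "- x" "- y"] by (simp add: support_def add.commute)

lemma support_uminus: "x \<in> support P \<Longrightarrow> - x \<in> support P"
  by (simp add: support_def)

lemma support_mult: "x \<in> support P \<Longrightarrow> a * x \<in> support P"
  using total[of a] mult[of a x] mult[of a "- x"] mult[of "- a" x] mult[of "- a" "- x"]
  by (auto simp: support_def)

lemma mem_cong: "x - y \<in> support P \<Longrightarrow> x \<in> P \<longleftrightarrow> y \<in> P"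
  using add[of y "x - y"] add[of x "- (x - y)"] by (auto simp: support_def)

end

interpretation CP: fixed_prime_cone "chosen_cone :: 'n::finite rpoly set"
  by standard (rule chosen_cone)

quotient_type (overloaded) 'n cone_domain = "'n::finite rpoly" / "\<lambda>p q. p - q \<in> support (chosen_cone :: 'n rpoly set)"
proof (rule equivpI)
  show "reflp (\<lambda>p q. p - q \<in> support (chosen_cone :: 'n rpoly set))"
    by (simp add: reflp_def CP.support_zero)
  show "symp (\<lambda>p q. p - q \<in> support (chosen_cone :: 'n rpoly set))"
    using CP.support_uminus by (fastforce simp: symp_def)
  show "transp (\<lambda>p q. p - q \<in> support (chosen_cone :: 'n rpoly set))"
  proof (rule transpI)
    fix p q r :: "'n rpoly" assume "p - q \<in> support chosen_cone" "q - r \<in> support chosen_cone"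
    from CP.support_add[OF this] show "p - r \<in> support chosen_cone" by simp
  qed
qed

instantiation cone_domain :: (finite) linordered_idom
begin

lift_definition zero_cone_domain :: "'a cone_domain" is 0 .
lift_definition one_cone_domain :: "'a cone_domain" is 1 .
lift_definition uminus_cone_domain :: "'a cone_domain \<Rightarrow> 'a cone_domain" is uminus
  using CP.support_uminus by fastforce
lift_definition plus_cone_domain :: "'a cone_domain \<Rightarrow> 'a cone_domain \<Rightarrow> 'a cone_domain" is "(+)"
proof -
  fix p q r s :: "'a rpoly"
  assume "p - q \<in> support chosen_cone" "r - s \<in> support chosen_cone"
  from CP.support_add[OF this] show "(p + r) - (q + s) \<in> support chosen_cone" by (simp add: algebra_simps)
qed
lift_definition minus_cone_domain :: "'a cone_domain \<Rightarrow> 'a cone_domain \<Rightarrow> 'a cone_domain" is "(-)"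
proof -
  fix p q r s :: "'a rpoly"
  assume "p - q \<in> support chosen_cone" "r - s \<in> support chosen_cone"
  from CP.support_add[OF this(1) CP.support_uminus[OF this(2)]]
  show "(p - r) - (q - s) \<in> support chosen_cone" by (simp add: algebra_simps)
qed
lift_definition times_cone_domain :: "'a cone_domain \<Rightarrow> 'a cone_domain \<Rightarrow> 'a cone_domain" is "(*)"
proof -
  fix p q r s :: "'a rpoly"
  assume "p - q \<in> support chosen_cone" "r - s \<in> support chosen_cone"
  from CP.support_add[OF CP.support_mult[OF this(1), of r] CP.support_mult[OF this(2), of q]]
  show "p * r - q * s \<in> support chosen_cone" by (simp add: algebra_simps)
qed
lift_definition less_eq_cone_domain :: "'a cone_domain \<Rightarrow> 'a cone_domain \<Rightarrow> bool"
  is "\<lambda>p q. q - p \<in> chosen_cone"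
proof -
  fix p q r s :: "'a rpoly"
  assume "p - q \<in> support chosen_cone" "r - s \<in> support chosen_cone"
  from CP.support_add[OF CP.support_uminus[OF this(1)] this(2)]
  have "(r - p) - (s - q) \<in> support chosen_cone" by (simp add: algebra_simps)
  from CP.mem_cong[OF this] show "(r - p \<in> chosen_cone) = (s - q \<in> chosen_cone)" .
qed
definition less_cone_domain :: "'a cone_domain \<Rightarrow> 'a cone_domain \<Rightarrow> bool" where
  "less_cone_domain x y \<longleftrightarrow> x \<le> y \<and> \<not> y \<le> x"
definition abs_of_cone_domain_def: "\<bar>x :: 'a cone_domain\<bar> = (if x < 0 then - x else x)"
definition sgn_of_cone_domain_def: "sgn (x :: 'a cone_domain) = (if x = 0 then 0 else if 0 < x then 1 else - 1)"

lemmas cone_domain_abs_eqs = zero_cone_domain.abs_eq one_cone_domain.abs_eq uminus_cone_domain.abs_eq plus_cone_domain.abs_eq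
  minus_cone_domain.abs_eq times_cone_domain.abs_eq zero_cone_domain_def one_cone_domain_def

instance
proof
  fix x y z :: "'a cone_domain"
  have ex: "\<exists>p. w = abs_cone_domain p" for w :: "'a cone_domain"
    by (induct w rule: cone_domain.abs_induct) blast
  obtain p q r where [simp]: "x = abs_cone_domain p" "y = abs_cone_domain q" "z = abs_cone_domain r"
    using ex[of x] ex[of y] ex[of z] by blast
  note eqs = cone_domain_abs_eqs and iff = cone_domain.abs_eq_iff and le = less_eq_cone_domain.abs_eq
  show "x + y + z = x + (y + z)" by (simp add: eqs add.assoc)
  show "x + y = y + x" by (simp add: eqs add.commute)
  show "0 + x = x" by (simp add: eqs)
  show "- x + x = 0" by (simp add: eqs)
  show "x - y = x + - y" by (simp add: eqs)
  show "x * y * z = x * (y * z)" by (simp add: eqs mult.assoc)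
  show "x * y = y * x" by (simp add: eqs mult.commute)
  show "1 * x = x" by (simp add: eqs)
  show "(x + y) * z = x * z + y * z" by (simp add: eqs distrib_right)
  show "(0 :: 'a cone_domain) \<noteq> 1"
  proof -
    have "(- 1 :: 'a rpoly) \<notin> chosen_cone" by (rule CP.minus_one)
    then show ?thesis by (simp add: eqs iff support_def)
  qed
  show "x + y - x = y" by (simp add: eqs)
  show "x - y - z = x - (y + z)" by (simp add: eqs diff_diff_eq)
  show "0 * x = 0" by (simp add: eqs)
  show "x * 0 = 0" by (simp add: eqs)
  show "(x < y) = (x \<le> y \<and> \<not> y \<le> x)" by (rule less_cone_domain_def)
  show refl: "x \<le> x" by (simp add: le CP.zero)
  show "x \<le> z" if "x \<le> y" "y \<le> z"
    using that CP.add[of "q - p" "r - q"] by (simp add: le)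
  show anti: "x = y" if "x \<le> y" "y \<le> x"
    using that by (simp add: le iff support_def)
  show "x \<le> y \<or> y \<le> x" using CP.total[of "q - p"] by (simp add: le)
  show "z + x \<le> z + y" if "x \<le> y" using that by (simp add: le eqs)
  show "z * x < z * y" if "x < y" "0 < z"
  proof -
    have 1: "q - p \<in> chosen_cone" "p - q \<notin> chosen_cone" "r \<in> chosen_cone" "- r \<notin> chosen_cone"
      using that by (simp_all add: less_cone_domain_def le eqs)
    have "r * (q - p) \<in> chosen_cone" using CP.mult 1 by blast
    moreover have "r * (p - q) \<notin> chosen_cone"
    proof
      assume "r * (p - q) \<in> chosen_cone"
      with \<open>r * (q - p) \<in> chosen_cone\<close> have "r * (q - p) \<in> support chosen_cone"
        by (simp add: support_def algebra_simps)
      from CP.prime[OF this] 1 show False by (auto simp: support_def)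
    qed
    ultimately show ?thesis by (simp add: less_cone_domain_def le eqs algebra_simps)
  qed
  show "\<bar>x\<bar> = (if x < 0 then - x else x)" by (rule abs_of_cone_domain_def)
  show "sgn x = (if x = 0 then 0 else if 0 < x then 1 else - 1)" by (rule sgn_of_cone_domain_def)
qed

end

text \<open>The values of the polynomials at the tautological point of the chosen cone, whose coordinates are the classes of the
  variables.\<close>

definition cone_point :: "'n::finite rpoly \<Rightarrow> 'n cone_domain fract real_closure" where
  "cone_point p = to_real_closure (Fract (abs_cone_domain p) 1)"

lemma is_hom_cone_point: "is_hom cone_point"
proof -
  have "is_hom (\<lambda>p :: 'n::finite rpoly. Fract (abs_cone_domain p) 1)"
    by (simp add: is_hom_def cone_domain_abs_eqs[symmetric] One_fract_def plus_cone_domain.abs_eq[symmetric]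
      times_cone_domain.abs_eq[symmetric])
  from is_hom_comp[OF is_hom_to_real_closure this] show ?thesis unfolding cone_point_def .
qed

lemma cone_point_eq_0: "cone_point p = 0 \<longleftrightarrow> p \<in> support chosen_cone"
proof -
  have "Fract (abs_cone_domain p) 1 = 0 \<longleftrightarrow> abs_cone_domain p = 0"
    by (simp add: Zero_fract_def eq_fract)
  also have "\<dots> \<longleftrightarrow> p \<in> support chosen_cone"
    by (simp add: zero_cone_domain_def cone_domain.abs_eq_iff)
  finally show ?thesis by (simp add: cone_point_def to_real_closure_eq_0)
qed

text \<open>The tautological point satisfies \<open>S = 0\<close> and \<open>u \<noteq> 0\<close> over a real closed field; transfer produces a real
  point with the same signs.\<close>

lemma no_cone_refutes:
  assumes "prime_cone (P :: 'n::finite rpoly set)"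
  shows "\<not> refutes_real_points P"
proof
  assume "refutes_real_points P"
  from chosen_cone(2)[OF assms this] obtain S u
    where Su: "finite S" "S \<subseteq> support (chosen_cone :: 'n rpoly set)" "u \<notin> support (chosen_cone :: 'n rpoly set)"
      "\<forall>x. (\<forall>g\<in>S. eval_poly g x = 0) \<longrightarrow> eval_poly u x = 0"
    unfolding refutes_real_points_def by (elim exE conjE) (rule that)
  let ?\<iota> = "\<lambda>c. cone_point (const_poly c :: 'n rpoly)"
  have hom: "is_hom ?\<iota>" by (rule is_hom_comp[OF is_hom_cone_point is_hom_const_poly])
  have fin: "finite (insert u S)" using Su(1) by simp
  from real_point_with_same_signs[OF hom fin, of "\<lambda>i. cone_point (var_poly i)"]
  obtain x where x: "\<forall>p\<in>insert u S. sg (eval_via ?\<iota> (\<lambda>i. cone_point (var_poly i)) p) = sg (eval_poly p x)"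
    by (elim exE) (rule that)
  have vanish: "eval_poly p x = 0 \<longleftrightarrow> p \<in> support chosen_cone" if "p \<in> insert u S" for p
  proof -
    have "sg (cone_point p) = sg (eval_poly p x)"
      unfolding hom_eq_eval_via[OF is_hom_cone_point, of p] using x that by (rule bspec)
    then show ?thesis using cone_point_eq_0[of p] by (simp add: sg_eq_iff)
  qed
  have "\<forall>g\<in>S. eval_poly g x = 0" using vanish Su(2) by blast
  with Su(4) have "eval_poly u x = 0" by simp
  with vanish[of u] Su(3) show False by simp
qed

section \<open>The real Nullstellensatz\<close>

inductive_set sos :: "'r::comm_ring_1 set" where
  zero: "0 \<in> sos"
| add: "\<sigma> \<in> sos \<Longrightarrow> \<sigma> + h^2 \<in> sos"

lemma sos_square: "h^2 \<in> sos"
  using sos.add[OF sos.zero, of h] by simp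

lemma sos_add: "\<sigma> \<in> sos \<Longrightarrow> \<tau> \<in> sos \<Longrightarrow> \<tau> + \<sigma> \<in> sos"
proof (induction rule: sos.induct)
  case (add \<sigma> h)
  from sos.add[OF add.IH[OF add.prems], of h] show ?case by (simp add: add.assoc)
qed simp

lemma sos_mult_square: "\<sigma> \<in> sos \<Longrightarrow> \<sigma> * h^2 \<in> sos"
proof (induction rule: sos.induct)
  case zero show ?case by (simp add: sos.zero)
next
  case (add \<sigma> g)
  have "(\<sigma> + g^2) * h^2 = \<sigma> * h^2 + (g * h)^2" by (simp add: distrib_right power_mult_distrib)
  with sos.add[OF add.IH, of "g * h"] show ?case by simp
qed

lemma sos_mult: "\<sigma> \<in> sos \<Longrightarrow> \<tau> \<in> sos \<Longrightarrow> \<tau> * \<sigma> \<in> sos"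
proof (induction rule: sos.induct)
  case zero show ?case by (simp add: sos.zero)
next
  case (add \<sigma> g)
  have "\<tau> * (\<sigma> + g^2) = \<tau> * \<sigma> + \<tau> * g^2" by (rule distrib_left)
  with sos_add[OF sos_mult_square[OF add.prems, of g] add.IH[OF add.prems]] show ?case by simp
qed

interpretation rpoly_module: Modules.module "(*) :: 'n::finite rpoly \<Rightarrow> 'n rpoly \<Rightarrow> 'n rpoly"
  by standard (simp_all add: algebra_simps)

lemma ideal_gen_zero: "0 \<in> ideal_gen S"
  unfolding ideal_gen_def by (rule rpoly_module.span_zero)

lemma ideal_gen_add: "i \<in> ideal_gen S \<Longrightarrow> j \<in> ideal_gen S \<Longrightarrow> i + j \<in> ideal_gen S"
  unfolding ideal_gen_def by (rule rpoly_module.span_add)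

lemma ideal_gen_mult: "i \<in> ideal_gen S \<Longrightarrow> a * i \<in> ideal_gen S"
  unfolding ideal_gen_def by (rule rpoly_module.span_scale)

lemma ideal_gen_uminus: "i \<in> ideal_gen S \<Longrightarrow> - i \<in> ideal_gen S"
  unfolding ideal_gen_def by (rule rpoly_module.span_neg)

lemma ideal_gen_superset: "S \<subseteq> ideal_gen S"
  unfolding ideal_gen_def by (rule rpoly_module.span_superset)

text \<open>Otherwise the preordering of sums of squares modulo the ideal avoids all \<open>-u\<^sup>2\<^sup>m\<close>, and it extends to a prime cone
  that refutes real points.\<close>

theorem real_nullstellensatz:
  fixes S :: "'n::finite rpoly set"
  assumes "finite S" and van: "\<And>x. (\<And>g. g \<in> S \<Longrightarrow> eval_poly g x = 0) \<Longrightarrow> eval_poly u x = 0"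
  shows "\<exists>m. \<exists>\<sigma>\<in>sos. u ^ (2 * m) + \<sigma> \<in> ideal_gen S"
proof (rule ccontr)
  assume n: "\<not> ?thesis"
  define T where "T = {\<sigma> + i | \<sigma> i. \<sigma> \<in> sos \<and> i \<in> ideal_gen S}"
  have TI: "\<sigma> \<in> sos \<Longrightarrow> i \<in> ideal_gen S \<Longrightarrow> \<sigma> + i \<in> T" for \<sigma> i by (auto simp: T_def)
  have "preordering T"
    unfolding preordering_def
  proof (intro conjI allI ballI)
    show "x^2 \<in> T" for x using TI[OF sos_square ideal_gen_zero] by simp
    fix x y assume "x \<in> T" "y \<in> T"
    then obtain \<sigma> i \<tau> j where x: "x = \<sigma> + i" "\<sigma> \<in> sos" "i \<in> ideal_gen S" and y: "y = \<tau> + j" "\<tau> \<in> sos" "j \<in> ideal_gen S"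
      unfolding T_def by blast
    have "x + y = (\<sigma> + \<tau>) + (i + j)" unfolding x y by (simp add: algebra_simps)
    then show "x + y \<in> T" using TI[OF sos_add[OF y(2) x(2)] ideal_gen_add[OF x(3) y(3)]] by simp
    have "x * y = \<sigma> * \<tau> + (\<sigma> * j + y * i)" unfolding x y by (simp add: algebra_simps)
    moreover have "\<sigma> * \<tau> + (\<sigma> * j + y * i) \<in> T"
      by (intro TI sos_mult ideal_gen_add ideal_gen_mult x y)
    ultimately show "x * y \<in> T" by simp
  qed
  moreover have "- (u ^ (2 * m)) \<notin> T" for m
  proof
    assume "- (u ^ (2 * m)) \<in> T"
    then obtain \<sigma> i where s: "- (u ^ (2 * m)) = \<sigma> + i" "\<sigma> \<in> sos" "i \<in> ideal_gen S"
      unfolding T_def by blast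
    have "u ^ (2 * m) = - (\<sigma> + i)" unfolding s(1)[symmetric] by simp
    then have "u ^ (2 * m) + \<sigma> = - i" by simp
    with ideal_gen_uminus[OF s(3)] s(2) n show False by metis
  qed
  ultimately obtain P where P: "prime_cone P" "T \<subseteq> P" "u \<notin> support P"
    using prime_cone_avoiding[of T u] by blast
  have "S \<subseteq> support P"
  proof
    fix g assume "g \<in> S"
    then have "g \<in> ideal_gen S" using ideal_gen_superset by blast
    from TI[OF sos.zero this] TI[OF sos.zero ideal_gen_uminus[OF this]] P(2) show "g \<in> support P"
      by (auto simp: support_def)
  qed
  then have "refutes_real_points P"
    unfolding refutes_real_points_def using P(3) assms by (intro exI[of _ S] exI[of _ u]) auto
  with no_cone_refutes[OF P(1)] show False ..
qed

section \<open>Truncated ideals and truncated sums of squares\<close>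

lemma mem_polys_upto: "p \<in> polys_upto t \<longleftrightarrow> (\<forall>m\<in>Poly_Mapping.keys p. mon_degree m \<le> t)"
  by (simp add: polys_upto_def total_degree_def)

lemma mem_polys_upto_degree: "p \<in> polys_upto t \<longleftrightarrow> total_degree p \<le> t"
  by (simp add: polys_upto_def)

lemma polys_upto_mono: "p \<in> polys_upto s \<Longrightarrow> s \<le> t \<Longrightarrow> p \<in> polys_upto t"
  by (simp add: polys_upto_def)

lemma polys_upto_zero: "0 \<in> polys_upto t"
  by (simp add: mem_polys_upto)

lemma polys_upto_const: "const_poly c \<in> polys_upto t"
  by (auto simp: mem_polys_upto const_poly_def mon_degree_def)

lemma polys_upto_one: "1 \<in> polys_upto t"
  using polys_upto_const[of 1 t] by (simp add: is_hom_one[OF is_hom_const_poly])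

lemma polys_upto_add: "p \<in> polys_upto t \<Longrightarrow> q \<in> polys_upto t \<Longrightarrow> p + q \<in> polys_upto t"
  unfolding mem_polys_upto using Poly_Mapping.keys_add[of p q] by blast

lemma polys_upto_mult:
  assumes "p \<in> polys_upto s" "q \<in> polys_upto t"
  shows "p * q \<in> polys_upto (s + t)"
  unfolding mem_polys_upto
proof
  fix m assume "m \<in> Poly_Mapping.keys (p * q)"
  then obtain a b where ab: "m = a + b" "a \<in> Poly_Mapping.keys p" "b \<in> Poly_Mapping.keys q"
    using keys_mult[of p q] by blast
  have "mon_degree m = mon_degree a + mon_degree b"
    by (simp add: ab(1) mon_degree_def lookup_add sum.distrib)
  with assms ab show "mon_degree m \<le> s + t" by (simp add: mem_polys_upto add_mono)
qed

lemma polys_upto_const_mult: "p \<in> polys_upto t \<Longrightarrow> const_poly c * p \<in> polys_upto t"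
  using polys_upto_mult[OF polys_upto_const[of c 0]] by simp

lemma polys_upto_square: "p \<in> polys_upto t \<Longrightarrow> p ^ 2 \<in> polys_upto (2 * t)"
  using polys_upto_mult[of p t p t] by (simp add: power2_eq_square mult_2)

lemma uminus_rpoly: "- p = const_poly (- 1) * p"
  by (simp add: is_hom_uminus[OF is_hom_const_poly] is_hom_one[OF is_hom_const_poly])

lemma polys_upto_uminus: "p \<in> polys_upto t \<Longrightarrow> - p \<in> polys_upto t"
  unfolding uminus_rpoly by (rule polys_upto_const_mult)

lemma polys_upto_diff: "p \<in> polys_upto t \<Longrightarrow> q \<in> polys_upto t \<Longrightarrow> p - q \<in> polys_upto t"
  unfolding diff_conv_add_uminus by (intro polys_upto_add polys_upto_uminus)

lemma polys_upto_sum: "(\<And>i. i \<in> A \<Longrightarrow> f i \<in> polys_upto t) \<Longrightarrow> sum f A \<in> polys_upto t"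
  by (induction A rule: infinite_finite_induct) (auto intro: polys_upto_zero polys_upto_add)

lemma eventually_polys_upto: "eventually (\<lambda>t. p \<in> polys_upto t) sequentially"
  unfolding eventually_sequentially by (intro exI[of _ "total_degree p"]) (simp add: polys_upto_def)

lemma eventually_all_polys_upto: "eventually (\<lambda>t. \<forall>i\<le>n. q i \<in> polys_upto t) sequentially" for n :: nat
proof -
  have "\<forall>i\<in>{..n}. eventually (\<lambda>t. q i \<in> polys_upto t) sequentially"
    by (rule ballI, rule eventually_polys_upto)
  from eventually_ball_finite[OF finite_atMost this] show ?thesis
    by (simp only: Ball_def atMost_iff)
qed

lemma trunc_gen_zero: "0 \<in> trunc_gen G d"
proof -
  have "(0 :: 'n::finite rpoly) = (\<Sum>g\<in>{}. 0 * g)" by simp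
  moreover have "finite {} \<and> {} \<subseteq> G \<and> (\<forall>g\<in>{}. total_degree g \<le> d \<and> 0 \<in> polys_upto (d - total_degree g))" by simp
  ultimately show ?thesis unfolding trunc_gen_def mem_Collect_eq
    by (intro exI[of _ "{}"] exI[of _ "\<lambda>_. 0"]) simp
qed

lemma trunc_gen_single:
  assumes "g \<in> G" "total_degree g \<le> d" "p \<in> polys_upto (d - total_degree g)"
  shows "p * g \<in> trunc_gen G d"
proof -
  have "p * g = (\<Sum>g'\<in>{g}. p * g')" by simp
  moreover have "finite {g} \<and> {g} \<subseteq> G \<and> (\<forall>g'\<in>{g}. total_degree g' \<le> d \<and> p \<in> polys_upto (d - total_degree g'))"
    using assms by simp
  ultimately show ?thesis unfolding trunc_gen_def mem_Collect_eq
    by (intro exI[of _ "{g}"] exI[of _ "\<lambda>_. p"]) blast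
qed

lemma trunc_gen_add:
  assumes "x \<in> trunc_gen G d" "y \<in> trunc_gen G d"
  shows "x + y \<in> trunc_gen G d"
proof -
  from assms obtain S p T q where x: "x = (\<Sum>g\<in>S. p g * g)" "finite S" "S \<subseteq> G"
      "\<forall>g\<in>S. total_degree g \<le> d \<and> p g \<in> polys_upto (d - total_degree g)"
    and y: "y = (\<Sum>g\<in>T. q g * g)" "finite T" "T \<subseteq> G"
      "\<forall>g\<in>T. total_degree g \<le> d \<and> q g \<in> polys_upto (d - total_degree g)"
    unfolding trunc_gen_def by blast
  define r where "r g = (if g \<in> S then p g else 0) + (if g \<in> T then q g else 0)" for g
  have "(\<Sum>g\<in>S \<union> T. r g * g) = (\<Sum>g\<in>S \<union> T. (if g \<in> S then p g * g else 0) + (if g \<in> T then q g * g else 0))"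
    by (intro sum.cong) (auto simp: r_def distrib_right)
  also have "\<dots> = (\<Sum>g\<in>S \<union> T. if g \<in> S then p g * g else 0) + (\<Sum>g\<in>S \<union> T. if g \<in> T then q g * g else 0)"
    by (rule sum.distrib)
  also have "(\<Sum>g\<in>S \<union> T. if g \<in> S then p g * g else 0) = x"
    unfolding x(1) using x(2) y(2) by (intro sum.mono_neutral_cong_right) auto
  also have "(\<Sum>g\<in>S \<union> T. if g \<in> T then q g * g else 0) = y"
    unfolding y(1) using x(2) y(2) by (intro sum.mono_neutral_cong_right) auto
  finally have "x + y = (\<Sum>g\<in>S \<union> T. r g * g)" by simp
  moreover have "\<forall>g\<in>S \<union> T. total_degree g \<le> d \<and> r g \<in> polys_upto (d - total_degree g)"
    using x(4) y(4) unfolding r_def by (auto intro!: polys_upto_add polys_upto_zero)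
  ultimately show ?thesis unfolding trunc_gen_def mem_Collect_eq
    using x y by (intro exI[of _ "S \<union> T"] exI[of _ r]) auto
qed

lemma trunc_gen_const_mult:
  assumes "x \<in> trunc_gen G d"
  shows "const_poly c * x \<in> trunc_gen G d"
proof -
  from assms obtain S p where x: "x = (\<Sum>g\<in>S. p g * g)" "finite S" "S \<subseteq> G"
      "\<forall>g\<in>S. total_degree g \<le> d \<and> p g \<in> polys_upto (d - total_degree g)"
    unfolding trunc_gen_def by blast
  have "const_poly c * x = (\<Sum>g\<in>S. (const_poly c * p g) * g)"
    unfolding x(1) sum_distrib_left by (simp only: mult.assoc)
  then show ?thesis unfolding trunc_gen_def mem_Collect_eq
    using x by (intro exI[of _ S] exI[of _ "\<lambda>g. const_poly c * p g"]) (simp add: polys_upto_const_mult)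
qed

lemma trunc_gen_subset_polys_upto: "x \<in> trunc_gen G d \<Longrightarrow> x \<in> polys_upto d"
proof -
  assume "x \<in> trunc_gen G d"
  then obtain S p where x: "x = (\<Sum>g\<in>S. p g * g)"
      "\<forall>g\<in>S. total_degree g \<le> d \<and> p g \<in> polys_upto (d - total_degree g)"
    unfolding trunc_gen_def by blast
  show ?thesis unfolding x(1)
  proof (rule polys_upto_sum)
    fix g assume "g \<in> S"
    with x(2) have g: "total_degree g \<le> d" "p g \<in> polys_upto (d - total_degree g)" by auto
    from polys_upto_mult[OF g(2), of g "total_degree g"] g(1) show "p g * g \<in> polys_upto d"
      by (simp add: mem_polys_upto_degree)
  qed
qed

lemma trunc_gen_subset_ideal_gen: "x \<in> trunc_gen G d \<Longrightarrow> x \<in> ideal_gen G"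
proof -
  assume "x \<in> trunc_gen G d"
  then obtain S p where x: "x = (\<Sum>g\<in>S. p g * g)" "S \<subseteq> G" unfolding trunc_gen_def by blast
  show ?thesis unfolding x(1) ideal_gen_def
    by (intro rpoly_module.span_sum rpoly_module.span_scale rpoly_module.span_base) (use x(2) in auto)
qed

text \<open>A representation in terms of the generators has finitely many summands, so every large
  degree bound accommodates it.\<close>

lemma eventually_trunc_gen:
  assumes "i \<in> ideal_gen G"
  shows "eventually (\<lambda>t. i \<in> trunc_gen G (2 * t)) sequentially"
  using assms unfolding ideal_gen_def
proof (induction rule: rpoly_module.span_induct_alt)
  case base show ?case by (simp add: trunc_gen_zero)
next
  case (step a g y)
  have "eventually (\<lambda>t. total_degree g + total_degree a \<le> t) sequentially"
    by (rule eventually_ge_at_top)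
  with step.IH show ?case
  proof eventually_elim
    case (elim t)
    have "a * g \<in> trunc_gen G (2 * t)"
      using elim(2) step.hyps by (intro trunc_gen_single) (auto simp: mem_polys_upto_degree)
    with elim(1) show ?case by (rule trunc_gen_add[rotated])
  qed
qed

lemma trunc_sos_gen: "g \<in> trunc_gen G (2 * t) \<Longrightarrow> g \<in> trunc_sos G t"
  unfolding trunc_sos_def mem_Collect_eq by (intro exI[of _ 0] exI[of _ "\<lambda>_. 0"] exI[of _ g]) simp

lemma trunc_sos_add_gen:
  assumes "x \<in> trunc_sos G t" "g \<in> trunc_gen G (2 * t)"
  shows "x + g \<in> trunc_sos G t"
proof -
  from assms(1) obtain k :: nat and h g' where x: "x = (\<Sum>i<k. h i ^ 2) + g'" "\<forall>i<k. h i \<in> polys_upto t"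
    "g' \<in> trunc_gen G (2 * t)" unfolding trunc_sos_def by blast
  have "x + g = (\<Sum>i<k. h i ^ 2) + (g' + g)" by (simp add: x(1) add.assoc)
  with x(2) trunc_gen_add[OF x(3) assms(2)] show ?thesis unfolding trunc_sos_def by blast
qed

lemma trunc_sos_add_square:
  assumes "x \<in> trunc_sos G t" "q \<in> polys_upto t"
  shows "x + q ^ 2 \<in> trunc_sos G t"
proof -
  from assms(1) obtain k :: nat and h g where x: "x = (\<Sum>i<k. h i ^ 2) + g" "\<forall>i<k. h i \<in> polys_upto t"
    "g \<in> trunc_gen G (2 * t)" unfolding trunc_sos_def by blast
  have "x + q ^ 2 = (\<Sum>i<Suc k. (h(k := q)) i ^ 2) + g" by (simp add: x(1) algebra_simps)
  moreover have "\<forall>i<Suc k. (h(k := q)) i \<in> polys_upto t" using x(2) assms(2) by (auto simp: less_Suc_eq)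
  ultimately show ?thesis unfolding trunc_sos_def using x(3) by blast
qed

lemma trunc_sos_square: "q \<in> polys_upto t \<Longrightarrow> q ^ 2 \<in> trunc_sos G t"
  using trunc_sos_add_square[OF trunc_sos_gen[OF trunc_gen_zero], of q t G] by simp

lemma trunc_sos_add:
  assumes "x \<in> trunc_sos G t" "y \<in> trunc_sos G t"
  shows "x + y \<in> trunc_sos G t"
proof -
  from assms(2) obtain k :: nat and h g where y: "y = (\<Sum>i<k. h i ^ 2) + g" "\<forall>i<k. h i \<in> polys_upto t"
    "g \<in> trunc_gen G (2 * t)" unfolding trunc_sos_def by blast
  have "x + (\<Sum>i<k. h i ^ 2) \<in> trunc_sos G t" using y(2)
  proof (induction k)
    case 0 show ?case using assms(1) by simp
  next
    case (Suc k)
    then show ?case using trunc_sos_add_square[of "x + (\<Sum>i<k. h i ^ 2)" G t "h k"]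
      by (simp add: add.assoc)
  qed
  from trunc_sos_add_gen[OF this y(3)] show ?thesis by (simp add: y(1) add.assoc)
qed

lemma const_poly_sqrt:
  assumes "0 \<le> c"
  shows "const_poly (sqrt c) ^ 2 = const_poly c"
proof -
  have "sqrt c ^ 2 = c" using assms by simp
  then show ?thesis using is_hom_power[OF is_hom_const_poly, of "sqrt c" 2] by metis
qed

lemma trunc_sos_const_mult:
  assumes "x \<in> trunc_sos G t" "0 \<le> c"
  shows "const_poly c * x \<in> trunc_sos G t"
proof -
  from assms(1) obtain k :: nat and h g where x: "x = (\<Sum>i<k. h i ^ 2) + g" "\<forall>i<k. h i \<in> polys_upto t"
    "g \<in> trunc_gen G (2 * t)" unfolding trunc_sos_def by blast
  have "const_poly c * x = (\<Sum>i<k. (const_poly (sqrt c) * h i) ^ 2) + const_poly c * g"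
    unfolding x(1) using assms(2) by (simp add: distrib_left sum_distrib_left power_mult_distrib const_poly_sqrt)
  moreover have "\<forall>i<k. const_poly (sqrt c) * h i \<in> polys_upto t" using x(2) by (simp add: polys_upto_const_mult)
  ultimately show ?thesis
    unfolding trunc_sos_def mem_Collect_eq using trunc_gen_const_mult[OF x(3), of c]
    by (intro exI[of _ k] exI[of _ "\<lambda>i. const_poly (sqrt c) * h i"] exI[of _ "const_poly c * g"]) simp
qed

lemma trunc_sos_sum: "(\<And>i. i \<in> A \<Longrightarrow> f i \<in> trunc_sos G t) \<Longrightarrow> sum f A \<in> trunc_sos G t"
  by (induction A rule: infinite_finite_induct)
    (auto intro: trunc_sos_add trunc_sos_gen trunc_gen_zero)

lemma eventually_trunc_sos:
  assumes "\<sigma> \<in> sos"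
  shows "eventually (\<lambda>t. \<sigma> \<in> trunc_sos G t) sequentially"
  using assms
proof (induction rule: sos.induct)
  case zero show ?case by (simp add: trunc_sos_gen trunc_gen_zero)
next
  case (add \<sigma> h)
  from add.IH eventually_polys_upto[of h] show ?case
    by eventually_elim (rule trunc_sos_add_square)
qed

lemma power2_of_affine: "(x + y * v) ^ 2 = x ^ 2 + (x * y + x * y) * v + y ^ 2 * v ^ 2"
  for x :: "'r::comm_ring_1"
  by (simp add: power2_eq_square algebra_simps)

lemma complete_square:
  fixes v :: "'n::finite rpoly"
  assumes "0 < a"
  shows "(const_poly (sqrt a) + const_poly (b / (2 * sqrt a)) * v) ^ 2
    = const_poly a + const_poly b * v + const_poly (b\<^sup>2 / (4 * a)) * v ^ 2"
proof -
  let ?c = "const_poly :: real \<Rightarrow> 'n rpoly"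
  note cm = is_hom_mult[OF is_hom_const_poly, symmetric] and cp = is_hom_power[OF is_hom_const_poly, symmetric]
  have s: "sqrt a \<noteq> 0" "(sqrt a)\<^sup>2 = a" using assms by auto
  have 1: "?c (sqrt a) * ?c (b / (2 * sqrt a)) = ?c (b / 2)"
    unfolding cm using s(1) by (intro arg_cong[where f = ?c]) (simp add: field_simps)
  have 2: "?c (b / (2 * sqrt a)) ^ 2 = ?c (b\<^sup>2 / (4 * a))"
    unfolding cp using s by (intro arg_cong[where f = ?c]) (simp add: power_divide power_mult_distrib)
  have 3: "?c (b / 2) + ?c (b / 2) = ?c b"
    unfolding is_hom_add[OF is_hom_const_poly, symmetric] by (rule arg_cong[where f = ?c]) simp
  have "(?c (sqrt a) + ?c (b / (2 * sqrt a)) * v) ^ 2 = ?c (sqrt a) ^ 2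
      + (?c (sqrt a) * ?c (b / (2 * sqrt a)) + ?c (sqrt a) * ?c (b / (2 * sqrt a))) * v
      + ?c (b / (2 * sqrt a)) ^ 2 * v ^ 2"
    by (rule power2_of_affine)
  also have "\<dots> = ?c a + ?c b * v + ?c (b\<^sup>2 / (4 * a)) * v ^ 2"
    unfolding 1 2 3 const_poly_sqrt[OF less_imp_le[OF assms]] ..
  finally show ?thesis .
qed

text \<open>Each step removes the unwanted term \<open>c v\<close>, where \<open>v = u\<^sup>N\<close>, at the expense of half of \<open>\<epsilon>\<close>, by adding the square
  \<open>\<epsilon>/2 - c v + d v\<^sup>2\<close>. This doubles the exponent and keeps the degrees independent of \<open>\<epsilon>\<close>.\<close>

lemma shifted_sos:
  fixes u :: "'n::finite rpoly"
  assumes "\<And>j. j \<le> k \<Longrightarrow> u ^ (2 ^ j) \<in> polys_upto t" and "0 < \<epsilon>"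
  shows "\<exists>c\<ge>0. const_poly \<epsilon> + u + const_poly c * u ^ (2 ^ Suc k) \<in> trunc_sos G t"
  using assms
proof (induction k arbitrary: \<epsilon>)
  case 0
  let ?h = "const_poly (sqrt \<epsilon>) + const_poly (1 / (2 * sqrt \<epsilon>)) * u"
  have "u \<in> polys_upto t" using "0.prems"(1)[OF le_refl] unfolding power_0 power_one_right .
  then have "?h \<in> polys_upto t" by (intro polys_upto_add polys_upto_const polys_upto_const_mult)
  from trunc_sos_square[OF this, of G]
  have sq: "const_poly \<epsilon> + u + const_poly (1\<^sup>2 / (4 * \<epsilon>)) * u ^ 2 \<in> trunc_sos G t"
    unfolding complete_square[OF "0.prems"(2)] is_hom_one[OF is_hom_const_poly] mult_1_left .
  have two: "2 ^ Suc 0 = (2 :: nat)" by simp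
  have "0 \<le> 1\<^sup>2 / (4 * \<epsilon>)" using "0.prems"(2) by simp
  then show ?case unfolding two using sq by (intro exI[of _ "1\<^sup>2 / (4 * \<epsilon>)"] conjI)
next
  case (Suc k)
  have e: "0 < \<epsilon> / 2" using Suc.prems by simp
  have collect: "(a + u + b * v) + (a + d * v + z) = (a + a) + u + (b + d) * v + z" for a b d v z :: "'n rpoly"
    by (simp add: algebra_simps)
  obtain c where c: "c \<ge> 0" "const_poly (\<epsilon> / 2) + u + const_poly c * u ^ (2 ^ Suc k) \<in> trunc_sos G t"
    using Suc.IH[OF Suc.prems(1)[OF le_SucI] e] by blast
  let ?v = "u ^ (2 ^ Suc k)"
  let ?h = "const_poly (sqrt (\<epsilon> / 2)) + const_poly ((- c) / (2 * sqrt (\<epsilon> / 2))) * ?v"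
  let ?d = "(- c)\<^sup>2 / (4 * (\<epsilon> / 2))"
  have "?v \<in> polys_upto t" by (rule Suc.prems(1)[OF le_refl])
  then have "?h \<in> polys_upto t" by (intro polys_upto_add polys_upto_const polys_upto_const_mult)
  from trunc_sos_add_square[OF c(2) this]
  have "(const_poly (\<epsilon> / 2) + u + const_poly c * ?v)
      + (const_poly (\<epsilon> / 2) + const_poly (- c) * ?v + const_poly ?d * ?v ^ 2) \<in> trunc_sos G t"
    unfolding complete_square[OF e] .
  moreover have "(const_poly (\<epsilon> / 2) + u + const_poly c * ?v)
      + (const_poly (\<epsilon> / 2) + const_poly (- c) * ?v + const_poly ?d * ?v ^ 2)
      = (const_poly (\<epsilon> / 2) + const_poly (\<epsilon> / 2)) + u + (const_poly c + const_poly (- c)) * ?v + const_poly ?d * ?v ^ 2"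
    by (rule collect)
  moreover have "const_poly (\<epsilon> / 2) + const_poly (\<epsilon> / 2) = (const_poly \<epsilon> :: 'n rpoly)"
    "const_poly c + const_poly (- c) = (0 :: 'n rpoly)"
  proof -
    have "const_poly (\<epsilon> / 2 + \<epsilon> / 2) = (const_poly \<epsilon> :: 'n rpoly)" by (rule arg_cong[where f = const_poly]) simp
    then show "const_poly (\<epsilon> / 2) + const_poly (\<epsilon> / 2) = (const_poly \<epsilon> :: 'n rpoly)"
      unfolding is_hom_add[OF is_hom_const_poly] .
    show "const_poly c + const_poly (- c) = (0 :: 'n rpoly)"
      unfolding is_hom_uminus[OF is_hom_const_poly] by (rule right_minus)
  qed
  moreover have "?v ^ 2 = u ^ (2 ^ Suc (Suc k))"
  proof -
    have "2 ^ Suc k * 2 = (2 :: nat) ^ Suc (Suc k)" by simp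
    then show ?thesis unfolding power_mult[symmetric] by (rule arg_cong)
  qed
  ultimately have "const_poly \<epsilon> + u + const_poly ?d * u ^ (2 ^ Suc (Suc k)) \<in> trunc_sos G t"
    by (simp only: mult_zero_left add_0_right)
  moreover have "0 \<le> ?d" using e by simp
  ultimately show ?case by blast
qed

lemma square_mult_even_power: "(u ^ j) ^ 2 * (u ^ (2 * m) + \<sigma>) = u ^ (2 * m + 2 * j) + \<sigma> * (u ^ j) ^ 2"
  for u :: "'r::comm_ring_1"
  by (simp add: power_add power_mult[symmetric] algebra_simps)

text \<open>The order \<open>t\<close> is chosen before \<open>\<epsilon>\<close>: only the scalar \<open>c\<close> depends on \<open>\<epsilon>\<close>, and the truncated cone is closed
  under nonnegative scalars.\<close>

lemma uniform_trunc_sos: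
  fixes u :: "'a::finite rpoly"
  assumes "u ^ (2 * m) + \<sigma> \<in> ideal_gen G" "\<sigma> \<in> sos"
  shows "eventually (\<lambda>t. \<forall>\<epsilon>>0. const_poly \<epsilon> + u \<in> trunc_sos G t) sequentially"
proof -
  \<comment> \<open>any power of two above \<open>2 m\<close> would do; it is even, so an even power of \<open>u\<close> fills the difference\<close>
  let ?n = "2 ^ Suc (2 * m) :: nat"
  have "2 * m \<le> ?n" using less_exp[of "Suc (2 * m)"] by linarith
  moreover have "even (?n - 2 * m)" by simp
  ultimately obtain j where j: "?n = 2 * m + 2 * j" by (metis dvdE le_add_diff_inverse)
  define \<tau> where "\<tau> = \<sigma> * (u ^ j) ^ 2"
  have \<tau>: "\<tau> \<in> sos" unfolding \<tau>_def using assms(2) by (rule sos_mult_square)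
  have "(u ^ j) ^ 2 * (u ^ (2 * m) + \<sigma>) \<in> ideal_gen G" using assms(1) by (rule ideal_gen_mult)
  then have I: "u ^ ?n + \<tau> \<in> ideal_gen G" unfolding j \<tau>_def square_mult_even_power .
  have cancel: "(a + u + b * x) + b * y + - b * (x + y) = a + u" for a b x y :: "'a rpoly"
    by (simp add: algebra_simps)
  have "eventually (\<lambda>t. \<forall>i\<le>2 * m. u ^ (2 ^ i) \<in> polys_upto t) sequentially"
    by (rule eventually_all_polys_upto)
  with eventually_trunc_gen[OF I] eventually_trunc_sos[OF \<tau>, of G] show ?thesis
  proof eventually_elim
    case (elim t)
    show ?case
    proof (intro allI impI)
      fix \<epsilon> :: real assume "0 < \<epsilon>"
      then obtain c where c: "c \<ge> 0" "const_poly \<epsilon> + u + const_poly c * u ^ ?n \<in> trunc_sos G t"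
        using shifted_sos[of "2 * m" u t \<epsilon> G] elim(3) by blast
      have "(const_poly \<epsilon> + u + const_poly c * u ^ ?n) + const_poly c * \<tau> + const_poly (- c) * (u ^ ?n + \<tau>) \<in> trunc_sos G t"
        by (intro trunc_sos_add_gen trunc_sos_add trunc_sos_const_mult trunc_gen_const_mult c elim(1,2))
      moreover have "(const_poly \<epsilon> + u + const_poly c * u ^ ?n) + const_poly c * \<tau> + const_poly (- c) * (u ^ ?n + \<tau>)
          = const_poly \<epsilon> + u"
        unfolding is_hom_uminus[OF is_hom_const_poly] by (rule cancel)
      ultimately show "const_poly \<epsilon> + u \<in> trunc_sos G t" by (simp only:)
    qed
  qed
qed

section \<open>Moment functionals and the relaxation values\<close>

lemma power2_of_linear: "(x + y * v) ^ 2 = x ^ 2 + ((y + y) * (x * v) + y ^ 2 * v ^ 2)"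
  for x :: "'r::comm_ring_1"
  by (simp add: power2_eq_square algebra_simps)

locale mom_functional =
  fixes G :: "'n::finite rpoly set" and t :: nat and \<Lambda> :: "'n rpoly \<Rightarrow> real"
  assumes mom: "\<Lambda> \<in> mom_functionals G t"
begin

lemma add: "p \<in> polys_upto (2 * t) \<Longrightarrow> q \<in> polys_upto (2 * t) \<Longrightarrow> \<Lambda> (p + q) = \<Lambda> p + \<Lambda> q"
  and const_mult: "p \<in> polys_upto (2 * t) \<Longrightarrow> \<Lambda> (const_poly c * p) = c * \<Lambda> p"
  and gen: "g \<in> trunc_gen G (2 * t) \<Longrightarrow> \<Lambda> g = 0"
  and one: "\<Lambda> 1 = 1"
  and square: "q \<in> polys_upto t \<Longrightarrow> 0 \<le> \<Lambda> (q ^ 2)"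
proof -
  note m = mom[unfolded mom_functionals_def mem_Collect_eq]
  note d = m[THEN conjunct1, unfolded poly_dual_def mem_Collect_eq, THEN conjunct2]
  show "p \<in> polys_upto (2 * t) \<Longrightarrow> q \<in> polys_upto (2 * t) \<Longrightarrow> \<Lambda> (p + q) = \<Lambda> p + \<Lambda> q"
    using d[THEN conjunct1] by blast
  show "p \<in> polys_upto (2 * t) \<Longrightarrow> \<Lambda> (const_poly c * p) = c * \<Lambda> p" using d[THEN conjunct2] by blast
  show "g \<in> trunc_gen G (2 * t) \<Longrightarrow> \<Lambda> g = 0" using m[THEN conjunct2, THEN conjunct1] by blast
  show "\<Lambda> 1 = 1" by (rule m[THEN conjunct2, THEN conjunct2, THEN conjunct1])
  show "q \<in> polys_upto t \<Longrightarrow> 0 \<le> \<Lambda> (q ^ 2)" using m[THEN conjunct2, THEN conjunct2, THEN conjunct2] by blast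
qed

lemma const: "\<Lambda> (const_poly c) = c"
  using const_mult[OF polys_upto_one, of c] one by simp

lemma diff: "p \<in> polys_upto (2 * t) \<Longrightarrow> q \<in> polys_upto (2 * t) \<Longrightarrow> \<Lambda> (p - q) = \<Lambda> p - \<Lambda> q"
  using add[of "p - q" q] polys_upto_diff[of p "2 * t" q] by simp

lemma nonneg:
  assumes "x \<in> trunc_sos G t"
  shows "0 \<le> \<Lambda> x"
proof -
  from assms obtain k :: nat and h g where x: "x = (\<Sum>i<k. h i ^ 2) + g" "\<forall>i<k. h i \<in> polys_upto t"
    "g \<in> trunc_gen G (2 * t)" unfolding trunc_sos_def by blast
  have "(\<Sum>i<k. h i ^ 2) \<in> polys_upto (2 * t) \<and> 0 \<le> \<Lambda> (\<Sum>i<k. h i ^ 2)" using x(2)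
  proof (induction k)
    case 0
    have "\<Lambda> 0 = 0" using gen[OF trunc_gen_zero] .
    then show ?case by (simp add: polys_upto_zero)
  next
    case (Suc k)
    then have IH: "(\<Sum>i<k. h i ^ 2) \<in> polys_upto (2 * t)" "0 \<le> \<Lambda> (\<Sum>i<k. h i ^ 2)" by auto
    have hk: "h k \<in> polys_upto t" using Suc.prems by simp
    from polys_upto_add[OF IH(1) polys_upto_square[OF hk]] add[OF IH(1) polys_upto_square[OF hk]]
      square[OF hk] IH(2) show ?case by simp
  qed
  then show ?thesis
    using add[of "\<Sum>i<k. h i ^ 2" g] trunc_gen_subset_polys_upto[OF x(3)] gen[OF x(3)] x(1) by simp
qed

text \<open>The Cauchy--Schwarz argument: \<open>\<Lambda>((p + c q)\<^sup>2) \<ge> 0\<close> for all \<open>c\<close> and \<open>\<Lambda>(p\<^sup>2) = 0\<close> force \<open>\<Lambda>(p q) = 0\<close>.\<close>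

lemma hankel_ker_if_square_nonpos:
  assumes p: "p \<in> polys_upto t" and "\<Lambda> (p ^ 2) \<le> 0"
  shows "p \<in> hankel_ker t \<Lambda>"
proof -
  have p0: "\<Lambda> (p ^ 2) = 0" using square[OF p] assms(2) by simp
  have "\<Lambda> (p * q) = 0" if q: "q \<in> polys_upto t" for q
  proof -
    define a b where "a = \<Lambda> (p * q)" and "b = \<Lambda> (q ^ 2)"
    have b: "0 \<le> b" unfolding b_def by (rule square[OF q])
    have pq: "p * q \<in> polys_upto (2 * t)" using polys_upto_mult[OF p q] by (simp add: mult_2)
    note P = polys_upto_square[OF p] pq polys_upto_square[OF q]
    have ineq: "0 \<le> 2 * c * a + c\<^sup>2 * b" for c
    proof -
      have "(p + const_poly c * q) ^ 2 = p ^ 2 + (const_poly (2 * c) * (p * q) + const_poly (c\<^sup>2) * q ^ 2)"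
        unfolding mult_2 is_hom_add[OF is_hom_const_poly] is_hom_power[OF is_hom_const_poly]
        by (rule power2_of_linear)
      moreover have "\<Lambda> (p ^ 2 + (const_poly (2 * c) * (p * q) + const_poly (c\<^sup>2) * q ^ 2)) = 2 * c * a + c\<^sup>2 * b"
        by (simp only: add[OF P(1) polys_upto_add[OF P(2,3)[THEN polys_upto_const_mult]]]
          add[OF P(2,3)[THEN polys_upto_const_mult]] const_mult[OF P(2)] const_mult[OF P(3)] p0 a_def b_def add_0_left)
      moreover have "0 \<le> \<Lambda> ((p + const_poly c * q) ^ 2)"
        using p q by (intro square polys_upto_add polys_upto_const_mult)
      ultimately show ?thesis by simp
    qed
    \<comment> \<open>the choice \<open>c = -a / (b + 1)\<close> avoids a case distinction on \<open>b = 0\<close>\<close>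
    define d where "d = b + 1"
    have d: "0 < d" using b by (simp add: d_def)
    have bd: "b = d - 1" by (simp add: d_def)
    have "2 * (- a / d) * a + (- a / d)\<^sup>2 * (d - 1) = - (a\<^sup>2 * (d + 1)) / d\<^sup>2"
      using d by (simp add: field_simps power2_eq_square)
    with ineq[of "- a / d"] have "a\<^sup>2 * (d + 1) / d\<^sup>2 \<le> 0" unfolding bd by simp
    moreover have "0 \<le> a\<^sup>2 * (d + 1) / d\<^sup>2" using d by simp
    ultimately have "a\<^sup>2 * (d + 1) / d\<^sup>2 = 0" by (rule antisym)
    then have "a = 0" using d by auto
    then show ?thesis by (simp add: a_def)
  qed
  then show ?thesis using p by (simp add: hankel_ker_def)
qed

end

lemma evaluation_in_mom_functionals:
  fixes G :: "'n::finite rpoly set"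
  assumes "\<And>g. g \<in> ideal_gen G \<Longrightarrow> eval_poly g x = 0"
  shows "restrict (\<lambda>p. eval_poly p x) (polys_upto (2 * t)) \<in> mom_functionals G t" (is "?L \<in> _")
proof -
  have h: "is_hom (\<lambda>p. eval_poly p x)" by (rule is_hom_eval_poly)
  have c: "eval_poly (const_poly c) x = c" for c
    by (simp add: const_poly_def eval_poly_def)
  have L: "?L p = eval_poly p x" if "p \<in> polys_upto (2 * t)" for p :: "'n rpoly" using that by simp
  show ?thesis
    unfolding mom_functionals_def poly_dual_def mem_Collect_eq
  proof (intro conjI ballI allI)
    show "?L \<in> extensional (polys_upto (2 * t))" by simp
    show "?L 1 = 1" unfolding L[OF polys_upto_one] by (rule is_hom_one[OF h])
    fix p :: "'n rpoly" assume p: "p \<in> polys_upto (2 * t)"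
    show "?L (const_poly c * p) = c * ?L p" for c
      unfolding L[OF p] L[OF polys_upto_const_mult[OF p]] is_hom_mult[OF h] c ..
    fix q :: "'n rpoly" assume q: "q \<in> polys_upto (2 * t)"
    show "?L (p + q) = ?L p + ?L q"
      unfolding L[OF p] L[OF q] L[OF polys_upto_add[OF p q]] is_hom_add[OF h] ..
  next
    fix g assume g: "g \<in> trunc_gen G (2 * t)"
    show "?L g = 0"
      unfolding L[OF trunc_gen_subset_polys_upto[OF g]] by (rule assms[OF trunc_gen_subset_ideal_gen[OF g]])
  next
    fix p :: "'n rpoly" assume p: "p \<in> polys_upto t"
    show "0 \<le> ?L (p ^ 2)"
      unfolding L[OF polys_upto_square[OF p]] is_hom_power[OF h] by simp
  qed
qed

lemma f_sos_le_f_mom: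
  assumes "f \<in> polys_upto (2 * t)"
  shows "f_sos f G t \<le> f_mom f G t"
  unfolding f_sos_def f_mom_def
proof (intro SUP_least INF_greatest)
  fix l \<Lambda> assume l: "l \<in> {l. f - const_poly l \<in> trunc_sos G t}" and "\<Lambda> \<in> mom_functionals G t"
  then interpret mom_functional G t \<Lambda> by unfold_locales
  from l have "0 \<le> \<Lambda> (f - const_poly l)" using nonneg by simp
  also have "\<dots> = \<Lambda> f - l" using assms by (simp add: diff polys_upto_const const)
  finally show "ereal l \<le> ereal (\<Lambda> f)" by simp
qed

lemma f_sos_ge:
  assumes "\<And>\<epsilon>. 0 < \<epsilon> \<Longrightarrow> f - const_poly (c - \<epsilon>) \<in> trunc_sos G t"
  shows "ereal c \<le> f_sos f G t"
proof (rule ereal_le_epsilon2)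
  fix e :: real assume "0 < e"
  then have "ereal (c - e) \<le> f_sos f G t" unfolding f_sos_def by (intro SUP_upper) (simp add: assms)
  then have "ereal (c - e) + ereal e \<le> f_sos f G t + ereal e" by (rule add_right_mono)
  then show "ereal c \<le> f_sos f G t + ereal e" by simp
qed

lemma eval_poly_ideal_gen:
  assumes "i \<in> ideal_gen S" "\<And>g. g \<in> S \<Longrightarrow> eval_poly g x = 0"
  shows "eval_poly i x = 0"
  using assms(1) unfolding ideal_gen_def
proof (induction rule: rpoly_module.span_induct_alt)
  case base show ?case by (rule is_hom_zero[OF is_hom_eval_poly])
next
  case (step a g y)
  then show ?case by (simp add: is_hom_add[OF is_hom_eval_poly] is_hom_mult[OF is_hom_eval_poly] assms(2))
qed

theorem theorem3p15:
  fixes f :: "'n::finite rpoly"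
    and fstar :: real
    and s :: nat
    and W :: "nat \<Rightarrow> (real ^ 'n) set"
    and fval :: "nat \<Rightarrow> real"
    and p :: "nat \<Rightarrow> 'n rpoly"
    and G :: "'n rpoly set"
  assumes min: "is_global_min f fstar"
    and decomp: "real_zeros (grad_ideal f) = (\<Union>j\<le>s. W j)"
    and varieties: "\<And>j. j \<le> s \<Longrightarrow> real_variety (W j)"
    and disj: "disjoint_family_on W {..s}"
    and levels: "\<And>j. j \<le> s \<Longrightarrow> eval_poly f ` W j = {fval j}"
    and incr: "strict_mono_on {..s} fval"
    and delta: "\<And>i j x. i \<le> s \<Longrightarrow> j \<le> s \<Longrightarrow> x \<in> W j \<Longrightarrow>
                  eval_poly (p i) x = (if i = j then 1 else 0)"
    and G_lower: "grad_ideal f \<subseteq> ideal_gen G"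
    and G_upper: "ideal_gen G \<subseteq> min_ideal f fstar"
  shows "\<exists>t1::nat. total_degree f \<le> 2 * t1 \<and>
           (\<forall>t\<ge>t1. f_sos f G t = f_mom f G t \<and> f_mom f G t = ereal fstar \<and>
              (\<forall>\<Lambda>\<in>mom_functionals G t. ereal (\<Lambda> f) = f_mom f G t \<longrightarrow>
                 (\<forall>i\<in>{1..s}. p i \<in> hankel_ker t \<Lambda>)))"
proof -
  define w where "w i = const_poly (fval i - fstar) * p i ^ 2" for i
  define u where "u = f - const_poly fstar - (\<Sum>i\<le>s. w i)"
  note ehom = is_hom_eval_poly
  have fval_ge: "fstar \<le> fval j" if "j \<le> s" for j
    using levels[OF that] min unfolding is_global_min_def by (metis image_iff singletonI)
  have ec: "eval_poly (const_poly c) x = c" for c and x :: "real ^ 'n"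
    by (simp add: const_poly_def eval_poly_def)
  have vanish: "eval_poly u x = 0" if x: "\<And>g. g \<in> range (\<lambda>i. partial_poly i f) \<Longrightarrow> eval_poly g x = 0" for x
  proof -
    have "x \<in> real_zeros (grad_ideal f)"
      unfolding real_zeros_def grad_ideal_def using eval_poly_ideal_gen x by blast
    then obtain j where j: "j \<le> s" "x \<in> W j" unfolding decomp by auto
    have "eval_poly f x = fval j" using levels[OF j(1)] j(2) by blast
    moreover have "eval_poly (w i) x = (if i = j then fval j - fstar else 0)" if "i \<le> s" for i
      using delta[OF that j] by (simp add: w_def is_hom_mult[OF ehom] is_hom_power[OF ehom] ec)
    then have "(\<Sum>i\<le>s. eval_poly (w i) x) = (\<Sum>i\<le>s. if i = j then fval j - fstar else 0)"
      by (intro sum.cong) auto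
    then have "(\<Sum>i\<le>s. eval_poly (w i) x) = fval j - fstar" using j(1) by simp
    ultimately show ?thesis
      by (simp add: u_def is_hom_diff[OF ehom] is_hom_sum[OF ehom] ec)
  qed
  have "\<exists>m. \<exists>\<sigma>\<in>sos. u ^ (2 * m) + \<sigma> \<in> grad_ideal f"
    unfolding grad_ideal_def
  proof (rule real_nullstellensatz)
    show "finite (range (\<lambda>i. partial_poly i f))" by simp
    show "eval_poly u x = 0" if "\<And>g. g \<in> range (\<lambda>i. partial_poly i f) \<Longrightarrow> eval_poly g x = 0" for x
      using that by (rule vanish)
  qed
  then obtain m \<sigma> where ms: "\<sigma> \<in> sos" "u ^ (2 * m) + \<sigma> \<in> grad_ideal f" by blast
  have "eventually (\<lambda>t. \<forall>\<epsilon>>0. const_poly \<epsilon> + u \<in> trunc_sos G t) sequentially"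
    using uniform_trunc_sos[of u m \<sigma> G] ms G_lower by blast
  moreover have "eventually (\<lambda>t. \<forall>i\<le>s. p i \<in> polys_upto t) sequentially"
    by (rule eventually_all_polys_upto)
  moreover note eventually_polys_upto[of f]
  ultimately have "eventually (\<lambda>t. (\<forall>\<epsilon>>0. const_poly \<epsilon> + u \<in> trunc_sos G t) \<and>
      (\<forall>i\<le>s. p i \<in> polys_upto t) \<and> f \<in> polys_upto t) sequentially"
    by (intro eventually_conj)
  then obtain t1 where t1: "\<And>t. t1 \<le> t \<Longrightarrow> (\<forall>\<epsilon>>0. const_poly \<epsilon> + u \<in> trunc_sos G t) \<and>
      (\<forall>i\<le>s. p i \<in> polys_upto t) \<and> f \<in> polys_upto t"
    unfolding eventually_sequentially by blast
  show ?thesis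
  proof (intro exI[of _ t1] conjI allI impI)
    show "total_degree f \<le> 2 * t1" using t1[of t1] by (simp add: mem_polys_upto_degree)
    fix t assume "t1 \<le> t"
    with t1 have shift: "\<And>\<epsilon>. 0 < \<epsilon> \<Longrightarrow> const_poly \<epsilon> + u \<in> trunc_sos G t" and pt: "\<And>i. i \<le> s \<Longrightarrow> p i \<in> polys_upto t"
      and ft: "f \<in> polys_upto t" by blast+
    have f2t: "f \<in> polys_upto (2 * t)" using ft by (rule polys_upto_mono) simp
    have w_sos: "w i \<in> trunc_sos G t" if "i \<le> s" for i
      unfolding w_def using pt[OF that] fval_ge[OF that] by (intro trunc_sos_const_mult trunc_sos_square) auto
    \<comment> \<open>with \<open>A = {}\<close> for the optimal value, with \<open>A = {i}\<close> for the kernel\<close>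
    have part: "(\<Sum>i\<in>{..s} - A. w i) + (const_poly \<epsilon> + u) \<in> trunc_sos G t" if "0 < \<epsilon>" for A \<epsilon>
      by (intro trunc_sos_add trunc_sos_sum w_sos shift that) simp
    have cdiff: "const_poly (fstar - \<epsilon>) = const_poly fstar - (const_poly \<epsilon> :: 'n rpoly)" for \<epsilon>
      by (rule is_hom_diff[OF is_hom_const_poly])
    have "ereal fstar \<le> f_sos f G t"
    proof (rule f_sos_ge)
      fix \<epsilon> :: real assume "0 < \<epsilon>"
      have "f - const_poly (fstar - \<epsilon>) = (\<Sum>i\<in>{..s} - {}. w i) + (const_poly \<epsilon> + u)"
        by (simp add: u_def cdiff algebra_simps)
      with part[OF \<open>0 < \<epsilon>\<close>, of "{}"] show "f - const_poly (fstar - \<epsilon>) \<in> trunc_sos G t" by simp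
    qed
    moreover have le: "f_sos f G t \<le> f_mom f G t" using f2t by (rule f_sos_le_f_mom)
    moreover have "f_mom f G t \<le> ereal fstar"
    proof -
      obtain x where x: "eval_poly f x = fstar" using min by (auto simp: is_global_min_def)
      let ?\<Lambda> = "restrict (\<lambda>p. eval_poly p x) (polys_upto (2 * t))"
      have "?\<Lambda> \<in> mom_functionals G t"
        by (rule evaluation_in_mom_functionals) (use G_upper x in \<open>auto simp: min_ideal_def\<close>)
      then have "f_mom f G t \<le> ereal (?\<Lambda> f)" unfolding f_mom_def by (rule INF_lower)
      then show ?thesis using f2t x by simp
    qed
    ultimately show "f_sos f G t = f_mom f G t" and mom: "f_mom f G t = ereal fstar" by auto
    show "\<forall>\<Lambda>\<in>mom_functionals G t. ereal (\<Lambda> f) = f_mom f G t \<longrightarrow> (\<forall>i\<in>{1..s}. p i \<in> hankel_ker t \<Lambda>)"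
    proof (intro ballI impI)
      fix \<Lambda> i assume L: "\<Lambda> \<in> mom_functionals G t" and "ereal (\<Lambda> f) = f_mom f G t" and i: "i \<in> {1..s}"
      then have Lf: "\<Lambda> f = fstar" using mom by simp
      interpret mom_functional G t \<Lambda> using L by unfold_locales
      have is_le: "i \<le> s" using i by simp
      have gap: "0 < fval i - fstar"
        using strict_mono_onD[OF incr, of 0 i] i fval_ge[of 0] by simp
      have pi2: "p i ^ 2 \<in> polys_upto (2 * t)" using pt[OF is_le] by (rule polys_upto_square)
      then have wi: "w i \<in> polys_upto (2 * t)" unfolding w_def by (rule polys_upto_const_mult)
      have "(fval i - fstar) * \<Lambda> (p i ^ 2) \<le> 0 + \<epsilon>" if "0 < \<epsilon>" for \<epsilon>
      proof -
        have "(\<Sum>j\<le>s. w j) = w i + (\<Sum>j\<in>{..s} - {i}. w j)" using is_le by (intro sum.remove) auto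
        then have "f - const_poly (fstar - \<epsilon>) - w i = (\<Sum>j\<in>{..s} - {i}. w j) + (const_poly \<epsilon> + u)"
          by (simp add: u_def cdiff algebra_simps)
        with part[OF that, of "{i}"] have "0 \<le> \<Lambda> (f - const_poly (fstar - \<epsilon>) - w i)" using nonneg by simp
        also have "\<dots> = \<epsilon> - (fval i - fstar) * \<Lambda> (p i ^ 2)"
          using f2t wi pi2 by (simp add: diff polys_upto_diff polys_upto_const const Lf) (simp add: w_def const_mult)
        finally show ?thesis by simp
      qed
      then have "(fval i - fstar) * \<Lambda> (p i ^ 2) \<le> 0" by (rule field_le_epsilon)
      then have "\<Lambda> (p i ^ 2) \<le> 0" using gap by (simp add: mult_le_0_iff)
      with pt[OF is_le] show "p i \<in> hankel_ker t \<Lambda>" by (rule hankel_ker_if_square_nonpos)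
    qed
  qed
qed

end
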